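(* Assume $0<\kappa_*\le\kappa^*<1$. The following two eigenvalue problems, considered for $\lambda\in\mathbb{C}\setminus\{0\}$, are equivalent. (E1) Find $\lambda$ and $0\ne u\in H^1_0(\mathrm{div},\Omega)$ such that $$\big(P(\nabla\nabla\cdot u+\lambda u),\ \nabla\nabla\cdot v+\lambda A^{-1}v\big)=0\qquad\text{for all } v\in H^1_0(\mathrm{div},\Omega).$$ (E2) Find $\lambda$ and $0\neq(\varphi,y,r)\in V$ such that for all $(\psi,z,s)\in V$ $$\begin{aligned}(P\nabla\varphi,\nabla\psi)+(Py,\nabla\psi)&=\lambda\big((\varphi,\psi)+(r,\psi)\big),\\ (P\nabla\varphi,z)+((I+P)y,z)-(\nabla r,z)&=0,\\ -(y,\nabla s)&=\lambda(\varphi,s).\end{aligned}$$ Equivalence means: if $(\lambda,(\varphi,y,r))$ is an eigenpair of (E2), then $(\lambda,y/\lambda)$ is an eigenpair of (E1); and if $(\lambda,u)$ is an eigenpair of (E1), then there is a unique $r\in\tilde H^1(\Omega)$ such that $(\lambda,(\nabla\cdot u,\lambda u,r))$ is an eigenpair of (E2).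
   Context: Let $\Omega\subset\mathbb{R}^d$, $d\in\{2,3\}$, be a bounded connected polygon ($d=2$) or polyhedron ($d=3$). Let $A:\Omega\to\mathbb{R}^{d\times d}$ be a measurable matrix field that is symmetric positive definite everywhere, and set $\kappa_*:=\inf_{x\in\Omega}\inf_{|\xi|=1}\xi^\top A(x)\xi$ and $\kappa^*:=\sup_{x\in\Omega}\sup_{|\xi|=1}\xi^\top A(x)\xi$, where $\xi\in\mathbb{R}^d$ and $|\cdot|$ is the Euclidean norm. Let $I$ be the $d\times d$ identity matrix and $P:=(A^{-1}-I)^{-1}$ (pointwise in $x$). Functions are complex-valued and $(f,g)=\int_\Omega f\cdot g\,dx$ is the bilinear $L^2$ pairing (no conjugation) for scalar or vector functions. $L^2_0(\Omega)=\{\tau\in L^2(\Omega):(\tau,1)=0\}$, $\tilde H^1_0(\Omega)=H^1_0(\Omega)\cap L^2_0(\Omega)$, $\tilde H^1(\Omega)=H^1(\Omega)\cap L^2_0(\Omega)$, and $V:=\tilde H^1_0(\Omega)\times (L^2(\Omega))^d\times\tilde H^1(\Omega)$. $H_0(\mathrm{div},\Omega)$ is the space of $\tau\in (L^2(\Omega))^d$ with $\nabla\cdot\tau\in L^2(\Omega)$ and zero normal trace on $\partial\Omega$, and $H^1_0(\mathrm{div},\Omega)=\{\tau\in H_0(\mathrm{div},\Omega):\nabla\cdot\tau\in H^1_0(\Omega)\}$. *)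

theory Defs
  imports "HOL-Analysis.Analysis"
begin

text \<open>
  Elements of the function spaces below are functions on all of \<open>\<real>\<^sup>d\<close>; only their values on \<open>\<Omega>\<close>
  matter, and two functions represent the same element iff they agree almost everywhere on \<open>\<Omega>\<close>.
  All integrals are Lebesgue integrals over \<open>\<Omega>\<close>.
\<close>

text \<open>
  Non-convex domains, domains with holes and non-Lipschitz polyhedra are allowed. Openness and
  boundedness follow from the representation as an interior.
\<close>

definition polyhedral_domain :: "(real^'n) set \<Rightarrow> bool" where
  "polyhedral_domain \<Omega> \<longleftrightarrow>
     \<Omega> \<noteq> {} \<and> connected \<Omega> \<and>
     (\<exists>F. finite F \<and> (\<forall>K\<in>F. polytope K) \<and> \<Omega> = interior (\<Union>F))"


subsection \<open>Test functions\<close>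

definition pderivative :: "'n \<Rightarrow> (real^'n \<Rightarrow> complex) \<Rightarrow> real^'n \<Rightarrow> complex" where
  "pderivative i f x = frechet_derivative f (at x) (axis i 1)"

primrec Ck :: "nat \<Rightarrow> (real^'n \<Rightarrow> complex) \<Rightarrow> bool" where
  "Ck 0 f \<longleftrightarrow> continuous_on UNIV f"
| "Ck (Suc k) f \<longleftrightarrow> (\<forall>x. f differentiable (at x)) \<and> (\<forall>i. Ck k (pderivative i f))"

definition test_functions :: "(real^'n) set \<Rightarrow> (real^'n \<Rightarrow> complex) set" where
  "test_functions \<Omega> =
     {\<theta>. (\<forall>k. Ck k \<theta>) \<and> compact (closure {x. \<theta> x \<noteq> 0}) \<and> closure {x. \<theta> x \<noteq> 0} \<subseteq> \<Omega>}"


subsection \<open>Square-integrable functions\<close>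

definition L2 :: "(real^'n) set \<Rightarrow> (real^'n \<Rightarrow> 'b::real_normed_vector) set" where
  "L2 \<Omega> = {f. f \<in> borel_measurable (lebesgue_on \<Omega>) \<and>
              integrable (lebesgue_on \<Omega>) (\<lambda>x. (norm (f x))\<^sup>2)}"

definition L2_norm :: "(real^'n) set \<Rightarrow> (real^'n \<Rightarrow> 'b::real_normed_vector) \<Rightarrow> real" where
  "L2_norm \<Omega> f = sqrt (\<integral>x. (norm (f x))\<^sup>2 \<partial>lebesgue_on \<Omega>)"

text \<open>The pairings are bilinear: there is no complex conjugation.\<close>

definition spair :: "(real^'n) set \<Rightarrow> (real^'n \<Rightarrow> complex) \<Rightarrow> (real^'n \<Rightarrow> complex) \<Rightarrow> complex" where
  "spair \<Omega> f g = (\<integral>x. f x * g x \<partial>lebesgue_on \<Omega>)"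

definition vpair :: "(real^'n) set \<Rightarrow> (real^'n \<Rightarrow> complex^'n) \<Rightarrow> (real^'n \<Rightarrow> complex^'n) \<Rightarrow> complex" where
  "vpair \<Omega> f g = (\<integral>x. (\<Sum>i\<in>UNIV. f x $ i * g x $ i) \<partial>lebesgue_on \<Omega>)"

definition L2_mean0 :: "(real^'n) set \<Rightarrow> (real^'n \<Rightarrow> complex) set" where
  "L2_mean0 \<Omega> = {\<tau> \<in> L2 \<Omega>. spair \<Omega> \<tau> (\<lambda>x. 1) = 0}"


subsection \<open>Weak derivatives and Sobolev spaces\<close>

definition has_weak_grad ::
  "(real^'n) set \<Rightarrow> (real^'n \<Rightarrow> complex) \<Rightarrow> (real^'n \<Rightarrow> complex^'n) \<Rightarrow> bool" where
  "has_weak_grad \<Omega> f G \<longleftrightarrow> f \<in> L2 \<Omega> \<and> G \<in> L2 \<Omega> \<and>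
     (\<forall>\<theta>\<in>test_functions \<Omega>. \<forall>i. spair \<Omega> f (pderivative i \<theta>) = - spair \<Omega> (\<lambda>x. G x $ i) \<theta>)"

definition has_weak_div ::
  "(real^'n) set \<Rightarrow> (real^'n \<Rightarrow> complex^'n) \<Rightarrow> (real^'n \<Rightarrow> complex) \<Rightarrow> bool" where
  "has_weak_div \<Omega> \<tau> g \<longleftrightarrow> \<tau> \<in> L2 \<Omega> \<and> g \<in> L2 \<Omega> \<and>
     (\<forall>\<theta>\<in>test_functions \<Omega>. vpair \<Omega> \<tau> (\<lambda>x. \<chi> i. pderivative i \<theta> x) = - spair \<Omega> g \<theta>)"

text \<open>The weak derivatives are unique almost everywhere on \<open>\<Omega>\<close>; a representative is chosen.\<close>

definition weak_grad :: "(real^'n) set \<Rightarrow> (real^'n \<Rightarrow> complex) \<Rightarrow> real^'n \<Rightarrow> complex^'n" where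
  "weak_grad \<Omega> f = (SOME G. has_weak_grad \<Omega> f G)"

definition weak_div :: "(real^'n) set \<Rightarrow> (real^'n \<Rightarrow> complex^'n) \<Rightarrow> real^'n \<Rightarrow> complex" where
  "weak_div \<Omega> \<tau> = (SOME g. has_weak_div \<Omega> \<tau> g)"

definition H1 :: "(real^'n) set \<Rightarrow> (real^'n \<Rightarrow> complex) set" where
  "H1 \<Omega> = {f. \<exists>G. has_weak_grad \<Omega> f G}"

definition H1_norm :: "(real^'n) set \<Rightarrow> (real^'n \<Rightarrow> complex) \<Rightarrow> real" where
  "H1_norm \<Omega> f = sqrt ((L2_norm \<Omega> f)\<^sup>2 + (L2_norm \<Omega> (weak_grad \<Omega> f))\<^sup>2)"

definition H10 :: "(real^'n) set \<Rightarrow> (real^'n \<Rightarrow> complex) set" where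
  "H10 \<Omega> = {f \<in> H1 \<Omega>. \<forall>e>0. \<exists>\<theta>\<in>test_functions \<Omega>. H1_norm \<Omega> (\<lambda>x. f x - \<theta> x) < e}"

definition H1_mean0 :: "(real^'n) set \<Rightarrow> (real^'n \<Rightarrow> complex) set" where
  "H1_mean0 \<Omega> = H1 \<Omega> \<inter> L2_mean0 \<Omega>"

definition H10_mean0 :: "(real^'n) set \<Rightarrow> (real^'n \<Rightarrow> complex) set" where
  "H10_mean0 \<Omega> = H10 \<Omega> \<inter> L2_mean0 \<Omega>"

definition Hdiv :: "(real^'n) set \<Rightarrow> (real^'n \<Rightarrow> complex^'n) set" where
  "Hdiv \<Omega> = {\<tau>. \<exists>g. has_weak_div \<Omega> \<tau> g}"

text \<open>
  The normal trace of \<open>\<tau>\<close> is, as usual, the functional given by Green's formula: its value at \<open>s\<close>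
  is the duality product of \<open>\<tau> \<cdot> n\<close> with the boundary trace of \<open>s\<close>. Every boundary trace is the
  trace of some \<open>s\<close> in \<open>H1 \<Omega>\<close>, so a zero normal trace means that this functional vanishes.
\<close>

definition normal_trace :: "(real^'n) set \<Rightarrow> (real^'n \<Rightarrow> complex^'n) \<Rightarrow> (real^'n \<Rightarrow> complex) \<Rightarrow> complex" where
  "normal_trace \<Omega> \<tau> s = vpair \<Omega> \<tau> (weak_grad \<Omega> s) + spair \<Omega> (weak_div \<Omega> \<tau>) s"

definition H0div :: "(real^'n) set \<Rightarrow> (real^'n \<Rightarrow> complex^'n) set" where
  "H0div \<Omega> = {\<tau> \<in> Hdiv \<Omega>. \<forall>s\<in>H1 \<Omega>. normal_trace \<Omega> \<tau> s = 0}"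

definition H10div :: "(real^'n) set \<Rightarrow> (real^'n \<Rightarrow> complex^'n) set" where
  "H10div \<Omega> = {\<tau> \<in> H0div \<Omega>. weak_div \<Omega> \<tau> \<in> H10 \<Omega>}"


subsection \<open>The coefficient\<close>

definition spd_matrix :: "real^'n^'n \<Rightarrow> bool" where
  "spd_matrix M \<longleftrightarrow> transpose M = M \<and> (\<forall>\<xi>. \<xi> \<noteq> 0 \<longrightarrow> \<xi> \<bullet> (M *v \<xi>) > 0)"

text \<open>The bounds are extended reals, so that the supremum is infinite when \<open>A\<close> is unbounded.\<close>

definition kappa_lower :: "(real^'n) set \<Rightarrow> (real^'n \<Rightarrow> real^'n^'n) \<Rightarrow> ereal" where
  "kappa_lower \<Omega> A = (INF x\<in>\<Omega>. INF \<xi>\<in>sphere 0 1. ereal (\<xi> \<bullet> (A x *v \<xi>)))"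

definition kappa_upper :: "(real^'n) set \<Rightarrow> (real^'n \<Rightarrow> real^'n^'n) \<Rightarrow> ereal" where
  "kappa_upper \<Omega> A = (SUP x\<in>\<Omega>. SUP \<xi>\<in>sphere 0 1. ereal (\<xi> \<bullet> (A x *v \<xi>)))"

definition P_field :: "(real^'n \<Rightarrow> real^'n^'n) \<Rightarrow> real^'n \<Rightarrow> real^'n^'n" where
  "P_field A x = matrix_inv (matrix_inv (A x) - mat 1)"

definition mapply :: "(real^'n \<Rightarrow> real^'n^'n) \<Rightarrow> (real^'n \<Rightarrow> complex^'n) \<Rightarrow> real^'n \<Rightarrow> complex^'n" where
  "mapply M w x = map_matrix complex_of_real (M x) *v w x"


subsection \<open>The two eigenvalue problems\<close>

definition eigenpair1 ::
  "(real^'n) set \<Rightarrow> (real^'n \<Rightarrow> real^'n^'n) \<Rightarrow> complex \<Rightarrow> (real^'n \<Rightarrow> complex^'n) \<Rightarrow> bool" where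
  "eigenpair1 \<Omega> A lam u \<longleftrightarrow>
     lam \<noteq> 0 \<and> u \<in> H10div \<Omega> \<and> \<not> (AE x in lebesgue_on \<Omega>. u x = 0) \<and>
     (\<forall>v\<in>H10div \<Omega>.
        vpair \<Omega>
          (mapply (P_field A) (\<lambda>x. weak_grad \<Omega> (weak_div \<Omega> u) x + lam *s u x))
          (\<lambda>x. weak_grad \<Omega> (weak_div \<Omega> v) x + lam *s mapply (\<lambda>x. matrix_inv (A x)) v x) = 0)"

definition V_space ::
  "(real^'n) set \<Rightarrow> ((real^'n \<Rightarrow> complex) \<times> (real^'n \<Rightarrow> complex^'n) \<times> (real^'n \<Rightarrow> complex)) set" where
  "V_space \<Omega> = H10_mean0 \<Omega> \<times> L2 \<Omega> \<times> H1_mean0 \<Omega>"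

definition eigenpair2 ::
  "(real^'n) set \<Rightarrow> (real^'n \<Rightarrow> real^'n^'n) \<Rightarrow> complex \<Rightarrow>
   (real^'n \<Rightarrow> complex) \<times> (real^'n \<Rightarrow> complex^'n) \<times> (real^'n \<Rightarrow> complex) \<Rightarrow> bool" where
  "eigenpair2 \<Omega> A lam = (\<lambda>(\<phi>, y, r).
     lam \<noteq> 0 \<and> (\<phi>, y, r) \<in> V_space \<Omega> \<and>
     \<not> (AE x in lebesgue_on \<Omega>. \<phi> x = 0 \<and> y x = 0 \<and> r x = 0) \<and>
     (\<forall>(\<psi>, z, s) \<in> V_space \<Omega>.
        vpair \<Omega> (mapply (P_field A) (weak_grad \<Omega> \<phi>)) (weak_grad \<Omega> \<psi>)
          + vpair \<Omega> (mapply (P_field A) y) (weak_grad \<Omega> \<psi>)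
          = lam * (spair \<Omega> \<phi> \<psi> + spair \<Omega> r \<psi>) \<and>
        vpair \<Omega> (mapply (P_field A) (weak_grad \<Omega> \<phi>)) z
          + vpair \<Omega> (mapply (\<lambda>x. mat 1 + P_field A x) y) z
          - vpair \<Omega> (weak_grad \<Omega> r) z = 0 \<and>
        - vpair \<Omega> y (weak_grad \<Omega> s) = lam * spair \<Omega> \<phi> s))"

end

theory Submission
  imports Defs
begin

text \<open>
  The identity \<open>P A\<^sup>-\<^sup>1 = A\<^sup>-\<^sup>1 P = I + P\<close> turns the weak form of (E1) into the first two equations
  of (E2), tested with \<open>\<psi> = \<nabla> \<cdot> v\<close> and \<open>z = v\<close>; the third equation says that \<open>\<nabla> \<cdot> u = \<phi>\<close> with zero
  normal trace. Conversely, (E1) says that \<open>g = P \<nabla> \<phi> + (I + P) y\<close> is orthogonal to the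
  divergence-free fields of \<open>H0div\<close>. As the gradients form a closed subspace of \<open>L\<^sup>2\<close> by the
  Poincare inequality, \<open>g\<close> is the gradient of some \<open>r\<close>, and the first equation of (E2) follows because
  every function of mean zero is a divergence (Neumann problem).

  The domain need not be Lipschitz, but it is a finite union of open convex sets: a point
  together with the points lying strictly on the same side of all facet hyperplanes that avoid it.
  The Poincare inequality on convex sets comes from a translation estimate, proved by duality
  without mollification, and it passes to unions of overlapping sets.
\<close>

section \<open>Square-integrable functions\<close>

text \<open>The pairings of the problem carry no conjugation, so orthogonality for
  \<open>spair\<close> and \<open>vpair\<close> is not orthogonality in a Hilbert space. Every
  Hilbert space argument therefore runs over the reals, with \<open>L2_inner\<close>, the real part
  of the Hermitian product. Fields found in this way are conjugated before they are paired, and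
  complex identities are recovered from their real parts by testing also with multiples by
  \<open>\<i>\<close>. The means are matched on both sides. A divergence with zero normal trace has
  mean zero, so \<open>\<phi>\<close> and the test functions \<open>\<psi>\<close> are exactly of
  the form needed to be divergences. Such \<open>\<psi>\<close> see \<open>r\<close> only up to a
  constant, which the mean-zero condition on \<open>r\<close> removes; this is the source of
  uniqueness. The bounds on \<open>A\<close> enter through two operator bounds:
  \<open>kappa_lower > 0\<close> bounds the inverse of \<open>A\<close>, and
  \<open>kappa_upper < 1\<close> makes \<open>matrix_inv (A x) - mat 1\<close> uniformly coercive,
  so that \<open>P\<close> maps \<open>L2\<close> to itself. Elements are plain functions and
  \<open>weak_grad\<close> is a chosen representative, so linearity of the gradient holds only
  almost everywhere.\<close>

text \<open>The core of every Cauchy-Schwarz inequality below: for \<open>L2_inner\<close>, for the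
  form in the Riesz theorem and for symmetric matrices. With \<open>a = 0\<close> it says that the
  linear coefficient vanishes.\<close>

lemma quadratic_nonneg_discriminant:
  fixes a b c :: real
  assumes "\<And>t. 0 \<le> a + 2 * t * b + t\<^sup>2 * c"
  shows "b\<^sup>2 \<le> a * c"
proof (cases "c = 0")
  case True
  have "b = 0"
  proof (rule ccontr)
    assume "b \<noteq> 0"
    \<comment> \<open>At this \<open>t\<close> the expression equals -1.\<close>
    with assms[of "- (a + 1) / (2 * b)"] True show False by (simp add: field_simps)
  qed
  with True show ?thesis by simp
next
  case False
  have "0 \<le> c"
  proof (rule ccontr)
    assume "\<not> 0 \<le> c"
    hence c: "c < 0" by simp
    \<comment> \<open>The instances at \<open>t\<close> and \<open>-t\<close> then add up to
      \<open>2 * (a - \<bar>a\<bar> - 1)\<close>, which is negative.\<close>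
    define t where "t = sqrt ((\<bar>a\<bar> + 1) / - c)"
    have "t\<^sup>2 = (\<bar>a\<bar> + 1) / - c" unfolding t_def using c by (intro real_sqrt_pow2) (simp add: field_simps)
    hence "t\<^sup>2 * c = - (\<bar>a\<bar> + 1)" using c by (simp add: field_simps)
    with assms[of t] assms[of "-t"] show False by simp
  qed
  with False have c: "c > 0" by simp
  \<comment> \<open>The parabola has its vertex at \<open>- b / c\<close>.\<close>
  have "0 \<le> (a + 2 * (- b / c) * b + (- b / c)\<^sup>2 * c) * c"
    using assms[of "- b / c"] c by (intro mult_nonneg_nonneg) auto
  also have "\<dots> = a * c - b\<^sup>2" using c by (simp add: field_simps power2_eq_square)
  finally show ?thesis by simp
qed

text \<open>Lebesgue measure is complete, so a change on a null set keeps measurability; extension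
  by zero moves the question from \<open>S\<close> to the whole space.\<close>

lemma measurable_lebesgue_on_AE_cong:
  fixes f g :: "'a::euclidean_space \<Rightarrow> 'b::euclidean_space"
  assumes f: "f \<in> borel_measurable (lebesgue_on S)" and S: "S \<in> sets lebesgue"
    and eq: "AE x in lebesgue_on S. f x = g x"
  shows "g \<in> borel_measurable (lebesgue_on S)"
proof -
  have "(\<lambda>x. if x \<in> S then f x else 0) \<in> borel_measurable lebesgue"
    using f S by (simp add: borel_measurable_if)
  moreover have "AE x in lebesgue. (if x \<in> S then f x else 0) = (if x \<in> S then g x else 0)"
    using eq S by (auto simp: AE_restrict_space_iff)
  ultimately have "(\<lambda>x. if x \<in> S then g x else 0) \<in> borel_measurable lebesgue"
    by (rule borel_measurable_AE)
  then show ?thesis using S by (simp add: borel_measurable_if)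
qed

section \<open>Membership, inner product and norm in L2\<close>

text \<open>On complex values this is the real part of the Hermitian product, in contrast to the
  complex bilinear \<open>spair\<close> and \<open>vpair\<close>.\<close>

definition L2_inner :: "(real^'n) set \<Rightarrow> (real^'n \<Rightarrow> 'b::real_inner) \<Rightarrow> (real^'n \<Rightarrow> 'b) \<Rightarrow> real" where
  "L2_inner \<Omega> f g = (\<integral>x. f x \<bullet> g x \<partial>lebesgue_on \<Omega>)"

lemma L2_measurable: "f \<in> L2 \<Omega> \<Longrightarrow> f \<in> borel_measurable (lebesgue_on \<Omega>)"
  by (simp add: L2_def)

lemma L2_integrable_norm2: "f \<in> L2 \<Omega> \<Longrightarrow> integrable (lebesgue_on \<Omega>) (\<lambda>x. (norm (f x))\<^sup>2)"
  by (simp add: L2_def)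

lemma L2_I:
  fixes f :: "real^'n \<Rightarrow> 'b::euclidean_space"
  assumes "f \<in> borel_measurable (lebesgue_on \<Omega>)" "integrable (lebesgue_on \<Omega>) b"
    and "\<And>x. x \<in> \<Omega> \<Longrightarrow> (norm (f x))\<^sup>2 \<le> b x"
  shows "f \<in> L2 \<Omega>"
proof -
  have "integrable (lebesgue_on \<Omega>) (\<lambda>x. (norm (f x))\<^sup>2)"
  proof (rule Bochner_Integration.integrable_bound[OF assms(2)])
    show "(\<lambda>x. (norm (f x))\<^sup>2) \<in> borel_measurable (lebesgue_on \<Omega>)"
      by (intro borel_measurable_power measurable_compose[OF assms(1) borel_measurable_norm])
    show "AE x in lebesgue_on \<Omega>. norm ((norm (f x))\<^sup>2) \<le> norm (b x)"
    proof (rule AE_I2)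
      fix x assume "x \<in> space (lebesgue_on \<Omega>)"
      hence "(norm (f x))\<^sup>2 \<le> b x" using assms(3) by simp
      also have "\<dots> \<le> norm (b x)" by simp
      finally show "norm ((norm (f x))\<^sup>2) \<le> norm (b x)" by simp
    qed
  qed
  then show ?thesis using assms(1) by (simp add: L2_def)
qed

text \<open>One domination argument for the inner product, the complex product and scaling by a real
  function.\<close>

lemma L2_integrable_bilinear:
  fixes f :: "real^'n \<Rightarrow> 'b::euclidean_space" and g :: "real^'n \<Rightarrow> 'c::euclidean_space"
    and p :: "'b \<Rightarrow> 'c \<Rightarrow> 'd::{banach,second_countable_topology}"
  assumes p: "bounded_bilinear p" and f: "f \<in> L2 \<Omega>" and g: "g \<in> L2 \<Omega>"
  shows "integrable (lebesgue_on \<Omega>) (\<lambda>x. p (f x) (g x))"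
proof -
  from bounded_bilinear.nonneg_bounded[OF p] obtain K
    where K: "0 \<le> K" "\<And>a b. norm (p a b) \<le> norm a * norm b * K" by blast
  show ?thesis
  proof (rule Bochner_Integration.integrable_bound)
    show "integrable (lebesgue_on \<Omega>) (\<lambda>x. K * ((norm (f x))\<^sup>2 + (norm (g x))\<^sup>2))"
      using L2_integrable_norm2[OF f] L2_integrable_norm2[OF g] by simp
    show "(\<lambda>x. p (f x) (g x)) \<in> borel_measurable (lebesgue_on \<Omega>)"
      by (rule borel_measurable_continuous_Pair[OF L2_measurable[OF f] L2_measurable[OF g]])
         (intro bounded_bilinear.continuous_on[OF p] continuous_intros)
    show "AE x in lebesgue_on \<Omega>. norm (p (f x) (g x)) \<le> norm (K * ((norm (f x))\<^sup>2 + (norm (g x))\<^sup>2))"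
    proof (rule AE_I2)
      fix x
      have "norm (f x) * norm (g x) \<le> (norm (f x))\<^sup>2 + (norm (g x))\<^sup>2"
        using sum_squares_bound[of "norm (f x)" "norm (g x)"] mult_nonneg_nonneg[OF norm_ge_zero[of "f x"] norm_ge_zero[of "g x"]]
        by linarith
      hence "norm (f x) * norm (g x) * K \<le> ((norm (f x))\<^sup>2 + (norm (g x))\<^sup>2) * K"
        using K(1) by (rule mult_right_mono)
      with K(2)[of "f x" "g x"]
      show "norm (p (f x) (g x)) \<le> norm (K * ((norm (f x))\<^sup>2 + (norm (g x))\<^sup>2))"
        using K(1) by (simp add: abs_mult mult.commute)
    qed
  qed
qed

lemmas L2_integrable_inner = L2_integrable_bilinear[OF bounded_bilinear_inner]
lemmas L2_integrable_mult = L2_integrable_bilinear[OF bounded_bilinear_mult]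

lemma L2_bounded_linear:
  fixes f :: "real^'n \<Rightarrow> 'b::euclidean_space" and T :: "'b \<Rightarrow> 'c::euclidean_space"
  assumes T: "bounded_linear T" and f: "f \<in> L2 \<Omega>"
  shows "(\<lambda>x. T (f x)) \<in> L2 \<Omega>"
proof -
  from bounded_linear.nonneg_bounded[OF T] obtain K
    where K: "0 \<le> K" "\<And>a. norm (T a) \<le> norm a * K" by blast
  show ?thesis
  proof (rule L2_I)
    show "(\<lambda>x. T (f x)) \<in> borel_measurable (lebesgue_on \<Omega>)"
      by (rule measurable_compose[OF L2_measurable[OF f] borel_measurable_continuous_onI])
         (rule bounded_linear.continuous_on[OF T continuous_on_id])
    show "integrable (lebesgue_on \<Omega>) (\<lambda>x. K\<^sup>2 * (norm (f x))\<^sup>2)"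
      using L2_integrable_norm2[OF f] by simp
    show "(norm (T (f x)))\<^sup>2 \<le> K\<^sup>2 * (norm (f x))\<^sup>2" for x
      using power_mono[OF K(2)[of "f x"], of 2] by (simp add: power_mult_distrib mult.commute)
  qed
qed

lemma L2_add:
  fixes f g :: "real^'n \<Rightarrow> 'b::euclidean_space"
  assumes f: "f \<in> L2 \<Omega>" and g: "g \<in> L2 \<Omega>"
  shows "(\<lambda>x. f x + g x) \<in> L2 \<Omega>"
proof (rule L2_I)
  show "(\<lambda>x. f x + g x) \<in> borel_measurable (lebesgue_on \<Omega>)"
    by (intro borel_measurable_add L2_measurable f g)
  show "integrable (lebesgue_on \<Omega>) (\<lambda>x. 2 * (norm (f x))\<^sup>2 + 2 * (norm (g x))\<^sup>2)"
    using L2_integrable_norm2[OF f] L2_integrable_norm2[OF g] by simp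
  show "(norm (f x + g x))\<^sup>2 \<le> 2 * (norm (f x))\<^sup>2 + 2 * (norm (g x))\<^sup>2" for x
  proof -
    have "(norm (f x + g x))\<^sup>2 \<le> (norm (f x) + norm (g x))\<^sup>2"
      by (intro power_mono norm_triangle_ineq) simp
    also have "\<dots> \<le> 2 * (norm (f x))\<^sup>2 + 2 * (norm (g x))\<^sup>2"
      using sum_squares_bound[of "norm (f x)" "norm (g x)"] by (simp add: power2_sum)
    finally show ?thesis .
  qed
qed

lemma L2_scaleR: "f \<in> L2 \<Omega> \<Longrightarrow> (\<lambda>x. c *\<^sub>R f x) \<in> L2 \<Omega>" for f :: "real^'n \<Rightarrow> 'b::euclidean_space"
  by (rule L2_bounded_linear[OF bounded_linear_scaleR_right])

lemma L2_uminus: "f \<in> L2 \<Omega> \<Longrightarrow> (\<lambda>x. - f x) \<in> L2 \<Omega>" for f :: "real^'n \<Rightarrow> 'b::euclidean_space"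
  using L2_scaleR[of f \<Omega> "-1"] by simp

lemma L2_diff: "f \<in> L2 \<Omega> \<Longrightarrow> g \<in> L2 \<Omega> \<Longrightarrow> (\<lambda>x. f x - g x) \<in> L2 \<Omega>"
  for f :: "real^'n \<Rightarrow> 'b::euclidean_space"
  using L2_add[OF _ L2_uminus, of f \<Omega> g] by simp

lemma L2_zero [simp]: "(\<lambda>x. 0) \<in> L2 \<Omega>"
  by (simp add: L2_def)

lemma L2_sum:
  fixes f :: "'i \<Rightarrow> real^'n \<Rightarrow> 'b::euclidean_space"
  assumes "\<And>i. i \<in> I \<Longrightarrow> f i \<in> L2 \<Omega>"
  shows "(\<lambda>x. \<Sum>i\<in>I. f i x) \<in> L2 \<Omega>"
  using assms by (induction I rule: infinite_finite_induct) (simp_all add: L2_add)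

lemma L2_cmult: "f \<in> L2 \<Omega> \<Longrightarrow> (\<lambda>x. c * f x) \<in> L2 \<Omega>" for f :: "real^'n \<Rightarrow> complex"
  by (rule L2_bounded_linear[OF bounded_linear_mult_right])

lemma L2_cnj: "f \<in> L2 \<Omega> \<Longrightarrow> (\<lambda>x. cnj (f x)) \<in> L2 \<Omega>"
  by (rule L2_bounded_linear[OF bounded_linear_cnj])

lemma L2_cong_AE:
  fixes f g :: "real^'n \<Rightarrow> 'b::euclidean_space"
  assumes f: "f \<in> L2 \<Omega>" and S: "\<Omega> \<in> sets lebesgue" and eq: "AE x in lebesgue_on \<Omega>. f x = g x"
  shows "g \<in> L2 \<Omega>"
proof -
  have g: "g \<in> borel_measurable (lebesgue_on \<Omega>)"
    using L2_measurable[OF f] S eq by (rule measurable_lebesgue_on_AE_cong)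
  have "integrable (lebesgue_on \<Omega>) (\<lambda>x. (norm (f x))\<^sup>2) = integrable (lebesgue_on \<Omega>) (\<lambda>x. (norm (g x))\<^sup>2)"
  proof (rule integrable_cong_AE)
    show "(\<lambda>x. (norm (f x))\<^sup>2) \<in> borel_measurable (lebesgue_on \<Omega>)"
      by (rule borel_measurable_integrable[OF L2_integrable_norm2[OF f]])
    show "(\<lambda>x. (norm (g x))\<^sup>2) \<in> borel_measurable (lebesgue_on \<Omega>)"
      by (intro borel_measurable_power measurable_compose[OF g borel_measurable_norm])
    show "AE x in lebesgue_on \<Omega>. (norm (f x))\<^sup>2 = (norm (g x))\<^sup>2"
      using eq by eventually_elim simp
  qed
  with g L2_integrable_norm2[OF f] show ?thesis unfolding L2_def by blast
qed

lemma L2_mult_bounded: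
  fixes m :: "real^'n \<Rightarrow> real" and f :: "real^'n \<Rightarrow> 'b::euclidean_space"
  assumes m: "m \<in> borel_measurable (lebesgue_on \<Omega>)" "\<And>x. x \<in> \<Omega> \<Longrightarrow> \<bar>m x\<bar> \<le> K" and f: "f \<in> L2 \<Omega>"
  shows "(\<lambda>x. m x *\<^sub>R f x) \<in> L2 \<Omega>"
proof (rule L2_I)
  show "(\<lambda>x. m x *\<^sub>R f x) \<in> borel_measurable (lebesgue_on \<Omega>)"
    by (intro borel_measurable_scaleR m(1) L2_measurable[OF f])
  show "integrable (lebesgue_on \<Omega>) (\<lambda>x. K\<^sup>2 * (norm (f x))\<^sup>2)"
    using L2_integrable_norm2[OF f] by simp
  show "(norm (m x *\<^sub>R f x))\<^sup>2 \<le> K\<^sup>2 * (norm (f x))\<^sup>2" if "x \<in> \<Omega>" for x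
  proof -
    have "(m x)\<^sup>2 \<le> K\<^sup>2" using power_mono[OF m(2)[OF that], of 2] by simp
    then show ?thesis by (simp add: power_mult_distrib mult_right_mono)
  qed
qed

lemma L2_bounded:
  fixes f :: "real^'n \<Rightarrow> 'b::euclidean_space"
  assumes "\<Omega> \<in> lmeasurable" "f \<in> borel_measurable (lebesgue_on \<Omega>)" "\<And>x. x \<in> \<Omega> \<Longrightarrow> norm (f x) \<le> K"
  shows "f \<in> L2 \<Omega>"
proof (rule L2_I)
  show "integrable (lebesgue_on \<Omega>) (\<lambda>x. K\<^sup>2)"
    using finite_measure.integrable_const[OF finite_measure_lebesgue_on[OF assms(1)]] .
  show "(norm (f x))\<^sup>2 \<le> K\<^sup>2" if "x \<in> \<Omega>" for x
    using assms(3)[OF that] by (intro power_mono) auto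
qed fact

lemma L2_const: "\<Omega> \<in> lmeasurable \<Longrightarrow> (\<lambda>x. c) \<in> L2 \<Omega>" for c :: "'b::euclidean_space"
  by (rule L2_bounded[where K = "norm c"]) auto

lemma L2_imp_integrable:
  fixes f :: "real^'n \<Rightarrow> 'b::euclidean_space"
  assumes "\<Omega> \<in> lmeasurable" "f \<in> L2 \<Omega>"
  shows "integrable (lebesgue_on \<Omega>) f"
  using L2_integrable_bilinear[OF bounded_bilinear_scaleR L2_const[OF assms(1), of 1] assms(2)] by simp

lemma L2_inner_commute: "L2_inner \<Omega> f g = L2_inner \<Omega> g f"
  by (simp add: L2_inner_def inner_commute)

lemma L2_inner_add_left:
  fixes f g h :: "real^'n \<Rightarrow> 'b::euclidean_space"
  assumes "f \<in> L2 \<Omega>" "g \<in> L2 \<Omega>" "h \<in> L2 \<Omega>"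
  shows "L2_inner \<Omega> (\<lambda>x. f x + g x) h = L2_inner \<Omega> f h + L2_inner \<Omega> g h"
  using assms by (simp add: L2_inner_def inner_add_left L2_integrable_inner)

lemma L2_inner_diff_left:
  fixes f g h :: "real^'n \<Rightarrow> 'b::euclidean_space"
  assumes "f \<in> L2 \<Omega>" "g \<in> L2 \<Omega>" "h \<in> L2 \<Omega>"
  shows "L2_inner \<Omega> (\<lambda>x. f x - g x) h = L2_inner \<Omega> f h - L2_inner \<Omega> g h"
  using assms by (simp add: L2_inner_def inner_diff_left L2_integrable_inner)

lemma L2_inner_diff_right:
  fixes f g h :: "real^'n \<Rightarrow> 'b::euclidean_space"
  assumes "f \<in> L2 \<Omega>" "g \<in> L2 \<Omega>" "h \<in> L2 \<Omega>"
  shows "L2_inner \<Omega> h (\<lambda>x. f x - g x) = L2_inner \<Omega> h f - L2_inner \<Omega> h g"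
  using L2_inner_diff_left[OF assms] by (simp add: L2_inner_commute)

lemma L2_inner_scaleR_left: "L2_inner \<Omega> (\<lambda>x. c *\<^sub>R f x) g = c * L2_inner \<Omega> f g"
  by (simp add: L2_inner_def)

lemma L2_norm_nonneg [simp]: "0 \<le> L2_norm \<Omega> f"
  by (simp add: L2_norm_def)

lemma L2_norm_power2: "(L2_norm \<Omega> f)\<^sup>2 = L2_inner \<Omega> f f"
  by (simp add: L2_norm_def L2_inner_def dot_square_norm)

lemma L2_inner_self_nonneg [simp]: "0 \<le> L2_inner \<Omega> f f"
  by (simp flip: L2_norm_power2)

lemma L2_norm_scaleR: "L2_norm \<Omega> (\<lambda>x. c *\<^sub>R f x) = \<bar>c\<bar> * L2_norm \<Omega> f"
  by (simp add: L2_norm_def power_mult_distrib real_sqrt_mult)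

lemma L2_norm_uminus: "L2_norm \<Omega> (\<lambda>x. - f x) = L2_norm \<Omega> f"
  by (simp add: L2_norm_def)

lemma L2_norm_minus_commute: "L2_norm \<Omega> (\<lambda>x. f x - g x) = L2_norm \<Omega> (\<lambda>x. g x - f x)"
  by (simp add: L2_norm_def norm_minus_commute)

lemma L2_norm_add_power2:
  fixes f g :: "real^'n \<Rightarrow> 'b::euclidean_space"
  assumes "f \<in> L2 \<Omega>" "g \<in> L2 \<Omega>"
  shows "(L2_norm \<Omega> (\<lambda>x. f x + g x))\<^sup>2 = (L2_norm \<Omega> f)\<^sup>2 + 2 * L2_inner \<Omega> f g + (L2_norm \<Omega> g)\<^sup>2"
  using L2_inner_add_left[OF assms L2_add[OF assms]] L2_inner_add_left[OF assms assms(1)]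
    L2_inner_add_left[OF assms assms(2)]
  by (simp add: L2_norm_power2 L2_inner_commute)

lemma L2_Cauchy_Schwarz:
  fixes f g :: "real^'n \<Rightarrow> 'b::euclidean_space"
  assumes f: "f \<in> L2 \<Omega>" and g: "g \<in> L2 \<Omega>"
  shows "\<bar>L2_inner \<Omega> f g\<bar> \<le> L2_norm \<Omega> f * L2_norm \<Omega> g"
proof -
  have "0 \<le> L2_inner \<Omega> f f + 2 * t * L2_inner \<Omega> f g + t\<^sup>2 * L2_inner \<Omega> g g" for t
  proof -
    have "L2_inner \<Omega> f (\<lambda>x. t *\<^sub>R g x) = t * L2_inner \<Omega> f g"
      by (simp add: L2_inner_def)
    moreover have "L2_inner \<Omega> (\<lambda>x. t *\<^sub>R g x) (\<lambda>x. t *\<^sub>R g x) = t\<^sup>2 * L2_inner \<Omega> g g"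
      by (simp add: L2_inner_def power2_eq_square mult.assoc)
    ultimately show ?thesis
      using L2_norm_add_power2[OF f L2_scaleR[OF g, of t]] zero_le_power2[of "L2_norm \<Omega> (\<lambda>x. f x + t *\<^sub>R g x)"]
      unfolding L2_norm_power2 by simp
  qed
  from quadratic_nonneg_discriminant[OF this]
  have "(L2_inner \<Omega> f g)\<^sup>2 \<le> (L2_norm \<Omega> f * L2_norm \<Omega> g)\<^sup>2"
    by (simp add: L2_norm_power2 power_mult_distrib)
  then have "\<bar>L2_inner \<Omega> f g\<bar> \<le> \<bar>L2_norm \<Omega> f * L2_norm \<Omega> g\<bar>"
    by (simp only: abs_le_square_iff)
  then show ?thesis by (simp add: abs_mult)
qed

lemma L2_norm_triangle:
  fixes f g :: "real^'n \<Rightarrow> 'b::euclidean_space"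
  assumes f: "f \<in> L2 \<Omega>" and g: "g \<in> L2 \<Omega>"
  shows "L2_norm \<Omega> (\<lambda>x. f x + g x) \<le> L2_norm \<Omega> f + L2_norm \<Omega> g"
proof -
  have "(L2_norm \<Omega> (\<lambda>x. f x + g x))\<^sup>2 \<le> (L2_norm \<Omega> f + L2_norm \<Omega> g)\<^sup>2"
    unfolding L2_norm_add_power2[OF f g] power2_sum
    using abs_le_D1[OF L2_Cauchy_Schwarz[OF f g]] by linarith
  then show ?thesis by (rule power2_le_imp_le) (intro add_nonneg_nonneg L2_norm_nonneg)
qed

lemma L2_norm_diff_triangle:
  fixes f g :: "real^'n \<Rightarrow> 'b::euclidean_space"
  assumes f: "f \<in> L2 \<Omega>" and g: "g \<in> L2 \<Omega>" and h: "h \<in> L2 \<Omega>"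
  shows "L2_norm \<Omega> (\<lambda>x. f x - h x) \<le> L2_norm \<Omega> (\<lambda>x. f x - g x) + L2_norm \<Omega> (\<lambda>x. g x - h x)"
  using L2_norm_triangle[OF L2_diff[OF f g] L2_diff[OF g h]] by simp

lemma L2_norm_cong_AE:
  fixes f g :: "real^'n \<Rightarrow> 'b::euclidean_space"
  assumes f: "f \<in> L2 \<Omega>" and g: "g \<in> L2 \<Omega>" and eq: "AE x in lebesgue_on \<Omega>. f x = g x"
  shows "L2_norm \<Omega> f = L2_norm \<Omega> g"
proof -
  have "(\<integral>x. (norm (f x))\<^sup>2 \<partial>lebesgue_on \<Omega>) = (\<integral>x. (norm (g x))\<^sup>2 \<partial>lebesgue_on \<Omega>)"
  proof (rule integral_cong_AE)
    show "AE x in lebesgue_on \<Omega>. (norm (f x))\<^sup>2 = (norm (g x))\<^sup>2"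
      using eq by eventually_elim simp
  qed (intro borel_measurable_integrable L2_integrable_norm2 f g)+
  then show ?thesis by (simp add: L2_norm_def)
qed

lemma L2_inner_cong_AE:
  fixes f g :: "real^'n \<Rightarrow> 'b::euclidean_space"
  assumes "f \<in> L2 \<Omega>" "g \<in> L2 \<Omega>" "AE x in lebesgue_on \<Omega>. f x = g x" "h \<in> L2 \<Omega>"
  shows "L2_inner \<Omega> f h = L2_inner \<Omega> g h"
  unfolding L2_inner_def
proof (rule integral_cong_AE)
  show "AE x in lebesgue_on \<Omega>. f x \<bullet> h x = g x \<bullet> h x"
    using assms(3) by eventually_elim simp
qed (intro borel_measurable_integrable L2_integrable_inner assms)+

lemma L2_norm_eq_0_imp_AE:
  fixes f :: "real^'n \<Rightarrow> 'b::euclidean_space"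
  assumes f: "f \<in> L2 \<Omega>" and "L2_norm \<Omega> f = 0"
  shows "AE x in lebesgue_on \<Omega>. f x = 0"
proof -
  have "(\<integral>x. (norm (f x))\<^sup>2 \<partial>lebesgue_on \<Omega>) = 0"
    using assms(2) by (simp add: L2_norm_def)
  then show ?thesis
    using integral_nonneg_eq_0_iff_AE[OF L2_integrable_norm2[OF f]] by auto
qed

lemma L2_inner_self_eq_0_imp_AE:
  fixes f :: "real^'n \<Rightarrow> 'b::euclidean_space"
  assumes f: "f \<in> L2 \<Omega>" and "L2_inner \<Omega> f f = 0"
  shows "AE x in lebesgue_on \<Omega>. f x = 0"
proof -
  have "(L2_norm \<Omega> f)\<^sup>2 = 0" using assms(2) by (simp add: L2_norm_power2)
  then show ?thesis by (intro L2_norm_eq_0_imp_AE f) simp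
qed

lemma L2_norm_zero [simp]: "L2_norm \<Omega> (\<lambda>x. 0) = 0"
  by (simp add: L2_norm_def)

section \<open>Completeness of L2\<close>

text \<open>Cauchy-Schwarz against the constant function 1.\<close>

lemma integral_norm_le_L2_norm:
  fixes f :: "real^'n \<Rightarrow> 'b::euclidean_space"
  assumes m: "\<Omega> \<in> lmeasurable" and f: "f \<in> L2 \<Omega>"
  shows "(\<integral>x. norm (f x) \<partial>lebesgue_on \<Omega>) \<le> L2_norm \<Omega> f * sqrt (measure lebesgue \<Omega>)"
proof -
  have nf: "(\<lambda>x. norm (f x)) \<in> L2 \<Omega>" using f measurable_compose[OF L2_measurable[OF f] borel_measurable_norm] by (simp add: L2_def)
  have "measure (lebesgue_on \<Omega>) \<Omega> = measure lebesgue \<Omega>"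
    using m by (subst measure_restrict_space) auto
  hence "L2_norm \<Omega> (\<lambda>x. 1::real) = sqrt (measure lebesgue \<Omega>)"
    by (simp add: L2_norm_def)
  moreover have "L2_norm \<Omega> (\<lambda>x. norm (f x)) = L2_norm \<Omega> f"
    by (simp add: L2_norm_def)
  ultimately show ?thesis
    using L2_Cauchy_Schwarz[OF nf L2_const[OF m, of 1]] by (simp add: L2_inner_def)
qed

text \<open>Riesz-Fischer. Along a fast subsequence the increments have summable \<open>L2\<close>
  norms, hence summable integrals because the measure is finite; so the subsequence converges almost
  everywhere. Fatou's lemma turns this into norm convergence of the whole sequence.\<close>

lemma L2_Cauchy_limit:
  fixes f :: "nat \<Rightarrow> real^'n \<Rightarrow> 'b::euclidean_space"
  assumes m: "\<Omega> \<in> lmeasurable" and f: "\<And>n. f n \<in> L2 \<Omega>"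
    and Cauchy: "\<And>e. 0 < e \<Longrightarrow> \<exists>N. \<forall>m\<ge>N. \<forall>n\<ge>N. L2_norm \<Omega> (\<lambda>x. f m x - f n x) < e"
  shows "\<exists>g\<in>L2 \<Omega>. (\<lambda>n. L2_norm \<Omega> (\<lambda>x. f n x - g x)) \<longlonglongrightarrow> 0"
proof -
  let ?M = "lebesgue_on \<Omega>"
  have nn: "(\<integral>\<^sup>+x. ennreal ((norm (h x))\<^sup>2) \<partial>?M) = ennreal ((L2_norm \<Omega> h)\<^sup>2)" if "h \<in> L2 \<Omega>" for h :: "real^'n \<Rightarrow> 'b"
    using nn_integral_eq_integral[OF L2_integrable_norm2[OF that]] by (simp add: L2_norm_def)
  have meas [measurable]: "f n \<in> borel_measurable ?M" for n
    by (rule L2_measurable[OF f])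
  obtain N where N: "\<And>k m n. N k \<le> m \<Longrightarrow> N k \<le> n \<Longrightarrow> L2_norm \<Omega> (\<lambda>x. f m x - f n x) < (1/2)^k"
    using Cauchy[of "(1/2)^k" for k] by (auto simp: choice_iff) metis
  \<comment> \<open>The sum passes all thresholds \<open>N j\<close> with \<open>j \<le> k\<close>;
    the summand \<open>k\<close> makes the indices strictly increasing.\<close>
  define r where "r k = (\<Sum>j\<le>k. N j) + k" for k
  have rN: "N k \<le> r k" for k
    unfolding r_def using member_le_sum[of k "{..k}" N] by simp
  have r_Suc: "r k < r (Suc k)" for k by (simp add: r_def)
  have r_ge: "k \<le> r k" for k by (simp add: r_def)
  have rN': "N k \<le> r j" if "k \<le> j" for k j
    using rN[of k] lift_Suc_mono_le[of r, OF less_imp_le[OF r_Suc] that] by linarith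
  have step: "L2_norm \<Omega> (\<lambda>x. f (r (Suc k)) x - f (r k) x) < (1/2)^k" for k
    by (intro N rN') simp_all
  let ?c = "sqrt (measure lebesgue \<Omega>)"
  have "(\<integral>\<^sup>+x. (\<Sum>k. ennreal (norm (f (r (Suc k)) x - f (r k) x))) \<partial>?M)
      = (\<Sum>k. \<integral>\<^sup>+x. ennreal (norm (f (r (Suc k)) x - f (r k) x)) \<partial>?M)"
    by (rule nn_integral_suminf) measurable
  also have "\<dots> \<le> (\<Sum>k. ennreal ((1/2)^k * ?c))"
  proof (rule suminf_le)
    fix k
    have d: "(\<lambda>x. f (r (Suc k)) x - f (r k) x) \<in> L2 \<Omega>" by (intro L2_diff f)
    have "(\<integral>\<^sup>+x. ennreal (norm (f (r (Suc k)) x - f (r k) x)) \<partial>?M)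
        = ennreal (\<integral>x. norm (f (r (Suc k)) x - f (r k) x) \<partial>?M)"
      by (rule nn_integral_eq_integral[OF integrable_norm[OF L2_imp_integrable[OF m d]]]) simp
    also have "\<dots> \<le> ennreal ((1/2)^k * ?c)"
      using integral_norm_le_L2_norm[OF m d] mult_right_mono[OF less_imp_le[OF step[of k]], of ?c]
      by (intro ennreal_leI) simp
    finally show "(\<integral>\<^sup>+x. ennreal (norm (f (r (Suc k)) x - f (r k) x)) \<partial>?M) \<le> ennreal ((1/2)^k * ?c)" .
  qed simp_all
  also have "\<dots> = ennreal (\<Sum>k. (1/2)^k * ?c)"
    by (rule suminf_ennreal2) (auto intro!: summable_mult2 summable_geometric)
  also have "\<dots> < \<infinity>" by simp
  finally have "AE x in ?M. (\<Sum>k. ennreal (norm (f (r (Suc k)) x - f (r k) x))) \<noteq> \<infinity>"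
    by (intro nn_integral_PInf_AE) auto
  then have conv: "AE x in ?M. convergent (\<lambda>k. f (r k) x)"
  proof eventually_elim
    fix x assume "(\<Sum>k. ennreal (norm (f (r (Suc k)) x - f (r k) x))) \<noteq> \<infinity>"
    then have "summable (\<lambda>k. norm (f (r (Suc k)) x - f (r k) x))"
      by (intro summable_suminf_not_top) (auto simp: top_ennreal_def infinity_ennreal_def)
    then have "summable (\<lambda>k. f (r (Suc k)) x - f (r k) x)"
      by (rule summable_norm_cancel)
    then have "convergent (\<lambda>n. \<Sum>k<n. f (r (Suc k)) x - f (r k) x)"
      by (simp add: summable_iff_convergent)
    then have "convergent (\<lambda>n. f (r n) x - f (r 0) x)"
      using sum_lessThan_telescope[of "\<lambda>k. f (r k) x"] by simp
    then have "convergent (\<lambda>n. (f (r n) x - f (r 0) x) + f (r 0) x)"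
      by (rule convergent_add) (rule convergent_const)
    then show "convergent (\<lambda>k. f (r k) x)" by simp
  qed
  define g where "g x = lim (\<lambda>k. f (r k) x)" for x
  have g[measurable]: "g \<in> borel_measurable ?M"
    unfolding g_def by (intro borel_measurable_lim_metric) measurable
  have lim: "AE x in ?M. (\<lambda>k. f (r k) x) \<longlonglongrightarrow> g x"
    using conv unfolding g_def by eventually_elim (simp add: convergent_LIMSEQ_iff)
  \<comment> \<open>Fatou along the subsequence, with \<open>n\<close> fixed: this controls every
    late \<open>f n\<close>, not only the members of the subsequence.\<close>
  have bound: "(\<integral>\<^sup>+x. ennreal ((norm (f n x - g x))\<^sup>2) \<partial>?M) \<le> ennreal (((1/2)^k)\<^sup>2)" if "N k \<le> n" for n k
  proof -
    have "(\<integral>\<^sup>+x. ennreal ((norm (f n x - g x))\<^sup>2) \<partial>?M)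
        = (\<integral>\<^sup>+x. liminf (\<lambda>j. ennreal ((norm (f n x - f (r j) x))\<^sup>2)) \<partial>?M)"
    proof (rule nn_integral_cong_AE)
      show "AE x in ?M. ennreal ((norm (f n x - g x))\<^sup>2) = liminf (\<lambda>j. ennreal ((norm (f n x - f (r j) x))\<^sup>2))"
        using lim
      proof eventually_elim
        fix x assume "(\<lambda>k. f (r k) x) \<longlonglongrightarrow> g x"
        then have "(\<lambda>j. ennreal ((norm (f n x - f (r j) x))\<^sup>2)) \<longlonglongrightarrow> ennreal ((norm (f n x - g x))\<^sup>2)"
          by (intro tendsto_ennrealI tendsto_intros)
        then show "ennreal ((norm (f n x - g x))\<^sup>2) = liminf (\<lambda>j. ennreal ((norm (f n x - f (r j) x))\<^sup>2))"
          by (intro lim_imp_Liminf[symmetric]) auto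
      qed
    qed
    also have "\<dots> \<le> liminf (\<lambda>j. \<integral>\<^sup>+x. ennreal ((norm (f n x - f (r j) x))\<^sup>2) \<partial>?M)"
      by (rule nn_integral_liminf) measurable
    also have "\<dots> \<le> ennreal (((1/2)^k)\<^sup>2)"
    proof (rule Liminf_le)
      show "\<forall>\<^sub>F j in sequentially. (\<integral>\<^sup>+x. ennreal ((norm (f n x - f (r j) x))\<^sup>2) \<partial>?M) \<le> ennreal (((1/2)^k)\<^sup>2)"
        using eventually_ge_at_top[of k]
      proof eventually_elim
        fix j assume "k \<le> j"
        then have "L2_norm \<Omega> (\<lambda>x. f n x - f (r j) x) < (1/2)^k"
          by (intro N that rN')
        then show "(\<integral>\<^sup>+x. ennreal ((norm (f n x - f (r j) x))\<^sup>2) \<partial>?M) \<le> ennreal (((1/2)^k)\<^sup>2)"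
          by (subst nn[OF L2_diff[OF f f]]) (intro ennreal_leI power_mono, auto)
      qed
    qed simp
    finally show ?thesis .
  qed
  have d: "(\<lambda>x. f n x - g x) \<in> L2 \<Omega>" if "N 0 \<le> n" for n
  proof -
    have "(\<integral>\<^sup>+x. ennreal ((norm (f n x - g x))\<^sup>2) \<partial>?M) < \<infinity>"
      using bound[OF that] by (rule le_less_trans) simp
    then show ?thesis
      unfolding L2_def by (auto simp: integrable_iff_bounded)
  qed
  have gL2: "g \<in> L2 \<Omega>"
    using L2_diff[OF f d, of "N 0" "N 0"] by simp
  have "(\<lambda>n. L2_norm \<Omega> (\<lambda>x. f n x - g x)) \<longlonglongrightarrow> 0"
  proof (rule LIMSEQ_I)
    fix e :: real assume "0 < e"
    then obtain k where k: "(1/2::real)^k < e" using real_arch_pow_inv[of e "1/2"] by auto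
    have "norm (L2_norm \<Omega> (\<lambda>x. f n x - g x) - 0) < e" if n: "N k \<le> n" for n
    proof -
      have "ennreal ((L2_norm \<Omega> (\<lambda>x. f n x - g x))\<^sup>2) \<le> ennreal (((1/2)^k)\<^sup>2)"
        using bound[OF n] nn[OF L2_diff[OF f gL2]] by simp
      then have "(L2_norm \<Omega> (\<lambda>x. f n x - g x))\<^sup>2 \<le> ((1/2)^k)\<^sup>2"
        by (simp add: ennreal_le_iff)
      then have "L2_norm \<Omega> (\<lambda>x. f n x - g x) \<le> (1/2)^k"
        by (rule power2_le_imp_le) simp
      with k show ?thesis by simp
    qed
    then show "\<exists>no. \<forall>n\<ge>no. norm (L2_norm \<Omega> (\<lambda>x. f n x - g x) - 0) < e" by blast
  qed
  with gL2 show ?thesis by blast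
qed

lemma L2_vec_iff:
  fixes G :: "real^'n \<Rightarrow> complex^'m"
  shows "G \<in> L2 \<Omega> \<longleftrightarrow> (\<forall>i. (\<lambda>x. G x $ i) \<in> L2 \<Omega>)"
proof
  assume "G \<in> L2 \<Omega>"
  then show "\<forall>i. (\<lambda>x. G x $ i) \<in> L2 \<Omega>"
    using L2_bounded_linear[OF bounded_linear_vec_nth] by blast
next
  assume *: "\<forall>i. (\<lambda>x. G x $ i) \<in> L2 \<Omega>"
  have lin: "bounded_linear (\<lambda>z::complex. axis i z :: complex^'m)" for i
    unfolding linear_conv_bounded_linear[symmetric] by (rule linearI) (auto simp: vec_eq_iff axis_def)
  have "(\<lambda>x. \<Sum>i\<in>UNIV. (axis i (G x $ i) :: complex^'m)) \<in> L2 \<Omega>"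
    by (rule L2_sum) (use * L2_bounded_linear[OF lin] in blast)
  moreover have "(\<Sum>i\<in>UNIV. (axis i (G x $ i) :: complex^'m)) = G x" for x
    by (simp add: vec_eq_iff axis_def if_distrib cong: if_cong)
  ultimately show "G \<in> L2 \<Omega>" by simp
qed

lemma L2_restrict:
  fixes f :: "real^'n \<Rightarrow> 'b::euclidean_space"
  assumes f: "f \<in> L2 \<Omega>" and sub: "U \<subseteq> \<Omega>" and U: "U \<in> sets lebesgue" and \<Omega>: "\<Omega> \<in> sets lebesgue"
  shows "f \<in> L2 U" and "L2_norm U f \<le> L2_norm \<Omega> f"
proof -
  have meas: "f \<in> borel_measurable (lebesgue_on U)"
    by (rule measurable_restrict_mono[OF L2_measurable[OF f] sub])
  have eq: "restrict_space (lebesgue_on \<Omega>) U = lebesgue_on U"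
    using sub by (simp add: restrict_restrict_space Int_absorb1 U \<Omega>)
  have sets: "U \<inter> space (lebesgue_on \<Omega>) \<in> sets (lebesgue_on \<Omega>)"
    using U sub \<Omega> by (simp add: sets_restrict_space_iff Int_absorb2)
  have int: "integrable (lebesgue_on \<Omega>) (\<lambda>x. indicator U x *\<^sub>R (norm (f x))\<^sup>2)"
    using L2_integrable_norm2[OF f] sets by (intro integrable_mult_indicator) (simp_all add: Int_absorb2 sub)
  then have "integrable (lebesgue_on U) (\<lambda>x. (norm (f x))\<^sup>2)"
    using integrable_restrict_space[OF sets, of "\<lambda>x. (norm (f x))\<^sup>2"] eq by simp
  with meas show "f \<in> L2 U" by (simp add: L2_def)
  have "(\<integral>x. (norm (f x))\<^sup>2 \<partial>lebesgue_on U) = (\<integral>x. indicator U x *\<^sub>R (norm (f x))\<^sup>2 \<partial>lebesgue_on \<Omega>)"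
    using integral_restrict_space[OF sets, of "\<lambda>x. (norm (f x))\<^sup>2"] eq by simp
  also have "\<dots> \<le> (\<integral>x. (norm (f x))\<^sup>2 \<partial>lebesgue_on \<Omega>)"
    by (rule integral_mono[OF int L2_integrable_norm2[OF f]]) (simp add: indicator_def)
  finally show "L2_norm U f \<le> L2_norm \<Omega> f"
    by (simp add: L2_norm_def)
qed

text \<open>The minimiser of \<open>B x x / 2 - F x\<close> exists by completeness and the parallelogram identity.
  The space is only given by its operations, as the function type carries no vector space structure.\<close>

lemma Riesz_representation:
  fixes H :: "'a set" and add :: "'a \<Rightarrow> 'a \<Rightarrow> 'a" and smul :: "real \<Rightarrow> 'a \<Rightarrow> 'a"
    and B :: "'a \<Rightarrow> 'a \<Rightarrow> real" and F :: "'a \<Rightarrow> real"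
  assumes ne: "H \<noteq> {}"
    and add: "\<And>x y. x \<in> H \<Longrightarrow> y \<in> H \<Longrightarrow> add x y \<in> H"
    and smul: "\<And>c x. x \<in> H \<Longrightarrow> smul c x \<in> H"
    and sym: "\<And>x y. x \<in> H \<Longrightarrow> y \<in> H \<Longrightarrow> B x y = B y x"
    and B_add: "\<And>x y z. x \<in> H \<Longrightarrow> y \<in> H \<Longrightarrow> z \<in> H \<Longrightarrow> B (add x y) z = B x z + B y z"
    and B_smul: "\<And>c x z. x \<in> H \<Longrightarrow> z \<in> H \<Longrightarrow> B (smul c x) z = c * B x z"
    and B_nonneg: "\<And>x. x \<in> H \<Longrightarrow> 0 \<le> B x x"
    and F_add: "\<And>x y. x \<in> H \<Longrightarrow> y \<in> H \<Longrightarrow> F (add x y) = F x + F y"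
    and F_smul: "\<And>c x. x \<in> H \<Longrightarrow> F (smul c x) = c * F x"
    and F_bound: "\<And>x. x \<in> H \<Longrightarrow> \<bar>F x\<bar> \<le> C * sqrt (B x x)"
    and complete: "\<And>s. \<lbrakk>\<And>n. s n \<in> H;
        \<And>e. 0 < e \<Longrightarrow> \<exists>N. \<forall>m\<ge>N. \<forall>n\<ge>N. sqrt (B (add (s m) (smul (-1) (s n))) (add (s m) (smul (-1) (s n)))) < e\<rbrakk>
        \<Longrightarrow> \<exists>q\<in>H. (\<lambda>n. sqrt (B (add (s n) (smul (-1) q)) (add (s n) (smul (-1) q)))) \<longlonglongrightarrow> 0"
  shows "\<exists>q\<in>H. \<forall>t\<in>H. B q t = F t"
proof -
  have B_add2: "B z (add x y) = B z x + B z y" if "x \<in> H" "y \<in> H" "z \<in> H" for x y z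
    using that by (metis B_add add sym)
  have B_smul2: "B z (smul c x) = c * B z x" if "x \<in> H" "z \<in> H" for x z c
    using that by (metis B_smul smul sym)
  note lin = B_add B_add2 B_smul B_smul2 F_add F_smul add smul
  have C: "\<bar>F x\<bar> \<le> \<bar>C\<bar> * sqrt (B x x)" if "x \<in> H" for x
  proof -
    have "C * sqrt (B x x) \<le> \<bar>C\<bar> * sqrt (B x x)" using B_nonneg[OF that] by (intro mult_right_mono) auto
    with F_bound[OF that] show ?thesis by linarith
  qed
  \<comment> \<open>Twice the functional announced above.\<close>
  define J where "J x = B x x - 2 * F x" for x
  have lower: "- (C\<^sup>2) \<le> J x" if "x \<in> H" for x
  proof -
    have "0 \<le> (sqrt (B x x) - \<bar>C\<bar>)\<^sup>2" by simp
    also have "\<dots> = B x x - 2 * (\<bar>C\<bar> * sqrt (B x x)) + C\<^sup>2"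
      using B_nonneg[OF that] by (simp add: power2_diff)
    finally show ?thesis using C[OF that] unfolding J_def by linarith
  qed
  define d where "d = (INF x\<in>H. J x)"
  have bdd: "bdd_below (J ` H)" using lower by (intro bdd_belowI2)
  have d_le: "d \<le> J x" if "x \<in> H" for x
    unfolding d_def by (rule cINF_lower[OF bdd that])
  have "\<exists>x\<in>H. J x < d + 1 / real (Suc n)" for n
    using cINF_less_iff[OF ne bdd, of "d + 1 / real (Suc n)"] unfolding d_def by simp
  then obtain s where s: "\<And>n. s n \<in> H" "\<And>n. J (s n) < d + 1 / real (Suc n)"
    by metis
  let ?D = "\<lambda>x y. add x (smul (-1) y)"
  \<comment> \<open>The parallelogram identity, combined with \<open>d \<le> J\<close> at the
    midpoint of \<open>x\<close> and \<open>y\<close>.\<close>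
  have par: "B (?D x y) (?D x y) \<le> 2 * J x + 2 * J y - 4 * d" if "x \<in> H" "y \<in> H" for x y
  proof -
    have "d \<le> J (smul (1/2) (add x y))" using that by (intro d_le) (simp add: lin)
    moreover have "J (smul (1/2) (add x y)) = (B x x + 2 * B x y + B y y) / 4 - (F x + F y)"
      using that sym[of y x] by (simp add: J_def lin field_simps)
    moreover have "B (?D x y) (?D x y) = B x x - 2 * B x y + B y y"
      using that sym[of y x] by (simp add: lin)
    ultimately show ?thesis unfolding J_def by (simp add: field_simps)
  qed
  obtain q where q: "q \<in> H" "(\<lambda>n. sqrt (B (?D (s n) q) (?D (s n) q))) \<longlonglongrightarrow> 0"
  proof -
    have "\<exists>q\<in>H. (\<lambda>n. sqrt (B (?D (s n) q) (?D (s n) q))) \<longlonglongrightarrow> 0"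
    proof (rule complete[OF s(1)])
      fix e :: real assume e: "0 < e"
      \<comment> \<open>By \<open>par\<close> the squared distance of two late members is below four
        times the tolerance, hence the quarter.\<close>
      then obtain N where N: "inverse (real (Suc N)) < e\<^sup>2 / 4"
        using reals_Archimedean[of "e\<^sup>2 / 4"] by auto
      have "sqrt (B (?D (s m) (s n)) (?D (s m) (s n))) < e" if "N \<le> m" "N \<le> n" for m n
      proof (rule real_less_lsqrt)
        have "1 / real (Suc m) \<le> inverse (real (Suc N))" "1 / real (Suc n) \<le> inverse (real (Suc N))"
          using that by (simp_all add: field_simps)
        then show "B (?D (s m) (s n)) (?D (s m) (s n)) < e\<^sup>2"
          using par[OF s(1)[of m] s(1)[of n]] s(2)[of m] s(2)[of n] N by linarith
      qed (use e B_nonneg add smul s in auto)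
      then show "\<exists>N. \<forall>m\<ge>N. \<forall>n\<ge>N. sqrt (B (?D (s m) (s n)) (?D (s m) (s n))) < e" by blast
    qed
    with that show ?thesis by blast
  qed
  have CS: "(B x y)\<^sup>2 \<le> B x x * B y y" if "x \<in> H" "y \<in> H" for x y
  proof (rule quadratic_nonneg_discriminant)
    fix t
    have "B (add x (smul t y)) (add x (smul t y)) = B x x + 2 * t * B x y + t\<^sup>2 * B y y"
      using that sym[of y x] by (simp add: lin power2_eq_square algebra_simps)
    then show "0 \<le> B x x + 2 * t * B x y + t\<^sup>2 * B y y"
      using B_nonneg[of "add x (smul t y)"] that by (simp add: lin)
  qed
  have qd: "J q \<le> d"
  proof (rule LIMSEQ_le_const)
    let ?b = "\<lambda>n. sqrt (B (?D (s n) q) (?D (s n) q))"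
    have "(\<lambda>n. d + 1 / real (Suc n) + 2 * (sqrt (B q q) + \<bar>C\<bar>) * ?b n) \<longlonglongrightarrow> d + 0 + 2 * (sqrt (B q q) + \<bar>C\<bar>) * 0"
      by (intro tendsto_add tendsto_mult tendsto_const q(2) LIMSEQ_Suc[OF lim_1_over_n])
    then show "(\<lambda>n. d + 1 / real (Suc n) + 2 * (sqrt (B q q) + \<bar>C\<bar>) * ?b n) \<longlonglongrightarrow> d" by simp
    have "J q \<le> d + 1 / real (Suc n) + 2 * (sqrt (B q q) + \<bar>C\<bar>) * ?b n" for n
    proof -
      \<comment> \<open>In terms of the error \<open>?e\<close>, the value \<open>J q\<close>
        exceeds \<open>J (s n)\<close> by at most \<open>2 * (sqrt (B q q) + \<bar>C\<bar>)\<close>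
        times the norm of \<open>?e\<close>; the term \<open>- B ?e ?e\<close> has the good
        sign.\<close>
      let ?e = "?D (s n) q"
      have e: "?e \<in> H" using s(1) q(1) by (simp add: lin)
      have BD: "B ?e ?e = B (s n) (s n) - 2 * B (s n) q + B q q" "B ?e q = B (s n) q - B q q" "F ?e = F (s n) - F q"
        using s(1)[of n] q(1) sym[of q "s n"] by (simp_all add: lin)
      have "\<bar>B ?e q\<bar> \<le> ?b n * sqrt (B q q)"
        using real_sqrt_le_mono[OF CS[OF e q(1)]] by (simp add: real_sqrt_mult)
      moreover have "\<bar>F ?e\<bar> \<le> \<bar>C\<bar> * ?b n" by (rule C[OF e])
      moreover have "J q = J (s n) - B ?e ?e - 2 * B ?e q + 2 * F ?e"
        unfolding J_def BD by simp
      moreover have "2 * (sqrt (B q q) + \<bar>C\<bar>) * ?b n = 2 * (?b n * sqrt (B q q)) + 2 * (\<bar>C\<bar> * ?b n)"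
        by (simp add: algebra_simps)
      ultimately show ?thesis using B_nonneg[OF e] s(2)[of n] by linarith
    qed
    then show "\<exists>N. \<forall>n\<ge>N. J q \<le> d + 1 / real (Suc n) + 2 * (sqrt (B q q) + \<bar>C\<bar>) * ?b n" by blast
  qed
  have "B q t = F t" if t: "t \<in> H" for t
  proof -
    \<comment> \<open>First variation at the minimiser. The constant term 0 is displayed so that the
      discriminant inequality forces the linear coefficient to vanish.\<close>
    have "0 \<le> 0 + 2 * \<epsilon> * (B q t - F t) + \<epsilon>\<^sup>2 * B t t" for \<epsilon>
    proof -
      have "J q \<le> J (add q (smul \<epsilon> t))"
        using qd d_le[of "add q (smul \<epsilon> t)"] t q(1) by (simp add: lin)
      also have "\<dots> = J q + 2 * \<epsilon> * (B q t - F t) + \<epsilon>\<^sup>2 * B t t"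
        using t q(1) sym[of t q] by (simp add: J_def lin power2_eq_square algebra_simps)
      finally show ?thesis by simp
    qed
    from quadratic_nonneg_discriminant[OF this] show ?thesis by simp
  qed
  with q(1) show ?thesis by blast
qed

section \<open>Test functions\<close>

lemma pderivative_eq:
  assumes "(f has_derivative f') (at x)"
  shows "pderivative i f x = f' (axis i 1)"
  unfolding pderivative_def by (simp add: frechet_derivative_at[OF assms, symmetric])

lemma Ck_Suc_D: "Ck (Suc k) f \<Longrightarrow> Ck k f"
proof (induction k arbitrary: f)
  case 0
  then show ?case
    by (auto intro!: continuous_at_imp_continuous_on differentiable_imp_continuous_within)
next
  case (Suc k)
  then show ?case by (metis Ck.simps(2))
qed

lemma Ck_const: "Ck k (\<lambda>x. c)"
proof (induction k arbitrary: c)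
  case (Suc k)
  have "pderivative i (\<lambda>x. c) = (\<lambda>x. 0)" for i :: 'a
    by (rule ext, subst pderivative_eq[OF has_derivative_const]) simp
  then show ?case using Suc by simp
qed simp

lemma pderivative_add:
  assumes f: "f differentiable (at x)" and g: "g differentiable (at x)"
  shows "pderivative i (\<lambda>x. f x + g x) x = pderivative i f x + pderivative i g x"
  using pderivative_eq[OF has_derivative_add[OF f[unfolded frechet_derivative_works] g[unfolded frechet_derivative_works]]]
  by (simp add: pderivative_def)

lemma pderivative_mult:
  assumes f: "f differentiable (at x)" and g: "g differentiable (at x)"
  shows "pderivative i (\<lambda>x. f x * g x) x = f x * pderivative i g x + pderivative i f x * g x"
  using pderivative_eq[OF has_derivative_mult[OF f[unfolded frechet_derivative_works] g[unfolded frechet_derivative_works]]]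
  by (simp add: pderivative_def)

lemma Ck_add: "Ck k f \<Longrightarrow> Ck k g \<Longrightarrow> Ck k (\<lambda>x. f x + g x)"
proof (induction k arbitrary: f g)
  case 0
  then show ?case by (simp add: continuous_on_add)
next
  case (Suc k)
  then have "pderivative i (\<lambda>x. f x + g x) = (\<lambda>x. pderivative i f x + pderivative i g x)" for i
    by (intro ext pderivative_add) auto
  with Suc show ?case by simp
qed

lemma Ck_mult: "Ck k f \<Longrightarrow> Ck k g \<Longrightarrow> Ck k (\<lambda>x. f x * g x)"
proof (induction k arbitrary: f g)
  case 0
  then show ?case by (simp add: continuous_on_mult)
next
  case (Suc k)
  then have eq: "pderivative i (\<lambda>x. f x * g x) = (\<lambda>x. f x * pderivative i g x + pderivative i f x * g x)" for i
    by (intro ext pderivative_mult) auto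
  have "Ck k (\<lambda>x. f x * pderivative i g x + pderivative i f x * g x)" for i
    using Suc.prems by (intro Ck_add Suc.IH Ck_Suc_D[OF Suc.prems(1)] Ck_Suc_D[OF Suc.prems(2)]) auto
  with Suc.prems eq show ?case by simp
qed

lemma Ck_prod: "(\<And>i. i \<in> I \<Longrightarrow> Ck k (f i)) \<Longrightarrow> Ck k (\<lambda>x. \<Prod>i\<in>I. f i x)"
  by (induction I rule: infinite_finite_induct) (simp_all add: Ck_const Ck_mult)

text \<open>The function and its translate have the same candidates for the derivative at
  corresponding points, so the choice in \<open>frechet_derivative\<close> agrees even where no
  derivative exists.\<close>

lemma pderivative_shift: "pderivative i (\<lambda>x. f (x - a)) = (\<lambda>x. pderivative i f (x - a))"
proof
  fix x
  have "(f has_derivative D) (at (x - a)) \<longleftrightarrow> ((\<lambda>x. f (x - a)) has_derivative D) (at x)" for D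
  proof
    assume "(f has_derivative D) (at (x - a))"
    moreover have "((\<lambda>x. x - a) has_derivative (\<lambda>h. h)) (at x)"
      by (auto intro!: derivative_eq_intros)
    ultimately show "((\<lambda>x. f (x - a)) has_derivative D) (at x)"
      using has_derivative_compose[of "\<lambda>x. x - a" "\<lambda>h. h" x UNIV f D] by simp
  next
    assume "((\<lambda>x. f (x - a)) has_derivative D) (at x)"
    moreover have "((\<lambda>x. x + a) has_derivative (\<lambda>h. h)) (at (x - a))"
      by (auto intro!: derivative_eq_intros)
    ultimately show "(f has_derivative D) (at (x - a))"
      using has_derivative_compose[of "\<lambda>x. x + a" "\<lambda>h. h" "x - a" UNIV "\<lambda>x. f (x - a)" D] by simp
  qed
  then show "pderivative i (\<lambda>x. f (x - a)) x = pderivative i f (x - a)"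
    unfolding pderivative_def frechet_derivative_def by simp
qed

lemma Ck_shift: "Ck k f \<Longrightarrow> Ck k (\<lambda>x. f (x - a))"
proof (induction k arbitrary: f)
  case 0
  have "continuous_on UNIV (\<lambda>x. f (x - a))"
    by (rule continuous_on_compose2[of UNIV f]) (use 0 in \<open>auto intro!: continuous_intros\<close>)
  then show ?case by simp
next
  case (Suc k)
  have "(\<lambda>x. f (x - a)) differentiable (at x)" for x
    by (rule differentiable_compose[of f]) (use Suc.prems in auto)
  with Suc show ?case by (simp add: pderivative_shift)
qed

text \<open>All derivatives of \<open>exp (- 1 / t)\<close> on \<open>t > 0\<close> have this form.\<close>

definition poly_exp_inverse :: "real poly \<Rightarrow> real \<Rightarrow> real" where
  "poly_exp_inverse p t = (if t > 0 then poly p (1 / t) * exp (- 1 / t) else 0)"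

lemma poly_exp_tendsto_0: "((\<lambda>y. poly p y * exp (- y)) \<longlongrightarrow> (0::real)) at_top"
proof -
  have "((\<lambda>y. \<Sum>i\<le>degree p. coeff p i * (y ^ i / exp y)) \<longlongrightarrow> (\<Sum>i\<le>degree p. coeff p i * 0)) at_top"
    by (intro tendsto_sum tendsto_mult tendsto_const tendsto_power_div_exp_0)
  then show ?thesis
    by (simp add: poly_altdef sum_distrib_right exp_minus divide_inverse mult.assoc)
qed

text \<open>With \<open>s = 1 / t\<close> the chain rule gives
  \<open>s^2 * (p(s) - p'(s)) * exp (- s)\<close>, which explains the factor
  \<open>[:0, 0, 1:]\<close>. At 0 the right-hand difference quotient is
  \<open>y * p(y) * exp (- y)\<close> with \<open>y\<close> tending to infinity.\<close>

lemma poly_exp_inverse_has_derivative: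
  "(poly_exp_inverse p has_real_derivative poly_exp_inverse ([:0, 0, 1:] * (p - pderiv p)) t) (at t)"
proof -
  consider "t < 0" | "t > 0" | "t = 0" by linarith
  then show ?thesis
  proof cases
    case 1
    have "((\<lambda>t. 0) has_real_derivative 0) (at t)" by simp
    moreover have "\<forall>\<^sub>F s in nhds t. poly_exp_inverse p s = 0"
      using eventually_nhds_in_open[of "{..<0}" t] 1
      by (auto elim!: eventually_mono simp: poly_exp_inverse_def)
    ultimately show ?thesis using 1
      by (subst DERIV_cong_ev[OF refl _ refl]) (auto simp: poly_exp_inverse_def)
  next
    case 2
    have "((\<lambda>t. poly p (1 / t) * exp (- 1 / t)) has_real_derivative
        poly_exp_inverse ([:0, 0, 1:] * (p - pderiv p)) t) (at t)"
      using 2 by (auto intro!: derivative_eq_intros DERIV_chain2[OF poly_DERIV]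
          simp: poly_exp_inverse_def field_simps power2_eq_square)
    moreover have "\<forall>\<^sub>F s in nhds t. poly_exp_inverse p s = poly p (1 / s) * exp (- 1 / s)"
      using eventually_nhds_in_open[of "{0<..}" t] 2
      by (auto elim!: eventually_mono simp: poly_exp_inverse_def)
    ultimately show ?thesis
      by (subst DERIV_cong_ev[OF refl _ refl]) auto
  next
    case 3
    have "((\<lambda>h. poly_exp_inverse p h / h) \<longlongrightarrow> 0) (at 0)"
      unfolding filterlim_at_split
    proof
      have "\<forall>\<^sub>F h in at_left 0. 0 = poly_exp_inverse p h / h"
        unfolding eventually_at_filter
        by (auto simp: poly_exp_inverse_def)
      then show "((\<lambda>h. poly_exp_inverse p h / h) \<longlongrightarrow> 0) (at_left 0)"
        by (rule Lim_transform_eventually[OF tendsto_const])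
      have "((\<lambda>h. poly (pCons 0 p) (inverse h) * exp (- inverse h)) \<longlongrightarrow> 0) (at_right 0)"
        by (rule filterlim_compose[OF poly_exp_tendsto_0 filterlim_inverse_at_top_right])
      moreover have "\<forall>\<^sub>F h in at_right 0. poly (pCons 0 p) (inverse h) * exp (- inverse h) = poly_exp_inverse p h / h"
        unfolding eventually_at_filter by (auto simp: poly_exp_inverse_def divide_inverse)
      ultimately show "((\<lambda>h. poly_exp_inverse p h / h) \<longlongrightarrow> 0) (at_right 0)"
        by (rule Lim_transform_eventually)
    qed
    then show ?thesis
      using 3 by (simp add: DERIV_def poly_exp_inverse_def)
  qed
qed

text \<open>Partial derivatives stay in the family up to constant factors but change the polynomial,
  so the induction generalises over \<open>p\<close>. The affine argument, with either sign of
  \<open>\<alpha>\<close>, covers both faces of a box in direction \<open>i\<close>.\<close>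

lemma Ck_poly_exp_inverse:
  "Ck k (\<lambda>x::real^'n. complex_of_real (poly_exp_inverse p (\<alpha> * x $ i + \<beta>)))"
proof (induction k arbitrary: p)
  case 0
  have "continuous_on UNIV (poly_exp_inverse p)"
    by (rule DERIV_continuous_on) (rule has_field_derivative_at_within, rule poly_exp_inverse_has_derivative)
  then have "continuous_on UNIV (\<lambda>x::real^'n. poly_exp_inverse p (\<alpha> * x $ i + \<beta>))"
    by (rule continuous_on_compose2) (auto intro!: continuous_intros)
  then show ?case by (simp add: continuous_on_of_real)
next
  case (Suc k)
  let ?q = "[:0, 0, 1:] * (p - pderiv p)"
  have d: "((\<lambda>x::real^'n. complex_of_real (poly_exp_inverse p (\<alpha> * x $ i + \<beta>))) has_derivative
      (\<lambda>h. complex_of_real (\<alpha> * h $ i * poly_exp_inverse ?q (\<alpha> * x $ i + \<beta>)))) (at x)" for x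
  proof -
    have "((\<lambda>x::real^'n. \<alpha> * x $ i + \<beta>) has_derivative (\<lambda>h. \<alpha> * h $ i)) (at x)"
      by (auto intro!: derivative_eq_intros bounded_linear_imp_has_derivative[OF bounded_linear_vec_nth])
    from has_derivative_compose[OF this poly_exp_inverse_has_derivative[of p, unfolded has_field_derivative_def]]
    have "((\<lambda>x::real^'n. poly_exp_inverse p (\<alpha> * x $ i + \<beta>)) has_derivative
        (\<lambda>h. poly_exp_inverse ?q (\<alpha> * x $ i + \<beta>) * (\<alpha> * h $ i))) (at x)" .
    from has_derivative_of_real[OF this] show ?thesis by (simp add: mult.commute)
  qed
  have "pderivative j (\<lambda>x::real^'n. complex_of_real (poly_exp_inverse p (\<alpha> * x $ i + \<beta>)))
      = (\<lambda>x. of_real (\<alpha> * axis j 1 $ i) * complex_of_real (poly_exp_inverse ?q (\<alpha> * x $ i + \<beta>)))" for j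
    by (rule ext, subst pderivative_eq[OF d]) simp
  moreover have "Ck k (\<lambda>x. of_real (\<alpha> * axis j 1 $ i) * complex_of_real (poly_exp_inverse ?q (\<alpha> * (x::real^'n) $ i + \<beta>)))" for j
    by (rule Ck_mult[OF Ck_const Suc])
  moreover have "(\<lambda>x::real^'n. complex_of_real (poly_exp_inverse p (\<alpha> * x $ i + \<beta>))) differentiable (at x)" for x
    using d by (rule differentiableI)
  ultimately show ?case by (simp only: Ck.simps) blast
qed

section \<open>Closure properties of test functions\<close>

lemma test_functionsI:
  assumes "\<And>k. Ck k \<theta>" "compact K" "K \<subseteq> \<Omega>" "\<And>x. x \<notin> K \<Longrightarrow> \<theta> x = 0"
  shows "\<theta> \<in> test_functions \<Omega>"
proof -
  have "closure {x. \<theta> x \<noteq> 0} \<subseteq> K"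
    using assms compact_imp_closed by (intro closure_minimal) auto
  then have "compact (closure {x. \<theta> x \<noteq> 0})"
    using assms(2) compact_Int_closed[of K "closure {x. \<theta> x \<noteq> 0}"] by (simp add: Int_absorb1)
  with \<open>closure _ \<subseteq> K\<close> assms show ?thesis by (auto simp: test_functions_def)
qed

lemma test_functionsE:
  assumes "\<theta> \<in> test_functions \<Omega>"
  obtains K where "compact K" "K \<subseteq> \<Omega>" "\<And>x. x \<notin> K \<Longrightarrow> \<theta> x = 0" "\<And>k. Ck k \<theta>"
proof
  show "compact (closure {x. \<theta> x \<noteq> 0})" "closure {x. \<theta> x \<noteq> 0} \<subseteq> \<Omega>" "\<And>k. Ck k \<theta>"
    using assms by (auto simp: test_functions_def)
  show "\<theta> x = 0" if "x \<notin> closure {x. \<theta> x \<noteq> 0}" for x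
    using that closure_subset[of "{x. \<theta> x \<noteq> 0}"] by auto
qed

lemma test_functions_Ck: "\<theta> \<in> test_functions \<Omega> \<Longrightarrow> Ck k \<theta>"
  by (simp add: test_functions_def)

lemma test_functions_mono: "U \<subseteq> \<Omega> \<Longrightarrow> test_functions U \<subseteq> test_functions \<Omega>"
  by (auto simp: test_functions_def)

lemma test_functions_zero: "(\<lambda>x. 0) \<in> test_functions \<Omega>"
  by (rule test_functionsI[of _ "{}"]) (auto simp: Ck_const)

lemma test_functions_add:
  assumes "\<theta> \<in> test_functions \<Omega>" "\<eta> \<in> test_functions \<Omega>"
  shows "(\<lambda>x. \<theta> x + \<eta> x) \<in> test_functions \<Omega>"
proof -
  from test_functionsE[OF assms(1)] obtain K
    where K: "compact K" "K \<subseteq> \<Omega>" "\<And>x. x \<notin> K \<Longrightarrow> \<theta> x = 0" "\<And>k. Ck k \<theta>" by blast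
  from test_functionsE[OF assms(2)] obtain L
    where L: "compact L" "L \<subseteq> \<Omega>" "\<And>x. x \<notin> L \<Longrightarrow> \<eta> x = 0" "\<And>k. Ck k \<eta>" by blast
  show ?thesis
    by (rule test_functionsI[of _ "K \<union> L"]) (use K L in \<open>auto intro!: Ck_add compact_Un\<close>)
qed

lemma test_functions_mult:
  assumes "\<theta> \<in> test_functions \<Omega>" "\<And>k. Ck k \<eta>"
  shows "(\<lambda>x. \<eta> x * \<theta> x) \<in> test_functions \<Omega>"
proof -
  from test_functionsE[OF assms(1)] obtain K
    where K: "compact K" "K \<subseteq> \<Omega>" "\<And>x. x \<notin> K \<Longrightarrow> \<theta> x = 0" "\<And>k. Ck k \<theta>" by blast
  show ?thesis
    by (rule test_functionsI[of _ K]) (use K assms(2) in \<open>auto intro!: Ck_mult\<close>)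
qed

lemma test_functions_cmult: "\<theta> \<in> test_functions \<Omega> \<Longrightarrow> (\<lambda>x. c * \<theta> x) \<in> test_functions \<Omega>"
  by (rule test_functions_mult[OF _ Ck_const])

lemma test_functions_diff:
  "\<theta> \<in> test_functions \<Omega> \<Longrightarrow> \<eta> \<in> test_functions \<Omega> \<Longrightarrow> (\<lambda>x. \<theta> x - \<eta> x) \<in> test_functions \<Omega>"
  using test_functions_add[OF _ test_functions_cmult, of \<theta> \<Omega> \<eta> "-1"] by simp

lemma test_functions_differentiable: "\<theta> \<in> test_functions \<Omega> \<Longrightarrow> \<theta> differentiable (at x)"
  using test_functions_Ck[of \<theta> \<Omega> "Suc 0"] by simp

lemma test_functions_pderivative:
  assumes "\<theta> \<in> test_functions \<Omega>"
  shows "pderivative i \<theta> \<in> test_functions \<Omega>"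
proof -
  from test_functionsE[OF assms] obtain K
    where K: "compact K" "K \<subseteq> \<Omega>" "\<And>x. x \<notin> K \<Longrightarrow> \<theta> x = 0" "\<And>k. Ck k \<theta>" by blast
  have "pderivative i \<theta> x = 0" if "x \<notin> K" for x
  proof -
    have "open (- K)" using compact_imp_closed[OF K(1)] by (rule open_Compl)
    moreover have "0 = \<theta> y" if "y \<in> - K" for y
      using K(3)[of y] that by simp
    ultimately have "(\<theta> has_derivative (\<lambda>h. 0)) (at x)"
      using that by (intro has_derivative_transform_within_open[OF has_derivative_const, where s = "- K"]) simp_all
    from pderivative_eq[OF this] show ?thesis .
  qed
  moreover have "Ck k (pderivative i \<theta>)" for k
    using K(4)[of "Suc k"] by simp
  ultimately show ?thesis
    using K by (intro test_functionsI[of _ K]) auto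
qed

lemma test_functions_shift:
  assumes "\<theta> \<in> test_functions \<Omega>"
  shows "(\<lambda>x. \<theta> (x - a)) \<in> test_functions ((+) a ` \<Omega>)"
proof -
  from test_functionsE[OF assms] obtain K
    where K: "compact K" "K \<subseteq> \<Omega>" "\<And>x. x \<notin> K \<Longrightarrow> \<theta> x = 0" "\<And>k. Ck k \<theta>" by blast
  show ?thesis
  proof (rule test_functionsI[of _ "(+) a ` K"])
    show "\<theta> (x - a) = 0" if "x \<notin> (+) a ` K" for x
    proof (rule K(3), rule notI)
      assume "x - a \<in> K"
      then have "a + (x - a) \<in> (+) a ` K" by (rule imageI)
      with that show False by simp
    qed
  qed (use K in \<open>auto intro!: Ck_shift compact_translation\<close>)
qed

lemma test_functions_continuous: "\<theta> \<in> test_functions \<Omega> \<Longrightarrow> continuous_on UNIV \<theta>"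
  using test_functions_Ck[of \<theta> \<Omega> 0] by simp

lemma test_functions_bounded:
  assumes "\<theta> \<in> test_functions \<Omega>"
  obtains B where "0 \<le> B" "\<And>x. norm (\<theta> x) \<le> B"
proof -
  from test_functionsE[OF assms] obtain K
    where "compact K" "K \<subseteq> \<Omega>" "\<And>x. x \<notin> K \<Longrightarrow> \<theta> x = 0" "\<And>k. Ck k \<theta>" by blast
  note K = this(1,3)
  have "compact (\<theta> ` K)"
    by (rule compact_continuous_image[OF continuous_on_subset[OF test_functions_continuous[OF assms]] K(1)]) simp
  then obtain B where "\<forall>y\<in>\<theta> ` K. norm y \<le> B"
    using compact_imp_bounded[of "\<theta> ` K"] unfolding bounded_iff by blast
  then have B: "\<And>x. x \<in> K \<Longrightarrow> norm (\<theta> x) \<le> B" by blast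
  have "norm (\<theta> x) \<le> max 0 B" for x
    using B[of x] K(2)[of x] by (cases "x \<in> K") auto
  then show thesis using that[of "max 0 B"] by simp
qed

lemma continuous_imp_measurable_lebesgue_on:
  fixes f :: "'a::euclidean_space \<Rightarrow> 'b::euclidean_space"
  shows "continuous_on UNIV f \<Longrightarrow> f \<in> borel_measurable (lebesgue_on S)"
  by (simp add: borel_measurable_continuous_onI measurable_completion measurable_restrict_space1)

lemma test_functions_measurable: "\<theta> \<in> test_functions \<Omega> \<Longrightarrow> \<theta> \<in> borel_measurable (lebesgue_on S)"
  by (rule continuous_imp_measurable_lebesgue_on[OF test_functions_continuous])

lemma test_functions_L2:
  assumes "\<theta> \<in> test_functions \<Omega>" "S \<in> lmeasurable"
  shows "\<theta> \<in> L2 S"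
  using test_functions_bounded[OF assms(1)] L2_bounded[OF assms(2) test_functions_measurable[OF assms(1)]]
  by metis

lemma test_functions_eq_0: "\<theta> \<in> test_functions \<Omega> \<Longrightarrow> x \<notin> \<Omega> \<Longrightarrow> \<theta> x = 0"
  by (auto elim!: test_functionsE)

section \<open>Bump functions and the fundamental lemma of the calculus of variations\<close>

text \<open>For \<open>t > 0\<close> the factor \<open>exp (- 1 / (n * t))\<close> tends to 1 as
  \<open>n\<close> grows. So the bumps approach the indicator of the open box while they stay
  between 0 and 1 and vanish outside the box.\<close>

definition box_bump :: "nat \<Rightarrow> real^'n \<Rightarrow> real^'n \<Rightarrow> real^'n \<Rightarrow> real" where
  "box_bump n a b x = (\<Prod>i\<in>UNIV. poly_exp_inverse 1 (real n * (x $ i - a $ i)) * poly_exp_inverse 1 (real n * (b $ i - x $ i)))"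

lemma poly_exp_inverse_1_bounds: "0 \<le> poly_exp_inverse 1 t" "poly_exp_inverse 1 t \<le> 1"
  by (auto simp: poly_exp_inverse_def)

lemma box_bump_bounds: "0 \<le> box_bump n a b x" "box_bump n a b x \<le> 1"
  unfolding box_bump_def
  by (intro prod_nonneg prod_le_1 ballI conjI mult_nonneg_nonneg mult_le_one poly_exp_inverse_1_bounds)+

lemma box_bump_eq_0: "x \<notin> box a b \<Longrightarrow> box_bump n a b x = 0"
proof -
  assume "x \<notin> box a b"
  then obtain i where "x $ i \<le> a $ i \<or> b $ i \<le> x $ i"
    by (auto simp: mem_box_cart not_less)
  then have "poly_exp_inverse 1 (real n * (x $ i - a $ i)) * poly_exp_inverse 1 (real n * (b $ i - x $ i)) = 0"
    by (auto simp: poly_exp_inverse_def zero_less_mult_iff)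
  then show ?thesis unfolding box_bump_def by (intro prod_zero) auto
qed

lemma box_bump_tendsto: "(\<lambda>n. box_bump n a b x) \<longlonglongrightarrow> indicator (box a b) x"
proof (cases "x \<in> box a b")
  case True
  have *: "(\<lambda>n. poly_exp_inverse 1 (real n * t)) \<longlonglongrightarrow> 1" if "0 < t" for t
  proof -
    have "(\<lambda>n. exp (- (1 / t) * (1 / real n))) \<longlonglongrightarrow> exp (- (1 / t) * 0)"
      by (intro tendsto_intros lim_1_over_n)
    then have "(\<lambda>n. exp (- (1 / t) * (1 / real n))) \<longlonglongrightarrow> 1" by simp
    moreover have "\<forall>\<^sub>F n in sequentially. exp (- (1 / t) * (1 / real n)) = poly_exp_inverse 1 (real n * t)"
      using eventually_gt_at_top[of 0]
      by eventually_elim (use that in \<open>simp add: poly_exp_inverse_def field_simps\<close>)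
    ultimately show ?thesis by (rule Lim_transform_eventually)
  qed
  have "(\<lambda>n. box_bump n a b x) \<longlonglongrightarrow> (\<Prod>i\<in>(UNIV::'a set). 1 * 1)"
    unfolding box_bump_def
    by (intro tendsto_prod tendsto_mult *) (use True in \<open>auto simp: mem_box_cart\<close>)
  with True show ?thesis by simp
qed (simp add: box_bump_eq_0)

lemma box_bump_test_function:
  assumes "cbox a b \<subseteq> \<Omega>"
  shows "(\<lambda>x. complex_of_real (box_bump n a b x)) \<in> test_functions \<Omega>"
proof (rule test_functionsI[of _ "cbox a b"])
  fix k
  have "Ck k (\<lambda>x. \<Prod>i\<in>UNIV. complex_of_real (poly_exp_inverse 1 (real n * x $ i + - real n * a $ i))
      * complex_of_real (poly_exp_inverse 1 (- real n * x $ i + real n * b $ i)))"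
    by (intro Ck_prod Ck_mult Ck_poly_exp_inverse)
  then show "Ck k (\<lambda>x. complex_of_real (box_bump n a b x))"
    by (simp add: box_bump_def algebra_simps)
  show "complex_of_real (box_bump n a b x) = 0" if "x \<notin> cbox a b" for x
    using box_bump_eq_0[of x a b n] box_subset_cbox[of a b] that by auto
qed (use assms in auto)

text \<open>Dominated convergence along \<open>box_bump\<close> shows that \<open>f\<close> has
  integral zero over every closed box in the domain. By Lebesgue differentiation, \<open>f\<close>
  is almost everywhere the limit of its averages over shrinking cubes, all of which vanish.\<close>

lemma fundamental_lemma_calculus_of_variations:
  fixes f :: "real^'n \<Rightarrow> complex"
  assumes \<Omega>: "open \<Omega>" and f: "integrable (lebesgue_on \<Omega>) f"
    and zero: "\<And>\<theta>. \<theta> \<in> test_functions \<Omega> \<Longrightarrow> (\<integral>x. f x * \<theta> x \<partial>lebesgue_on \<Omega>) = 0"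
  shows "AE x in lebesgue_on \<Omega>. f x = 0"
proof -
  have \<Omega>_sets: "\<Omega> \<in> sets lebesgue" using \<Omega> by simp
  define F where "F x = (if x \<in> \<Omega> then f x else 0)" for x
  have F: "integrable lebesgue F"
    unfolding F_def using f \<Omega>_sets by (simp add: Lebesgue_Measure.integrable_restrict_UNIV)
  have Fm[measurable]: "F \<in> borel_measurable lebesgue" using F by simp
  have F_on: "F absolutely_integrable_on S" if "S \<in> sets lebesgue" for S
    unfolding set_integrable_def using F that by (intro integrable_mult_indicator)
  have box0: "integral (cbox a b) F = 0" if ab: "cbox a b \<subseteq> \<Omega>" for a b
  proof -
    have "(\<lambda>n. \<integral>x. F x * of_real (box_bump n a b x) \<partial>lebesgue) \<longlonglongrightarrow> (\<integral>x. F x * of_real (indicator (box a b) x) \<partial>lebesgue)"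
    proof (rule integral_dominated_convergence)
      show "integrable lebesgue (\<lambda>x. norm (F x))" using F by simp
      have bm: "(\<lambda>x. complex_of_real (box_bump n a b x)) \<in> borel_measurable lebesgue" for n
        using test_functions_measurable[OF box_bump_test_function[OF ab, of n], of UNIV] by (simp add: lebesgue_on_UNIV_eq)
      show "(\<lambda>x. F x * of_real (box_bump n a b x)) \<in> borel_measurable lebesgue" for n
        by (intro borel_measurable_times Fm bm)
      show "(\<lambda>x. F x * of_real (indicator (box a b) x)) \<in> borel_measurable lebesgue"
      proof -
        have "(\<lambda>x. F x * of_real (indicator (box a b) x)) = (\<lambda>x. F x * indicator (box a b) x)"
          by (auto simp: indicator_def)
        moreover have "(\<lambda>x. F x * indicator (box a b) x) \<in> borel_measurable lebesgue"
          by (intro borel_measurable_times Fm borel_measurable_indicator) simp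
        ultimately show ?thesis by simp
      qed
      show "AE x in lebesgue. (\<lambda>n. F x * of_real (box_bump n a b x)) \<longlonglongrightarrow> F x * of_real (indicator (box a b) x)"
        by (intro AE_I2 tendsto_intros box_bump_tendsto)
      show "AE x in lebesgue. norm (F x * of_real (box_bump n a b x)) \<le> norm (F x)" for n
        by (intro AE_I2) (simp add: norm_mult box_bump_bounds mult_left_le)
    qed
    moreover have "(\<integral>x. F x * of_real (box_bump n a b x) \<partial>lebesgue) = 0" for n
    proof -
      have "(\<lambda>x. F x * of_real (box_bump n a b x)) = (\<lambda>x. if x \<in> \<Omega> then f x * of_real (box_bump n a b x) else 0)"
        by (auto simp: F_def)
      then show ?thesis
        using zero[OF box_bump_test_function[OF ab, of n]] \<Omega>_sets by (simp add: Lebesgue_Measure.integral_restrict_UNIV)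
    qed
    ultimately have "(\<integral>x. F x * of_real (indicator (box a b) x) \<partial>lebesgue) = 0"
      using LIMSEQ_unique[OF _ tendsto_const] by fastforce
    moreover have "(\<integral>x. F x * of_real (indicator (box a b) x) \<partial>lebesgue) = integral (box a b) F"
      unfolding set_lebesgue_integral_eq_integral(2)[OF F_on[of "box a b"], symmetric, simplified]
      unfolding set_lebesgue_integral_def by (intro Bochner_Integration.integral_cong) (auto simp: indicator_def)
    ultimately show ?thesis by (simp add: integral_open_interval)
  qed
  have "F integrable_on cbox a b" for a b
    using F_on[of "cbox a b"] by (simp add: set_lebesgue_integral_eq_integral)
  from integrable_ccontinuous_explicit[OF this] obtain N where
    N: "negligible N" "\<And>x e. \<lbrakk>x \<notin> N; 0 < e\<rbrakk> \<Longrightarrow> \<exists>d>0. \<forall>h. 0 < h \<and> h < d \<longrightarrow>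
       norm (integral (cbox x (x + h *\<^sub>R One)) F /\<^sub>R h ^ DIM(real^'n) - F x) < e"
    by metis
  have "f x = 0" if x: "x \<in> \<Omega>" "x \<notin> N" for x
  proof (rule ccontr)
    assume "f x \<noteq> 0"
    with N(2)[OF x(2), of "norm (f x)"] obtain d where d: "d > 0" "\<And>h. 0 < h \<Longrightarrow> h < d \<Longrightarrow>
       norm (integral (cbox x (x + h *\<^sub>R One)) F /\<^sub>R h ^ DIM(real^'n) - F x) < norm (f x)" by auto
    obtain e where e: "0 < e" "ball x e \<subseteq> \<Omega>" using \<Omega> x(1) open_contains_ball by blast
    let ?O = "One :: real^'n"
    \<comment> \<open>Small enough for the differentiation estimate and for the cube of side
      \<open>h\<close> at \<open>x\<close> to lie in \<open>ball x e\<close>.\<close>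
    define h where "h = min (d / 2) (e / 2 / (norm ?O + 1))"
    have O: "0 < norm ?O + 1" by (simp add: add_nonneg_pos)
    have h: "0 < h" "h < d" using d(1) e(1) O by (auto simp: h_def)
    have "h * norm ?O < e"
    proof -
      have "h * norm ?O \<le> h * (norm ?O + 1)" using h(1) by simp
      also have "\<dots> \<le> e / 2 / (norm ?O + 1) * (norm ?O + 1)"
        using O by (intro mult_right_mono) (auto simp: h_def)
      also have "\<dots> = e / 2"
        using O by (intro iffD1[OF nonzero_eq_divide_eq]) auto
      finally have "h * norm ?O \<le> e / 2" .
      with e(1) show ?thesis by linarith
    qed
    have "cbox x (x + h *\<^sub>R One) \<subseteq> \<Omega>"
    proof
      fix y assume y: "y \<in> cbox x (x + h *\<^sub>R One)"
      have "norm (y - x) \<le> norm (h *\<^sub>R ?O)"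
      proof (rule norm_le_componentwise)
        fix b :: "real^'n" assume b: "b \<in> Basis"
        then have "x \<bullet> b \<le> y \<bullet> b" "y \<bullet> b \<le> x \<bullet> b + h"
          using y unfolding mem_box by (auto simp: inner_add_left)
        then show "\<bar>(y - x) \<bullet> b\<bar> \<le> \<bar>(h *\<^sub>R ?O) \<bullet> b\<bar>"
          using b h by (simp add: inner_diff_left)
      qed
      with \<open>h * norm ?O < e\<close> h have "dist x y < e" by (simp add: dist_norm norm_minus_commute)
      with e show "y \<in> \<Omega>" by auto
    qed
    \<comment> \<open>With a vanishing average the estimate reads
      \<open>norm (f x) < norm (f x)\<close>.\<close>
    from box0[OF this] d(2)[OF h] show False using x by (simp add: F_def)
  qed
  then have "AE x in lebesgue. x \<in> \<Omega> \<longrightarrow> f x = 0"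
    using N(1) by (intro AE_I'[of N]) (auto simp: negligible_iff_null_sets)
  then show ?thesis using \<Omega>_sets by (simp add: AE_restrict_space_iff)
qed

section \<open>Directional derivatives and translates of test functions\<close>

lemma test_functions_sum:
  "(\<And>i. i \<in> I \<Longrightarrow> f i \<in> test_functions \<Omega>) \<Longrightarrow> (\<lambda>x. \<Sum>i\<in>I. f i x) \<in> test_functions \<Omega>"
  by (induction I rule: infinite_finite_induct) (simp_all add: test_functions_zero test_functions_add)

definition dir_derivative :: "real^'n \<Rightarrow> (real^'n \<Rightarrow> complex) \<Rightarrow> real^'n \<Rightarrow> complex" where
  "dir_derivative h \<theta> x = (\<Sum>i\<in>UNIV. of_real (h $ i) * pderivative i \<theta> x)"

lemma test_functions_dir_derivative:
  "\<theta> \<in> test_functions \<Omega> \<Longrightarrow> dir_derivative h \<theta> \<in> test_functions \<Omega>"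
  unfolding dir_derivative_def[abs_def]
  by (intro test_functions_sum test_functions_cmult test_functions_pderivative)

lemma dir_derivative_eq:
  assumes "(\<theta> has_derivative D) (at x)"
  shows "D h = dir_derivative h \<theta> x"
proof -
  interpret D: linear D using assms by (rule has_derivative_linear)
  have "D h = D (\<Sum>i\<in>UNIV. h $ i *\<^sub>R axis i 1)"
    using basis_expansion[of h] by (simp add: scalar_mult_eq_scaleR)
  also have "\<dots> = (\<Sum>i\<in>UNIV. of_real (h $ i) * D (axis i 1))"
    unfolding D.sum D.scaleR by (simp add: scaleR_conv_of_real)
  finally show ?thesis
    by (simp add: dir_derivative_def pderivative_eq[OF assms])
qed

lemma test_function_line_derivative:
  assumes "\<theta> \<in> test_functions \<Omega>"
  shows "((\<lambda>t. \<theta> (x - t *\<^sub>R h)) has_derivative (\<lambda>s. s *\<^sub>R - dir_derivative h \<theta> (x - t *\<^sub>R h))) (at t within S)"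
proof -
  obtain D where D: "(\<theta> has_derivative D) (at (x - t *\<^sub>R h))"
    using test_functions_differentiable[OF assms] unfolding differentiable_def by blast
  interpret D: linear D using D by (rule has_derivative_linear)
  have "((\<lambda>t. x - t *\<^sub>R h) has_derivative (\<lambda>s. - (s *\<^sub>R h))) (at t within S)"
    by (auto intro!: derivative_eq_intros)
  from has_derivative_compose[OF this D] show ?thesis
    unfolding D.neg D.scaleR dir_derivative_eq[OF D, of h] by simp
qed

text \<open>Differentiation under the integral sign by dominated convergence. All differentiation
  falls on the test function, so integrability of \<open>f\<close> is enough; this later replaces
  mollification.\<close>

lemma integral_shift_has_vector_derivative:
  fixes f :: "real^'n \<Rightarrow> complex"
  assumes f: "integrable lebesgue f" and \<theta>: "\<theta> \<in> test_functions \<Omega>"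
  shows "((\<lambda>t. \<integral>x. f x * \<theta> (x - t *\<^sub>R h) \<partial>lebesgue) has_vector_derivative
           - (\<integral>x. f x * dir_derivative h \<theta> (x - t *\<^sub>R h) \<partial>lebesgue)) (at t)"
proof -
  let ?D = "dir_derivative h \<theta>"
  have int: "integrable lebesgue (\<lambda>x. f x * \<eta> (x - a))" if \<eta>: "\<eta> \<in> test_functions \<Omega>" for \<eta> a
  proof -
    obtain B where B: "0 \<le> B" "\<And>x. norm (\<eta> x) \<le> B" using test_functions_bounded[OF \<eta>] by blast
    show ?thesis
    proof (rule Bochner_Integration.integrable_bound)
      show "integrable lebesgue (\<lambda>x. B * norm (f x))" using f by simp
      have "continuous_on UNIV (\<lambda>x. \<eta> (x - a))"
        by (rule continuous_on_compose2[OF test_functions_continuous[OF \<eta>]]) (auto intro!: continuous_intros)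
      from continuous_imp_measurable_lebesgue_on[OF this, of UNIV]
      show "(\<lambda>x. f x * \<eta> (x - a)) \<in> borel_measurable lebesgue"
        using f by (intro borel_measurable_times) (simp_all add: lebesgue_on_UNIV_eq)
      show "AE x in lebesgue. norm (f x * \<eta> (x - a)) \<le> norm (B * norm (f x))"
        using B mult_left_mono[OF B(2), of "norm (f _)"]
        by (intro AE_I2) (simp add: norm_mult mult.commute[of B])
    qed
  qed
  obtain B where B: "0 \<le> B" "\<And>x. norm (?D x) \<le> B"
    using test_functions_bounded[OF test_functions_dir_derivative[OF \<theta>]] by blast
  have Lip: "norm (\<theta> (x - s *\<^sub>R h) - \<theta> (x - t *\<^sub>R h)) \<le> B * \<bar>s - t\<bar>" for x s
  proof -
    have "norm (\<theta> (x - s *\<^sub>R h) - \<theta> (x - t *\<^sub>R h)) \<le> B * norm (s - t)"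
    proof (rule differentiable_bound[where S = UNIV and f' = "\<lambda>u s. s *\<^sub>R - ?D (x - u *\<^sub>R h)"])
      show "onorm (\<lambda>s. s *\<^sub>R - ?D (x - u *\<^sub>R h)) \<le> B" for u
        by (rule onorm_le) (use B(2)[of "x - u *\<^sub>R h"] in \<open>simp add: mult.commute[of B] mult_left_mono\<close>)
      show "((\<lambda>u. \<theta> (x - u *\<^sub>R h)) has_derivative (\<lambda>s. s *\<^sub>R - ?D (x - u *\<^sub>R h))) (at u within UNIV)" for u
        by (rule test_function_line_derivative[OF \<theta>])
    qed simp_all
    then show ?thesis by simp
  qed
  define \<Phi> where "\<Phi> s = (\<integral>x. f x * \<theta> (x - s *\<^sub>R h) \<partial>lebesgue)" for s
  define d where "d = - (\<integral>x. f x * ?D (x - t *\<^sub>R h) \<partial>lebesgue)"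
  have "((\<lambda>s. norm (\<Phi> s - \<Phi> t - (s - t) *\<^sub>R d) / norm (s - t)) \<longlongrightarrow> 0) (at t)"
    unfolding tendsto_at_iff_sequentially
  proof (intro allI impI)
    fix X assume X: "\<forall>i. X i \<in> UNIV - {t}" "X \<longlonglongrightarrow> t"
    \<comment> \<open>The error of the difference quotient. The sign is plus because
      \<open>\<theta> (x - t *\<^sub>R h)\<close> has the derivative
      \<open>- ?D (x - t *\<^sub>R h)\<close> in \<open>t\<close>.\<close>
    let ?q = "\<lambda>n x. f x * (inverse (X n - t) *\<^sub>R (\<theta> (x - X n *\<^sub>R h) - \<theta> (x - t *\<^sub>R h)) + ?D (x - t *\<^sub>R h))"
    have qint: "integrable lebesgue (?q n)" for n
    proof -
      have "?q n = (\<lambda>x. inverse (X n - t) *\<^sub>R (f x * \<theta> (x - X n *\<^sub>R h) - f x * \<theta> (x - t *\<^sub>R h)) + f x * ?D (x - t *\<^sub>R h))"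
        by (auto simp: algebra_simps)
      then show ?thesis
        using int[OF \<theta>] int[OF test_functions_dir_derivative[OF \<theta>]] by simp
    qed
    have "(\<lambda>n. \<integral>x. ?q n x \<partial>lebesgue) \<longlonglongrightarrow> integral\<^sup>L lebesgue (\<lambda>x::real^'n. 0)"
    proof (rule integral_dominated_convergence)
      show "integrable lebesgue (\<lambda>x. 2 * B * norm (f x))" using f by simp
      show "?q n \<in> borel_measurable lebesgue" for n
        using qint by (rule borel_measurable_integrable)
      show "AE x in lebesgue. (\<lambda>n. ?q n x) \<longlonglongrightarrow> 0"
      proof (rule AE_I2)
        fix x
        have "((\<lambda>s. norm (\<theta> (x - s *\<^sub>R h) - \<theta> (x - t *\<^sub>R h) - (s - t) *\<^sub>R - ?D (x - t *\<^sub>R h)) / norm (s - t)) \<longlongrightarrow> 0) (at t)"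
          using test_function_line_derivative[OF \<theta>, of x h t UNIV] unfolding has_derivative_iff_norm by blast
        then have "(\<lambda>n. norm (\<theta> (x - X n *\<^sub>R h) - \<theta> (x - t *\<^sub>R h) - (X n - t) *\<^sub>R - ?D (x - t *\<^sub>R h)) / norm (X n - t)) \<longlonglongrightarrow> 0"
          using X unfolding tendsto_at_iff_sequentially comp_def by blast
        moreover have "norm (\<theta> (x - X n *\<^sub>R h) - \<theta> (x - t *\<^sub>R h) - (X n - t) *\<^sub>R - ?D (x - t *\<^sub>R h)) / norm (X n - t)
            = norm (inverse (X n - t) *\<^sub>R (\<theta> (x - X n *\<^sub>R h) - \<theta> (x - t *\<^sub>R h)) + ?D (x - t *\<^sub>R h))" (is "_ = norm ?r") for n
        proof -
          have "X n \<noteq> t" using X by auto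
          then have "\<theta> (x - X n *\<^sub>R h) - \<theta> (x - t *\<^sub>R h) - (X n - t) *\<^sub>R - ?D (x - t *\<^sub>R h) = (X n - t) *\<^sub>R ?r"
            by (simp add: scaleR_right_distrib)
          then show ?thesis using \<open>X n \<noteq> t\<close> by simp
        qed
        ultimately have "(\<lambda>n. inverse (X n - t) *\<^sub>R (\<theta> (x - X n *\<^sub>R h) - \<theta> (x - t *\<^sub>R h)) + ?D (x - t *\<^sub>R h)) \<longlonglongrightarrow> 0"
          by (simp add: tendsto_norm_zero_iff)
        from tendsto_mult_right_zero[OF this] show "(\<lambda>n. ?q n x) \<longlonglongrightarrow> 0" .
      qed
      \<comment> \<open>One \<open>B\<close> bounds the difference quotient by the Lipschitz
        estimate, the other one the derivative.\<close>
      show "AE x in lebesgue. norm (?q n x) \<le> 2 * B * norm (f x)" for n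
      proof (rule AE_I2)
        fix x
        have "X n \<noteq> t" using X by auto
        then have "norm (inverse (X n - t) *\<^sub>R (\<theta> (x - X n *\<^sub>R h) - \<theta> (x - t *\<^sub>R h))) \<le> B"
          using Lip[of x "X n"] by (simp add: divide_simps mult.commute)
        then have "norm (inverse (X n - t) *\<^sub>R (\<theta> (x - X n *\<^sub>R h) - \<theta> (x - t *\<^sub>R h)) + ?D (x - t *\<^sub>R h)) \<le> 2 * B"
          using B(2)[of "x - t *\<^sub>R h"] by (intro norm_triangle_le) simp
        then show "norm (?q n x) \<le> 2 * B * norm (f x)"
          using mult_left_mono[of _ "2 * B" "norm (f x)"] by (simp add: norm_mult mult.commute[of "2 * B"])
      qed
    qed simp
    moreover have "norm (\<integral>x. ?q n x \<partial>lebesgue) = norm (\<Phi> (X n) - \<Phi> t - (X n - t) *\<^sub>R d) / norm (X n - t)" for n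
    proof -
      have nz: "X n \<noteq> t" using X by auto
      have "?q n = (\<lambda>x. inverse (X n - t) *\<^sub>R (f x * \<theta> (x - X n *\<^sub>R h) - f x * \<theta> (x - t *\<^sub>R h)) + f x * ?D (x - t *\<^sub>R h))"
        by (auto simp: algebra_simps)
      then have "(\<integral>x. ?q n x \<partial>lebesgue) = inverse (X n - t) *\<^sub>R (\<Phi> (X n) - \<Phi> t) - d"
        using int[OF \<theta>] int[OF test_functions_dir_derivative[OF \<theta>]] by (simp add: \<Phi>_def d_def)
      also have "\<dots> = inverse (X n - t) *\<^sub>R (\<Phi> (X n) - \<Phi> t - (X n - t) *\<^sub>R d)"
        using nz by (simp add: scaleR_diff_right)
      finally show ?thesis by (simp add: divide_inverse mult.commute)
    qed
    ultimately have "(\<lambda>n. norm (\<Phi> (X n) - \<Phi> t - (X n - t) *\<^sub>R d) / norm (X n - t)) \<longlonglongrightarrow> 0"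
      using tendsto_norm_zero by fastforce
    then show "((\<lambda>s. norm (\<Phi> s - \<Phi> t - (s - t) *\<^sub>R d) / norm (s - t)) \<circ> X) \<longlonglongrightarrow> 0"
      by (simp add: comp_def)
  qed
  then have "(\<Phi> has_vector_derivative d) (at t)"
    unfolding has_vector_derivative_def has_derivative_iff_norm
    by (simp add: bounded_linear_scaleR_left)
  then show ?thesis by (simp add: \<Phi>_def[abs_def] d_def)
qed

lemma integral_lebesgue_shift:
  fixes g :: "real^'n \<Rightarrow> 'b::euclidean_space"
  assumes [measurable]: "g \<in> borel_measurable borel"
  shows "(\<integral>x. g (x - a) \<partial>lebesgue) = (\<integral>x. g x \<partial>lebesgue)"
proof -
  have "(\<integral>x. g x \<partial>lborel) = (\<integral>x. g x \<partial>distr lborel borel ((+) (- a)))"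
    by (simp add: lborel_distr_plus)
  also have "\<dots> = (\<integral>x. g (x - a) \<partial>lborel)"
    by (subst integral_distr) auto
  finally show ?thesis by (simp add: integral_completion)
qed

text \<open>By translation invariance the integral of
  \<open>\<theta> (x - t *\<^sub>R axis i 1)\<close> does not depend on \<open>t\<close>, so its
  derivative at \<open>t = 0\<close> vanishes.\<close>

lemma integral_pderivative_test_function:
  fixes \<theta> :: "real^'n \<Rightarrow> complex"
  assumes \<theta>: "\<theta> \<in> test_functions \<Omega>"
  shows "(\<integral>x. pderivative i \<theta> x \<partial>lebesgue) = 0"
proof -
  obtain K where K: "compact K" "\<And>x. x \<notin> K \<Longrightarrow> \<theta> x = 0" "\<And>x. x \<notin> K \<Longrightarrow> pderivative i \<theta> x = 0"
  proof -
    let ?K = "closure {x. \<theta> x \<noteq> 0} \<union> closure {x. pderivative i \<theta> x \<noteq> 0}"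
    have "compact ?K"
      using \<theta> test_functions_pderivative[OF \<theta>, of i] unfolding test_functions_def by (auto intro: compact_Un)
    then show thesis
    proof (rule that)
      show "\<theta> x = 0" if "x \<notin> ?K" for x
        using that closure_subset[of "{x. \<theta> x \<noteq> 0}"] by blast
      show "pderivative i \<theta> x = 0" if "x \<notin> ?K" for x
        using that closure_subset[of "{x. pderivative i \<theta> x \<noteq> 0}"] by blast
    qed
  qed
  from compact_imp_bounded[OF K(1)] obtain R where R: "\<And>x. x \<in> K \<Longrightarrow> norm x \<le> R"
    unfolding bounded_iff by blast
  \<comment> \<open>An integrable factor that equals 1 on all translates of \<open>K\<close> by less
    than 1, so it can be inserted without changing the integrals.\<close>
  define b where "b x = indicator (ball 0 (R + 1)) x *\<^sub>R (1::complex)" for x :: "real^'n"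
  have "integrable lebesgue b"
    unfolding b_def[abs_def]
    by (rule integrable.intros, rule has_bochner_integral_indicator) (use emeasure_bounded_finite[OF bounded_ball] in auto)
  let ?e = "axis i 1 :: real^'n"
  from integral_shift_has_vector_derivative[OF \<open>integrable lebesgue b\<close> \<theta>, of ?e 0]
  have "((\<lambda>t. \<integral>x. b x * \<theta> (x - t *\<^sub>R ?e) \<partial>lebesgue) has_vector_derivative - (\<integral>x. b x * dir_derivative ?e \<theta> x \<partial>lebesgue)) (at 0)"
    by simp
  moreover have "((\<lambda>t. \<integral>x. b x * \<theta> (x - t *\<^sub>R ?e) \<partial>lebesgue) has_vector_derivative 0) (at 0)"
  proof (rule has_vector_derivative_transform_within_open[OF has_vector_derivative_const])
    show "open {-1<..<1::real}" "0 \<in> {-1<..<1::real}" by auto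
    fix t :: real assume t: "t \<in> {-1<..<1}"
    have "b x * \<theta> (x - t *\<^sub>R ?e) = \<theta> (x - t *\<^sub>R ?e)" for x
    proof (cases "x - t *\<^sub>R ?e \<in> K")
      case True
      have "norm x \<le> norm (x - t *\<^sub>R ?e) + norm (t *\<^sub>R ?e)"
        using norm_triangle_ineq[of "x - t *\<^sub>R ?e" "t *\<^sub>R ?e"] by simp
      also have "\<dots> < R + 1" using R[OF True] t abs_less_iff[of t 1] by simp
      finally show ?thesis by (simp add: b_def)
    qed (simp add: K)
    then have "(\<integral>x. b x * \<theta> (x - t *\<^sub>R ?e) \<partial>lebesgue) = (\<integral>x. \<theta> (x - t *\<^sub>R ?e) \<partial>lebesgue)"
      by (simp only:)
    then show "(\<integral>x. \<theta> x \<partial>lebesgue) = (\<integral>x. b x * \<theta> (x - t *\<^sub>R ?e) \<partial>lebesgue)"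
      using integral_lebesgue_shift[of \<theta> "t *\<^sub>R ?e"] test_functions_continuous[OF \<theta>]
      by (simp add: borel_measurable_continuous_onI)
  qed
  ultimately have "(\<integral>x. b x * dir_derivative ?e \<theta> x \<partial>lebesgue) = 0"
    using vector_derivative_unique_at by fastforce
  moreover have "b x * dir_derivative ?e \<theta> x = pderivative i \<theta> x" for x
  proof -
    have "dir_derivative ?e \<theta> x = pderivative i \<theta> x"
      unfolding dir_derivative_def by (subst sum.remove[of _ i]) (auto simp: axis_def)
    then show ?thesis using K(3)[of x] R[of x] by (cases "x \<in> K") (auto simp: b_def)
  qed
  ultimately show ?thesis by simp
qed

section \<open>The scalar pairing\<close>

lemma integral_lebesgue_on_subset:
  fixes g :: "real^'n \<Rightarrow> 'b::euclidean_space"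
  assumes "U \<subseteq> \<Omega>" "U \<in> sets lebesgue" "\<Omega> \<in> sets lebesgue" "\<And>x. x \<notin> U \<Longrightarrow> g x = 0"
  shows "integral\<^sup>L (lebesgue_on \<Omega>) g = integral\<^sup>L (lebesgue_on U) g"
proof -
  have "g = (\<lambda>x. if x \<in> U then g x else 0)" using assms(4) by auto
  then have "integral\<^sup>L (lebesgue_on \<Omega>) g = integral\<^sup>L (lebesgue_on \<Omega>) (\<lambda>x. if x \<in> U then g x else 0)" by simp
  also have "\<dots> = integral\<^sup>L (lebesgue_on U) g"
    using assms by (intro Lebesgue_Measure.integral_restrict) auto
  finally show ?thesis .
qed

lemma spair_test_subset:
  assumes "\<theta> \<in> test_functions U" "U \<subseteq> \<Omega>" "open U" "open \<Omega>"
  shows "spair \<Omega> f \<theta> = spair U f \<theta>"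
  unfolding spair_def
  by (rule integral_lebesgue_on_subset) (use assms test_functions_eq_0 in auto)

lemma spair_commute: "spair \<Omega> f g = spair \<Omega> g f"
  by (simp add: spair_def mult.commute)

lemma spair_add_left:
  "f \<in> L2 \<Omega> \<Longrightarrow> g \<in> L2 \<Omega> \<Longrightarrow> h \<in> L2 \<Omega> \<Longrightarrow> spair \<Omega> (\<lambda>x. f x + g x) h = spair \<Omega> f h + spair \<Omega> g h"
  by (simp add: spair_def distrib_right L2_integrable_mult)

lemma spair_diff_left:
  "f \<in> L2 \<Omega> \<Longrightarrow> g \<in> L2 \<Omega> \<Longrightarrow> h \<in> L2 \<Omega> \<Longrightarrow> spair \<Omega> (\<lambda>x. f x - g x) h = spair \<Omega> f h - spair \<Omega> g h"
  by (simp add: spair_def left_diff_distrib L2_integrable_mult)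

lemma spair_cmult_left: "spair \<Omega> (\<lambda>x. c * f x) h = c * spair \<Omega> f h"
  by (simp add: spair_def mult.assoc)

lemma spair_cmult_right: "spair \<Omega> f (\<lambda>x. c * h x) = c * spair \<Omega> f h"
  by (subst (1 2) spair_commute) (rule spair_cmult_left)

lemma spair_diff_right:
  "f \<in> L2 \<Omega> \<Longrightarrow> g \<in> L2 \<Omega> \<Longrightarrow> h \<in> L2 \<Omega> \<Longrightarrow> spair \<Omega> h (\<lambda>x. f x - g x) = spair \<Omega> h f - spair \<Omega> h g"
  using spair_diff_left[of f \<Omega> g h] by (simp add: spair_commute)

lemma spair_add_right:
  "f \<in> L2 \<Omega> \<Longrightarrow> g \<in> L2 \<Omega> \<Longrightarrow> h \<in> L2 \<Omega> \<Longrightarrow> spair \<Omega> h (\<lambda>x. f x + g x) = spair \<Omega> h f + spair \<Omega> h g"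
  using spair_add_left[of f \<Omega> g h] by (simp add: spair_commute)

lemma spair_cong_AE:
  assumes "f \<in> L2 \<Omega>" "g \<in> L2 \<Omega>" "AE x in lebesgue_on \<Omega>. f x = g x" "h \<in> L2 \<Omega>"
  shows "spair \<Omega> f h = spair \<Omega> g h"
  unfolding spair_def
proof (rule integral_cong_AE)
  show "AE x in lebesgue_on \<Omega>. f x * h x = g x * h x"
    using assms(3) by eventually_elim simp
qed (intro borel_measurable_integrable L2_integrable_mult assms)+

lemma spair_bound:
  fixes f g :: "real^'n \<Rightarrow> complex"
  assumes f: "f \<in> L2 \<Omega>" and g: "g \<in> L2 \<Omega>"
  shows "norm (spair \<Omega> f g) \<le> L2_norm \<Omega> f * L2_norm \<Omega> g"
proof -
  have nL2: "(\<lambda>x. norm (h x)) \<in> L2 \<Omega>" if "h \<in> L2 \<Omega>" for h :: "real^'n \<Rightarrow> complex"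
    using that measurable_compose[OF L2_measurable[OF that] borel_measurable_norm] by (simp add: L2_def)
  have "norm (spair \<Omega> f g) \<le> (\<integral>x. norm (f x * g x) \<partial>lebesgue_on \<Omega>)"
    unfolding spair_def by (rule integral_norm_bound)
  also have "\<dots> = L2_inner \<Omega> (\<lambda>x. norm (f x)) (\<lambda>x. norm (g x))"
    by (simp add: L2_inner_def norm_mult)
  also have "\<dots> \<le> L2_norm \<Omega> (\<lambda>x. norm (f x)) * L2_norm \<Omega> (\<lambda>x. norm (g x))"
    using L2_Cauchy_Schwarz[OF nL2[OF f] nL2[OF g]] by simp
  also have "\<dots> = L2_norm \<Omega> f * L2_norm \<Omega> g"
    by (simp add: L2_norm_def)
  finally show ?thesis .
qed

text \<open>The bridge from the bilinear pairing to the real Hilbert space, at the price of one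
  conjugation.\<close>

lemma Re_spair:
  assumes "f \<in> L2 \<Omega>" "g \<in> L2 \<Omega>"
  shows "Re (spair \<Omega> f g) = L2_inner \<Omega> f (\<lambda>x. cnj (g x))"
  using integral_Re[OF L2_integrable_mult[OF assms]] by (simp add: spair_def L2_inner_def inner_complex_def)

section \<open>Weak derivatives\<close>

lemma L2_norm_mono:
  fixes f :: "real^'n \<Rightarrow> 'b::euclidean_space" and g :: "real^'n \<Rightarrow> 'c::euclidean_space"
  assumes f: "f \<in> L2 \<Omega>" and g: "g \<in> L2 \<Omega>" and le: "\<And>x. norm (f x) \<le> norm (g x)"
  shows "L2_norm \<Omega> f \<le> L2_norm \<Omega> g"
  unfolding L2_norm_def
  by (intro real_sqrt_le_mono integral_mono L2_integrable_norm2 f g power_mono le norm_ge_zero)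

lemma sqrt_L2_inner_self: "sqrt (L2_inner \<Omega> f f) = L2_norm \<Omega> f"
  by (simp add: L2_norm_power2[symmetric])

lemma L2_component: "G \<in> L2 \<Omega> \<Longrightarrow> (\<lambda>x. G x $ i) \<in> L2 \<Omega>" for G :: "real^'n \<Rightarrow> complex^'m"
  by (simp add: L2_vec_iff)

lemma L2_norm_component_le:
  "G \<in> L2 \<Omega> \<Longrightarrow> L2_norm \<Omega> (\<lambda>x. G x $ i) \<le> L2_norm \<Omega> G" for G :: "real^'n \<Rightarrow> complex^'m"
  by (intro L2_norm_mono L2_component Finite_Cartesian_Product.norm_nth_le)

lemma L2_vcmult: "G \<in> L2 \<Omega> \<Longrightarrow> (\<lambda>x. c *s G x) \<in> L2 \<Omega>" for G :: "real^'n \<Rightarrow> complex^'m"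
  by (simp add: L2_vec_iff L2_cmult)

lemma L2_vcnj: "G \<in> L2 \<Omega> \<Longrightarrow> (\<lambda>x. \<chi> i. cnj (G x $ i)) \<in> L2 \<Omega>" for G :: "real^'n \<Rightarrow> complex^'m"
  by (simp add: L2_vec_iff L2_cnj)

lemma AE_vec_eq:
  fixes F G :: "'a \<Rightarrow> 'b^'m"
  assumes "\<And>i. AE x in M. F x $ i = G x $ i"
  shows "AE x in M. F x = G x"
proof -
  have "AE x in M. \<forall>i\<in>UNIV. F x $ i = G x $ i"
    using assms by (intro AE_finite_allI) auto
  then show ?thesis by eventually_elim (simp add: vec_eq_iff)
qed

lemma vpair_eq_sum:
  fixes F G :: "real^'n \<Rightarrow> complex^'n"
  assumes "F \<in> L2 \<Omega>" "G \<in> L2 \<Omega>"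
  shows "vpair \<Omega> F G = (\<Sum>i\<in>UNIV. spair \<Omega> (\<lambda>x. F x $ i) (\<lambda>x. G x $ i))"
  unfolding vpair_def spair_def
  by (intro Bochner_Integration.integral_sum L2_integrable_mult L2_component assms)

lemma vpair_commute: "vpair \<Omega> F G = vpair \<Omega> G F"
  by (simp add: vpair_def mult.commute)

lemma vpair_add_left:
  "F \<in> L2 \<Omega> \<Longrightarrow> G \<in> L2 \<Omega> \<Longrightarrow> H \<in> L2 \<Omega> \<Longrightarrow> vpair \<Omega> (\<lambda>x. F x + G x) H = vpair \<Omega> F H + vpair \<Omega> G H"
  by (simp add: vpair_eq_sum L2_add spair_add_left L2_component sum.distrib)

lemma vpair_add_right:
  "F \<in> L2 \<Omega> \<Longrightarrow> G \<in> L2 \<Omega> \<Longrightarrow> H \<in> L2 \<Omega> \<Longrightarrow> vpair \<Omega> H (\<lambda>x. F x + G x) = vpair \<Omega> H F + vpair \<Omega> H G"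
  by (simp add: vpair_add_left vpair_commute[of _ H])

lemma vpair_cmult_left: "vpair \<Omega> (\<lambda>x. c *s F x) G = c * vpair \<Omega> F G"
  by (simp add: vpair_def mult.assoc sum_distrib_left[symmetric])

lemma vpair_cmult_right: "vpair \<Omega> F (\<lambda>x. c *s G x) = c * vpair \<Omega> F G"
  by (simp add: vpair_commute[of _ F] vpair_cmult_left)

lemma vpair_cong_AE:
  assumes "F \<in> L2 \<Omega>" "G \<in> L2 \<Omega>" "AE x in lebesgue_on \<Omega>. F x = G x" "H \<in> L2 \<Omega>"
  shows "vpair \<Omega> F H = vpair \<Omega> G H"
proof -
  have "AE x in lebesgue_on \<Omega>. F x $ i = G x $ i" for i
    using assms(3) by eventually_elim simp
  then show ?thesis
    unfolding vpair_eq_sum[OF assms(1,4)] vpair_eq_sum[OF assms(2,4)]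
    by (intro sum.cong refl spair_cong_AE L2_component assms)
qed

lemma vpair_cong_AE_right:
  assumes "F \<in> L2 \<Omega>" "G \<in> L2 \<Omega>" "AE x in lebesgue_on \<Omega>. F x = G x" "H \<in> L2 \<Omega>"
  shows "vpair \<Omega> H F = vpair \<Omega> H G"
  using vpair_cong_AE[OF assms] by (simp add: vpair_commute)

lemma Re_vpair:
  fixes F G :: "real^'n \<Rightarrow> complex^'n"
  assumes "F \<in> L2 \<Omega>" "G \<in> L2 \<Omega>"
  shows "Re (vpair \<Omega> F G) = L2_inner \<Omega> (\<lambda>x. \<chi> i. cnj (F x $ i)) G"
proof -
  have "Re (vpair \<Omega> F G) = (\<Sum>i\<in>UNIV. L2_inner \<Omega> (\<lambda>x. F x $ i) (\<lambda>x. cnj (G x $ i)))"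
    using assms by (simp add: vpair_eq_sum Re_spair L2_component)
  also have "\<dots> = (\<integral>x. (\<Sum>i\<in>UNIV. F x $ i \<bullet> cnj (G x $ i)) \<partial>lebesgue_on \<Omega>)"
    unfolding L2_inner_def
    by (intro Bochner_Integration.integral_sum[symmetric] L2_integrable_inner L2_component L2_cnj assms)
  also have "\<dots> = L2_inner \<Omega> (\<lambda>x. \<chi> i. cnj (F x $ i)) G"
    by (simp add: L2_inner_def inner_vec_def inner_complex_def)
  finally show ?thesis .
qed

lemma has_weak_gradD:
  assumes "has_weak_grad \<Omega> f G"
  shows "f \<in> L2 \<Omega>" "G \<in> L2 \<Omega>"
    and "\<theta> \<in> test_functions \<Omega> \<Longrightarrow> spair \<Omega> f (pderivative i \<theta>) = - spair \<Omega> (\<lambda>x. G x $ i) \<theta>"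
  using assms by (auto simp: has_weak_grad_def)

lemma has_weak_divD:
  assumes "has_weak_div \<Omega> \<tau> g"
  shows "\<tau> \<in> L2 \<Omega>" "g \<in> L2 \<Omega>"
    and "\<theta> \<in> test_functions \<Omega> \<Longrightarrow> vpair \<Omega> \<tau> (\<lambda>x. \<chi> i. pderivative i \<theta> x) = - spair \<Omega> g \<theta>"
  using assms by (auto simp: has_weak_div_def)

lemma has_weak_grad_weak_grad: "f \<in> H1 \<Omega> \<Longrightarrow> has_weak_grad \<Omega> f (weak_grad \<Omega> f)"
  by (simp add: weak_grad_def H1_def someI_ex)

lemma has_weak_div_weak_div: "\<tau> \<in> Hdiv \<Omega> \<Longrightarrow> has_weak_div \<Omega> \<tau> (weak_div \<Omega> \<tau>)"
  by (simp add: weak_div_def Hdiv_def someI_ex)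

section \<open>Weak derivatives on bounded open sets\<close>

text \<open>Instantiated not only with the polyhedral domain but also with the convex pieces of a
  cover, their unions and their overlaps.\<close>

locale bounded_open =
  fixes \<Omega> :: "(real^'n) set"
  assumes open_domain: "open \<Omega>" and bounded_domain: "bounded \<Omega>"
begin

lemma domain_lmeasurable: "\<Omega> \<in> lmeasurable"
  using open_domain bounded_domain by (simp add: lmeasurable_open)

lemma domain_sets: "\<Omega> \<in> sets lebesgue"
  using open_domain by simp

lemma test_L2: "\<theta> \<in> test_functions \<Omega> \<Longrightarrow> \<theta> \<in> L2 \<Omega>"
  using domain_lmeasurable by (rule test_functions_L2[rotated])

lemma test_gradient_L2: "\<theta> \<in> test_functions \<Omega> \<Longrightarrow> (\<lambda>x. \<chi> i. pderivative i \<theta> x) \<in> L2 \<Omega>"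
  by (simp add: L2_vec_iff test_L2 test_functions_pderivative)

lemma L2_eq_0_if_orthogonal_to_tests:
  assumes "f \<in> L2 \<Omega>" "\<And>\<theta>. \<theta> \<in> test_functions \<Omega> \<Longrightarrow> spair \<Omega> f \<theta> = 0"
  shows "AE x in lebesgue_on \<Omega>. f x = 0"
  using fundamental_lemma_calculus_of_variations[OF open_domain L2_imp_integrable[OF domain_lmeasurable assms(1)]]
    assms(2) unfolding spair_def by blast

lemma has_weak_grad_cong:
  assumes "has_weak_grad \<Omega> f G" "AE x in lebesgue_on \<Omega>. f x = f' x" "AE x in lebesgue_on \<Omega>. G x = G' x"
  shows "has_weak_grad \<Omega> f' G'"
proof -
  note D = has_weak_gradD[OF assms(1)]
  have f': "f' \<in> L2 \<Omega>" by (rule L2_cong_AE[OF D(1) domain_sets assms(2)])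
  have G': "G' \<in> L2 \<Omega>" by (rule L2_cong_AE[OF D(2) domain_sets assms(3)])
  have "spair \<Omega> f' (pderivative i \<theta>) = - spair \<Omega> (\<lambda>x. G' x $ i) \<theta>" if \<theta>: "\<theta> \<in> test_functions \<Omega>" for \<theta> i
  proof -
    have "AE x in lebesgue_on \<Omega>. G x $ i = G' x $ i" using assms(3) by eventually_elim simp
    then have "spair \<Omega> (\<lambda>x. G x $ i) \<theta> = spair \<Omega> (\<lambda>x. G' x $ i) \<theta>"
      by (intro spair_cong_AE L2_component D G' test_L2[OF \<theta>])
    moreover have "spair \<Omega> f (pderivative i \<theta>) = spair \<Omega> f' (pderivative i \<theta>)"
      by (intro spair_cong_AE D f' assms(2) test_L2[OF test_functions_pderivative[OF \<theta>]])
    ultimately show ?thesis using D(3)[OF \<theta>, of i] by simp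
  qed
  with f' G' show ?thesis by (simp add: has_weak_grad_def)
qed

lemma has_weak_grad_unique:
  assumes "has_weak_grad \<Omega> f G" "has_weak_grad \<Omega> f G'"
  shows "AE x in lebesgue_on \<Omega>. G x = G' x"
proof (rule AE_vec_eq)
  fix i
  note D = has_weak_gradD[OF assms(1)] and D' = has_weak_gradD[OF assms(2)]
  have "AE x in lebesgue_on \<Omega>. G x $ i - G' x $ i = 0"
  proof (rule L2_eq_0_if_orthogonal_to_tests)
    show "(\<lambda>x. G x $ i - G' x $ i) \<in> L2 \<Omega>" by (intro L2_diff L2_component D D')
    fix \<theta> assume \<theta>: "\<theta> \<in> test_functions \<Omega>"
    show "spair \<Omega> (\<lambda>x. G x $ i - G' x $ i) \<theta> = 0"
      using D(3)[OF \<theta>, of i] D'(3)[OF \<theta>, of i]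
      by (subst spair_diff_left) (simp_all add: L2_component D D' test_L2[OF \<theta>])
  qed
  then show "AE x in lebesgue_on \<Omega>. G x $ i = G' x $ i" by eventually_elim simp
qed

lemma weak_grad_eq_AE: "has_weak_grad \<Omega> f G \<Longrightarrow> AE x in lebesgue_on \<Omega>. weak_grad \<Omega> f x = G x"
  by (rule has_weak_grad_unique[OF has_weak_grad_weak_grad]) (auto simp: H1_def)

text \<open>Functions that agree almost everywhere have the same set of weak gradients, so the
  choice operator picks the same one: the equality holds everywhere.\<close>

lemma weak_grad_cong: "AE x in lebesgue_on \<Omega>. f x = g x \<Longrightarrow> weak_grad \<Omega> f = weak_grad \<Omega> g"
proof -
  assume *: "AE x in lebesgue_on \<Omega>. f x = g x"
  then have "AE x in lebesgue_on \<Omega>. g x = f x" by eventually_elim simp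
  with * have "has_weak_grad \<Omega> f = has_weak_grad \<Omega> g"
    by (intro ext iffI) (erule has_weak_grad_cong; simp)+
  then show ?thesis by (simp add: weak_grad_def)
qed

lemma has_weak_div_unique:
  assumes "has_weak_div \<Omega> \<tau> g" "has_weak_div \<Omega> \<tau> g'"
  shows "AE x in lebesgue_on \<Omega>. g x = g' x"
proof -
  note D = has_weak_divD[OF assms(1)] and D' = has_weak_divD[OF assms(2)]
  have "AE x in lebesgue_on \<Omega>. g x - g' x = 0"
  proof (rule L2_eq_0_if_orthogonal_to_tests)
    show "(\<lambda>x. g x - g' x) \<in> L2 \<Omega>" by (intro L2_diff D D')
    fix \<theta> assume \<theta>: "\<theta> \<in> test_functions \<Omega>"
    show "spair \<Omega> (\<lambda>x. g x - g' x) \<theta> = 0"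
      using D(3)[OF \<theta>] D'(3)[OF \<theta>]
      by (subst spair_diff_left) (simp_all add: D D' test_L2[OF \<theta>])
  qed
  then show ?thesis by eventually_elim simp
qed

lemma weak_div_eq_AE: "has_weak_div \<Omega> \<tau> g \<Longrightarrow> AE x in lebesgue_on \<Omega>. weak_div \<Omega> \<tau> x = g x"
  by (rule has_weak_div_unique[OF has_weak_div_weak_div]) (auto simp: Hdiv_def)

lemma has_weak_grad_add:
  assumes "has_weak_grad \<Omega> f F" "has_weak_grad \<Omega> g G"
  shows "has_weak_grad \<Omega> (\<lambda>x. f x + g x) (\<lambda>x. F x + G x)"
proof -
  note D = has_weak_gradD[OF assms(1)] has_weak_gradD[OF assms(2)]
  show ?thesis
    unfolding has_weak_grad_def
    using D by (auto simp: L2_add spair_add_left L2_component test_L2 test_functions_pderivative)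
qed

lemma has_weak_grad_cmult:
  assumes "has_weak_grad \<Omega> f F"
  shows "has_weak_grad \<Omega> (\<lambda>x. c * f x) (\<lambda>x. c *s F x)"
  using has_weak_gradD[OF assms]
  by (auto simp: has_weak_grad_def L2_cmult L2_vcmult spair_cmult_left)

lemma has_weak_grad_diff:
  assumes "has_weak_grad \<Omega> f F" "has_weak_grad \<Omega> g G"
  shows "has_weak_grad \<Omega> (\<lambda>x. f x - g x) (\<lambda>x. F x - G x)"
  using has_weak_grad_add[OF assms(1) has_weak_grad_cmult[OF assms(2), of "-1"]] by simp

lemma integral_pderivative_domain:
  assumes \<theta>: "\<theta> \<in> test_functions \<Omega>"
  shows "(\<integral>x. pderivative i \<theta> x \<partial>lebesgue_on \<Omega>) = 0"
  using integral_lebesgue_on_subset[of \<Omega> UNIV "pderivative i \<theta>"] domain_sets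
    integral_pderivative_test_function[OF \<theta>, of i] test_functions_eq_0[OF test_functions_pderivative[OF \<theta>]]
  by (simp add: lebesgue_on_UNIV_eq)

lemma has_weak_grad_const: "has_weak_grad \<Omega> (\<lambda>x. c) (\<lambda>x. 0)"
  by (auto simp: has_weak_grad_def L2_const[OF domain_lmeasurable] spair_def integral_pderivative_domain)

text \<open>Integration by parts is the product rule, as the integral of a derivative of
  \<open>\<theta> x * \<eta> x\<close> is zero.\<close>

lemma has_weak_grad_test:
  assumes \<theta>: "\<theta> \<in> test_functions \<Omega>"
  shows "has_weak_grad \<Omega> \<theta> (\<lambda>x. \<chi> i. pderivative i \<theta> x)"
proof -
  have "spair \<Omega> \<theta> (pderivative i \<eta>) = - spair \<Omega> (pderivative i \<theta>) \<eta>" if \<eta>: "\<eta> \<in> test_functions \<Omega>" for \<eta> i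
  proof -
    have "pderivative i (\<lambda>x. \<theta> x * \<eta> x) = (\<lambda>x. \<theta> x * pderivative i \<eta> x + pderivative i \<theta> x * \<eta> x)"
      using test_functions_differentiable[OF \<theta>] test_functions_differentiable[OF \<eta>]
      by (intro ext pderivative_mult)
    moreover have "(\<integral>x. pderivative i (\<lambda>x. \<theta> x * \<eta> x) x \<partial>lebesgue_on \<Omega>) = 0"
      by (rule integral_pderivative_domain[OF test_functions_mult[OF \<eta> test_functions_Ck[OF \<theta>]]])
    ultimately have "spair \<Omega> \<theta> (pderivative i \<eta>) + spair \<Omega> (pderivative i \<theta>) \<eta> = 0"
      unfolding spair_def
      by (simp add: L2_integrable_mult test_L2[OF \<theta>] test_L2[OF \<eta>] test_L2[OF test_functions_pderivative[OF \<theta>]]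
          test_L2[OF test_functions_pderivative[OF \<eta>]])
    then show ?thesis by (simp add: eq_neg_iff_add_eq_0)
  qed
  then show ?thesis
    using test_L2[OF \<theta>] test_gradient_L2[OF \<theta>] by (simp add: has_weak_grad_def)
qed

text \<open>The weak gradient is a closed operator: for a fixed test function both sides of its
  defining identity are continuous in the \<open>L2\<close> norm.\<close>

lemma has_weak_grad_limit:
  assumes fn: "\<And>n. has_weak_grad \<Omega> (f n) (F n)" and L2: "g \<in> L2 \<Omega>" "G \<in> L2 \<Omega>"
    and lim: "(\<lambda>n. L2_norm \<Omega> (\<lambda>x. f n x - g x)) \<longlonglongrightarrow> 0" "(\<lambda>n. L2_norm \<Omega> (\<lambda>x. F n x - G x)) \<longlonglongrightarrow> 0"
  shows "has_weak_grad \<Omega> g G"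
proof -
  note D = has_weak_gradD[OF fn]
  have spair_lim: "(\<lambda>n. spair \<Omega> (a n) \<eta>) \<longlonglongrightarrow> spair \<Omega> b \<eta>"
    if a: "\<And>n. a n \<in> L2 \<Omega>" "b \<in> L2 \<Omega>" "\<eta> \<in> L2 \<Omega>" and l: "(\<lambda>n. L2_norm \<Omega> (\<lambda>x. a n x - b x)) \<longlonglongrightarrow> 0" for a b \<eta>
  proof (rule LIM_zero_cancel, rule Lim_null_comparison)
    show "\<forall>\<^sub>F n in sequentially. norm (spair \<Omega> (a n) \<eta> - spair \<Omega> b \<eta>) \<le> L2_norm \<Omega> (\<lambda>x. a n x - b x) * L2_norm \<Omega> \<eta>"
      using spair_bound[OF L2_diff[OF a(1,2)] a(3)] by (simp add: spair_diff_left a)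
    show "(\<lambda>n. L2_norm \<Omega> (\<lambda>x. a n x - b x) * L2_norm \<Omega> \<eta>) \<longlonglongrightarrow> 0"
      using tendsto_mult_right[OF l, of "L2_norm \<Omega> \<eta>"] by simp
  qed
  have "spair \<Omega> g (pderivative i \<theta>) = - spair \<Omega> (\<lambda>x. G x $ i) \<theta>" if \<theta>: "\<theta> \<in> test_functions \<Omega>" for \<theta> i
  proof (rule LIMSEQ_unique)
    show "(\<lambda>n. spair \<Omega> (f n) (pderivative i \<theta>)) \<longlonglongrightarrow> spair \<Omega> g (pderivative i \<theta>)"
      by (intro spair_lim D L2 lim test_L2[OF test_functions_pderivative[OF \<theta>]])
    have "(\<lambda>n. L2_norm \<Omega> (\<lambda>x. F n x $ i - G x $ i)) \<longlonglongrightarrow> 0"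
    proof (rule Lim_null_comparison[OF _ lim(2)])
      show "\<forall>\<^sub>F n in sequentially. norm (L2_norm \<Omega> (\<lambda>x. F n x $ i - G x $ i)) \<le> L2_norm \<Omega> (\<lambda>x. F n x - G x)"
        using L2_norm_component_le[OF L2_diff[OF D(2) L2(2)], where i = i] by simp
    qed
    then have "(\<lambda>n. spair \<Omega> (\<lambda>x. F n x $ i) \<theta>) \<longlonglongrightarrow> spair \<Omega> (\<lambda>x. G x $ i) \<theta>"
      by (intro spair_lim D L2 L2_component test_L2[OF \<theta>])
    then show "(\<lambda>n. spair \<Omega> (f n) (pderivative i \<theta>)) \<longlonglongrightarrow> - spair \<Omega> (\<lambda>x. G x $ i) \<theta>"
      unfolding D(3)[OF \<theta>] by (rule tendsto_minus)
  qed
  with L2 show ?thesis by (simp add: has_weak_grad_def)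
qed

lemma test_H10: "\<theta> \<in> test_functions \<Omega> \<Longrightarrow> \<theta> \<in> H10 \<Omega>"
proof -
  assume \<theta>: "\<theta> \<in> test_functions \<Omega>"
  \<comment> \<open>The chosen weak gradient of the zero function is known to vanish only almost
    everywhere.\<close>
  have "L2_norm \<Omega> (weak_grad \<Omega> (\<lambda>x. 0)) = 0"
    using L2_norm_cong_AE[OF _ _ weak_grad_eq_AE[OF has_weak_grad_const[of 0]]]
      has_weak_gradD(2)[OF has_weak_grad_weak_grad, of "\<lambda>x. 0" \<Omega>] has_weak_grad_const[of 0]
    by (auto simp: H1_def)
  then have "H1_norm \<Omega> (\<lambda>x. \<theta> x - \<theta> x) = 0"
    by (simp add: H1_norm_def)
  then have "\<forall>e>0. \<exists>\<eta>\<in>test_functions \<Omega>. H1_norm \<Omega> (\<lambda>x. \<theta> x - \<eta> x) < e"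
    using \<theta> by metis
  moreover have "\<theta> \<in> H1 \<Omega>" using has_weak_grad_test[OF \<theta>] by (auto simp: H1_def)
  ultimately show ?thesis by (simp add: H10_def)
qed

lemma H10_cong:
  assumes "f \<in> H10 \<Omega>" "AE x in lebesgue_on \<Omega>. f x = g x"
  shows "g \<in> H10 \<Omega>"
proof -
  have H1: "f \<in> H1 \<Omega>" using assms(1) by (simp add: H10_def)
  note D = has_weak_grad_weak_grad[OF H1]
  have gH1: "g \<in> H1 \<Omega>"
    using has_weak_grad_cong[OF D assms(2)] by (auto simp: H1_def)
  have "H1_norm \<Omega> (\<lambda>x. f x - \<theta> x) = H1_norm \<Omega> (\<lambda>x. g x - \<theta> x)" if \<theta>: "\<theta> \<in> test_functions \<Omega>" for \<theta>
  proof -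
    have ae: "AE x in lebesgue_on \<Omega>. f x - \<theta> x = g x - \<theta> x" using assms(2) by eventually_elim simp
    have "L2_norm \<Omega> (\<lambda>x. f x - \<theta> x) = L2_norm \<Omega> (\<lambda>x. g x - \<theta> x)"
      by (intro L2_norm_cong_AE[OF _ _ ae] L2_diff test_L2[OF \<theta>] has_weak_gradD(1)[OF D]
          has_weak_gradD(1)[OF has_weak_grad_weak_grad[OF gH1]])
    then show ?thesis using weak_grad_cong[OF ae] by (simp add: H1_norm_def)
  qed
  with assms(1) gH1 show ?thesis by (auto simp: H10_def)
qed

section \<open>Density of test functions and duality\<close>

text \<open>Let \<open>H\<close> be the \<open>L2\<close> closure of the test functions. The Riesz
  theorem yields the orthogonal projection \<open>q\<close> of \<open>g\<close> onto
  \<open>H\<close>; the difference \<open>q - g\<close> is orthogonal to all test functions, so it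
  vanishes by the fundamental lemma.\<close>

lemma test_functions_dense:
  assumes g: "g \<in> L2 \<Omega>" and e: "0 < e"
  shows "\<exists>\<theta>\<in>test_functions \<Omega>. L2_norm \<Omega> (\<lambda>x. g x - \<theta> x) < e"
proof -
  define H where "H = {q \<in> L2 \<Omega>. \<forall>e>0. \<exists>\<theta>\<in>test_functions \<Omega>. L2_norm \<Omega> (\<lambda>x. q x - \<theta> x) < e}"
  have test_H: "\<theta> \<in> H" if "\<theta> \<in> test_functions \<Omega>" for \<theta>
    using that test_L2[OF that] by (auto simp: H_def intro!: bexI[of _ \<theta>])
  have HL2: "q \<in> L2 \<Omega>" if "q \<in> H" for q using that by (simp add: H_def)
  have "\<exists>q\<in>H. \<forall>t\<in>H. L2_inner \<Omega> q t = L2_inner \<Omega> g t"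
  proof (rule Riesz_representation[where add = "\<lambda>f g x. f x + g x" and smul = "\<lambda>c f x. c *\<^sub>R f x" and C = "L2_norm \<Omega> g"])
    show "H \<noteq> {}" using test_H[OF test_functions_zero] by blast
    show "(\<lambda>x. p x + q x) \<in> H" if p: "p \<in> H" and q: "q \<in> H" for p q
    proof -
      have "\<exists>\<theta>\<in>test_functions \<Omega>. L2_norm \<Omega> (\<lambda>x. p x + q x - \<theta> x) < e" if "0 < e" for e
      proof -
        have "0 < e / 2" using that by simp
        then obtain \<theta> \<eta> where t: "\<theta> \<in> test_functions \<Omega>" "L2_norm \<Omega> (\<lambda>x. p x - \<theta> x) < e / 2"
          "\<eta> \<in> test_functions \<Omega>" "L2_norm \<Omega> (\<lambda>x. q x - \<eta> x) < e / 2"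
          using p q unfolding H_def by blast
        have "(\<lambda>x. p x + q x - (\<theta> x + \<eta> x)) = (\<lambda>x. (p x - \<theta> x) + (q x - \<eta> x))" by auto
        then have "L2_norm \<Omega> (\<lambda>x. p x + q x - (\<theta> x + \<eta> x)) < e"
          using L2_norm_triangle[OF L2_diff[OF HL2[OF p] test_L2[OF t(1)]] L2_diff[OF HL2[OF q] test_L2[OF t(3)]]] t(2,4)
          by simp
        then show ?thesis using test_functions_add[OF t(1,3)] by (intro bexI[where x = "\<lambda>x. \<theta> x + \<eta> x"])
      qed
      then show ?thesis using L2_add[OF HL2[OF p] HL2[OF q]] by (simp add: H_def)
    qed
    show "(\<lambda>x. c *\<^sub>R q x) \<in> H" if q: "q \<in> H" for c q
    proof -
      have "\<exists>\<theta>\<in>test_functions \<Omega>. L2_norm \<Omega> (\<lambda>x. c *\<^sub>R q x - \<theta> x) < e" if "0 < e" for e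
      proof -
        have "0 < e / (\<bar>c\<bar> + 1)" using that by simp
        then obtain \<theta> where t: "\<theta> \<in> test_functions \<Omega>" "L2_norm \<Omega> (\<lambda>x. q x - \<theta> x) < e / (\<bar>c\<bar> + 1)"
          using q unfolding H_def by blast
        have "L2_norm \<Omega> (\<lambda>x. c *\<^sub>R q x - of_real c * \<theta> x) = \<bar>c\<bar> * L2_norm \<Omega> (\<lambda>x. q x - \<theta> x)"
          using L2_norm_scaleR[of \<Omega> c "\<lambda>x. q x - \<theta> x"] by (simp add: scaleR_conv_of_real right_diff_distrib)
        also have "\<dots> \<le> (\<bar>c\<bar> + 1) * L2_norm \<Omega> (\<lambda>x. q x - \<theta> x)" by (intro mult_right_mono) auto
        also have "\<dots> < e" using t(2) by (simp add: field_simps)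
        finally show ?thesis using test_functions_cmult[OF t(1)] by (intro bexI[where x = "\<lambda>x. of_real c * \<theta> x"])
      qed
      then show ?thesis using L2_scaleR[OF HL2[OF q]] by (simp add: H_def)
    qed
    show "\<bar>L2_inner \<Omega> g x\<bar> \<le> L2_norm \<Omega> g * sqrt (L2_inner \<Omega> x x)" if "x \<in> H" for x
      unfolding sqrt_L2_inner_self by (rule L2_Cauchy_Schwarz[OF g HL2[OF that]])
    show "L2_inner \<Omega> p q = L2_inner \<Omega> q p" for p q :: "real^'n \<Rightarrow> complex"
      by (rule L2_inner_commute)
    show "L2_inner \<Omega> (\<lambda>x. p x + q x) r = L2_inner \<Omega> p r + L2_inner \<Omega> q r" if "p \<in> H" "q \<in> H" "r \<in> H" for p q r
      using that by (intro L2_inner_add_left HL2)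
    show "L2_inner \<Omega> (\<lambda>x. c *\<^sub>R p x) q = c * L2_inner \<Omega> p q" for c and p q :: "real^'n \<Rightarrow> complex"
      by (rule L2_inner_scaleR_left)
    show "L2_inner \<Omega> g (\<lambda>x. p x + q x) = L2_inner \<Omega> g p + L2_inner \<Omega> g q" if "p \<in> H" "q \<in> H" for p q
      using L2_inner_add_left[OF HL2[OF that(1)] HL2[OF that(2)] g] by (simp only: L2_inner_commute[of \<Omega> g])
    show "L2_inner \<Omega> g (\<lambda>x. c *\<^sub>R p x) = c * L2_inner \<Omega> g p" for c p
      by (simp only: L2_inner_commute[of \<Omega> g] L2_inner_scaleR_left)
    fix s :: "nat \<Rightarrow> real^'n \<Rightarrow> complex"
    assume s: "\<And>n. s n \<in> H"
      and C: "\<And>e. 0 < e \<Longrightarrow> \<exists>N. \<forall>m\<ge>N. \<forall>n\<ge>N. sqrt (L2_inner \<Omega> (\<lambda>x. s m x + (-1) *\<^sub>R s n x) (\<lambda>x. s m x + (-1) *\<^sub>R s n x)) < e"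
    obtain q where q: "q \<in> L2 \<Omega>" "(\<lambda>n. L2_norm \<Omega> (\<lambda>x. s n x - q x)) \<longlonglongrightarrow> 0"
      using L2_Cauchy_limit[of \<Omega> s, OF domain_lmeasurable HL2[OF s]] C by (auto simp: sqrt_L2_inner_self)
    have "\<exists>\<theta>\<in>test_functions \<Omega>. L2_norm \<Omega> (\<lambda>x. q x - \<theta> x) < e" if "0 < e" for e
    proof -
      have e: "0 < e / 2" using that by simp
      from LIMSEQ_D[OF q(2) this] obtain n where n: "L2_norm \<Omega> (\<lambda>x. s n x - q x) < e / 2" by fastforce
      obtain \<theta> where t: "\<theta> \<in> test_functions \<Omega>" "L2_norm \<Omega> (\<lambda>x. s n x - \<theta> x) < e / 2"
        using s[of n] e unfolding H_def by blast
      have "L2_norm \<Omega> (\<lambda>x. q x - \<theta> x) < e"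
        using L2_norm_diff_triangle[OF q(1) HL2[OF s[of n]] test_L2[OF t(1)]] n t(2) L2_norm_minus_commute[of \<Omega> q "s n"]
        by linarith
      with t(1) show ?thesis by blast
    qed
    with q(1) have "q \<in> H" by (simp add: H_def)
    with q(2) show "\<exists>q\<in>H. (\<lambda>n. sqrt (L2_inner \<Omega> (\<lambda>x. s n x + (-1) *\<^sub>R q x) (\<lambda>x. s n x + (-1) *\<^sub>R q x))) \<longlonglongrightarrow> 0"
      by (auto simp: sqrt_L2_inner_self)
  qed simp
  then obtain q where q: "q \<in> H" "\<And>t. t \<in> H \<Longrightarrow> L2_inner \<Omega> q t = L2_inner \<Omega> g t" by blast
  have d: "(\<lambda>x. q x - g x) \<in> L2 \<Omega>" by (rule L2_diff[OF HL2[OF q(1)] g])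
  have "AE x in lebesgue_on \<Omega>. cnj (q x - g x) = 0"
  proof (rule L2_eq_0_if_orthogonal_to_tests[OF L2_cnj[OF d]])
    fix \<theta> assume \<theta>: "\<theta> \<in> test_functions \<Omega>"
    have Re0: "Re (spair \<Omega> (\<lambda>x. cnj (q x - g x)) \<eta>) = 0" if \<eta>: "\<eta> \<in> test_functions \<Omega>" for \<eta>
    proof -
      have "Re (spair \<Omega> (\<lambda>x. cnj (q x - g x)) \<eta>) = L2_inner \<Omega> \<eta> (\<lambda>x. q x - g x)"
        by (subst spair_commute, subst Re_spair[OF test_L2[OF \<eta>] L2_cnj[OF d]]) simp
      also have "\<dots> = 0"
        using q(2)[OF test_H[OF \<eta>]]
        by (simp add: L2_inner_commute[of \<Omega> \<eta>] L2_inner_diff_left[OF HL2[OF q(1)] g test_L2[OF \<eta>]])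
      finally show ?thesis .
    qed
    \<comment> \<open>The real parts for \<open>\<theta>\<close> and for its multiple by
      \<open>\<i>\<close> determine the complex pairing.\<close>
    from Re0[OF \<theta>] Re0[OF test_functions_cmult[OF \<theta>, of \<i>]]
    show "spair \<Omega> (\<lambda>x. cnj (q x - g x)) \<theta> = 0"
      unfolding spair_cmult_right by (simp add: complex_eq_iff)
  qed
  then have ae: "AE x in lebesgue_on \<Omega>. q x = g x" by eventually_elim simp
  obtain \<theta> where \<theta>: "\<theta> \<in> test_functions \<Omega>" "L2_norm \<Omega> (\<lambda>x. q x - \<theta> x) < e"
    using q(1) e unfolding H_def by blast
  have "L2_norm \<Omega> (\<lambda>x. q x - \<theta> x) = L2_norm \<Omega> (\<lambda>x. g x - \<theta> x)"
  proof (rule L2_norm_cong_AE)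
    show "AE x in lebesgue_on \<Omega>. q x - \<theta> x = g x - \<theta> x" using ae by eventually_elim simp
  qed (intro L2_diff HL2 q(1) g test_L2[OF \<theta>(1)])+
  with \<theta> show ?thesis by auto
qed

text \<open>The pairing of \<open>g\<close> with its conjugate is the squared norm, and test
  functions come arbitrarily close to that conjugate.\<close>

lemma L2_norm_le_dual:
  assumes g: "g \<in> L2 \<Omega>" and M: "0 \<le> M"
    and le: "\<And>\<theta>. \<theta> \<in> test_functions \<Omega> \<Longrightarrow> norm (spair \<Omega> g \<theta>) \<le> M * L2_norm \<Omega> \<theta>"
  shows "L2_norm \<Omega> g \<le> M"
proof (rule ccontr)
  let ?N = "L2_norm \<Omega> g"
  assume "\<not> ?N \<le> M"
  then have N: "M < ?N" by simp
  \<comment> \<open>The total error \<open>e * (?N + M)\<close> is then half of the gap between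
    \<open>?N^2\<close> and \<open>M * ?N\<close>.\<close>
  define e where "e = ?N * (?N - M) / (2 * (?N + M))"
  have e: "0 < e" unfolding e_def using N M by (intro divide_pos_pos mult_pos_pos) auto
  obtain \<theta> where \<theta>: "\<theta> \<in> test_functions \<Omega>" "L2_norm \<Omega> (\<lambda>x. cnj (g x) - \<theta> x) < e"
    using test_functions_dense[OF L2_cnj[OF g] e] by blast
  have t: "\<theta> \<in> L2 \<Omega>" by (rule test_L2[OF \<theta>(1)])
  have cn: "L2_norm \<Omega> (\<lambda>x. cnj (g x)) = ?N" by (simp add: L2_norm_def)
  have "L2_norm \<Omega> \<theta> \<le> L2_norm \<Omega> (\<lambda>x. \<theta> x - cnj (g x)) + ?N"
    using L2_norm_triangle[OF L2_diff[OF t L2_cnj[OF g]] L2_cnj[OF g]] cn by simp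
  then have t_le: "L2_norm \<Omega> \<theta> \<le> ?N + e"
    using \<theta>(2) L2_norm_minus_commute[of \<Omega> \<theta> "\<lambda>x. cnj (g x)"] by linarith
  have "?N\<^sup>2 = Re (spair \<Omega> g (\<lambda>x. cnj (g x)))"
    using Re_spair[OF g L2_cnj[OF g]] by (simp add: L2_norm_power2)
  also have "\<dots> \<le> norm (spair \<Omega> g (\<lambda>x. cnj (g x)))" by (rule complex_Re_le_cmod)
  also have "spair \<Omega> g (\<lambda>x. cnj (g x)) = spair \<Omega> g (\<lambda>x. cnj (g x) - \<theta> x) + spair \<Omega> g \<theta>"
    using spair_add_right[OF L2_diff[OF L2_cnj[OF g] t] t g] by simp
  also have "norm \<dots> \<le> norm (spair \<Omega> g (\<lambda>x. cnj (g x) - \<theta> x)) + norm (spair \<Omega> g \<theta>)"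
    by (rule norm_triangle_ineq)
  also have "\<dots> \<le> ?N * e + M * (?N + e)"
    using spair_bound[OF g L2_diff[OF L2_cnj[OF g] t]] le[OF \<theta>(1)]
      mult_left_mono[OF t_le M] mult_left_mono[OF less_imp_le[OF \<theta>(2)], of ?N] by simp
  also have "\<dots> = M * ?N + e * (?N + M)" by (simp add: algebra_simps)
  also have "e * (?N + M) = ?N * (?N - M) / 2" unfolding e_def using N M by (simp add: field_simps)
  finally have "?N\<^sup>2 \<le> M * ?N + ?N * (?N - M) / 2" .
  moreover have "0 < ?N * (?N - M)" using N M by (intro mult_pos_pos) auto
  moreover have "?N * (?N - M) = ?N\<^sup>2 - M * ?N" by (simp add: power2_eq_square algebra_simps)
  ultimately show False by linarith
qed

end

section \<open>The Poincare inequality on polyhedral domains\<close>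

text \<open>There are finitely many cells because \<open>S x\<close> is determined by a subset of
  the finite set \<open>HS\<close>. A cell stays in the domain for the following reason. For
  \<open>z\<close> in \<open>S x\<close>, a point of the segment close to \<open>x\<close> lies in
  some polytope \<open>K\<close>. If \<open>z\<close> violated an inequality of \<open>K\<close>,
  that inequality could not be strict at \<open>x\<close>, since its open half-space would then
  contain \<open>z\<close> as well; but then it would already be violated at the point close to
  \<open>x\<close>.\<close>

lemma polyhedral_domain_convex_cover:
  fixes \<Omega> :: "(real^'n) set"
  assumes "polyhedral_domain \<Omega>"
  obtains \<C> where "finite \<C>" "\<And>U. U \<in> \<C> \<Longrightarrow> open U \<and> convex U \<and> U \<noteq> {}" "\<Union>\<C> = \<Omega>"
proof -
  from assms obtain F where F: "finite F" "\<And>K. K \<in> F \<Longrightarrow> polytope K" "\<Omega> = interior (\<Union>F)"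
    unfolding polyhedral_domain_def by blast
  have "\<exists>P. finite P \<and> K = {x. \<forall>p\<in>P. fst p \<bullet> x \<le> snd p}" if "K \<in> F" for K :: "(real^'n) set"
  proof -
    from polytope_imp_polyhedron[OF F(2)[OF that]] obtain G where
      G: "finite G" "K = \<Inter>G" "\<And>h. h \<in> G \<Longrightarrow> \<exists>a b. a \<noteq> 0 \<and> h = {x. a \<bullet> x \<le> b}"
      unfolding polyhedron_def by blast
    obtain a b where ab: "\<And>h. h \<in> G \<Longrightarrow> h = {x. a h \<bullet> x \<le> b h}"
      using G(3) by metis
    have "K = {x. \<forall>p\<in>(\<lambda>h. (a h, b h)) ` G. fst p \<bullet> x \<le> snd p}"
      using G(2) ab by auto
    with G(1) show ?thesis by blast
  qed
  then have "\<forall>K\<in>F. \<exists>P. finite P \<and> K = {x. \<forall>p\<in>P. fst p \<bullet> x \<le> snd p}" by blast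
  from bchoice[OF this] obtain P where
    P': "\<forall>K\<in>F. finite (P K) \<and> K = {x. \<forall>p\<in>P K. fst p \<bullet> x \<le> snd p}" ..
  have P: "\<And>K. K \<in> F \<Longrightarrow> finite (P K)" "\<And>K. K \<in> F \<Longrightarrow> K = {x. \<forall>p\<in>P K. fst p \<bullet> x \<le> snd p}"
    using P' by simp_all
  define HS where "HS = (\<Union>K\<in>F. \<Union>p\<in>P K. {{y. fst p \<bullet> y < snd p}, {y. fst p \<bullet> y > snd p}})"
  have HS: "finite HS" "\<And>E. E \<in> HS \<Longrightarrow> open E \<and> convex E"
    unfolding HS_def using F(1) P(1)
    by (auto intro: open_halfspace_lt open_halfspace_gt convex_halfspace_lt convex_halfspace_gt)
  \<comment> \<open>A hyperplane through \<open>x\<close> contributes neither of its sides, so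
    \<open>S x\<close> is an open set that may cross it.\<close>
  define S where "S x = \<Inter>{E\<in>HS. x \<in> E}" for x
  have S: "open (S x)" "convex (S x)" "x \<in> S x" for x
    using HS unfolding S_def by (auto intro!: open_Inter convex_Inter)
  have "S x \<subseteq> \<Omega>" if x: "x \<in> \<Omega>" for x
  proof -
    from x F(3) obtain e where e: "0 < e" "ball x e \<subseteq> \<Union>F"
      by (auto simp: mem_interior)
    have "z \<in> \<Union>F" if z: "z \<in> S x" for z
    proof -
      define t where "t = min 1 (e / (2 * (norm (z - x) + 1)))"
      have n: "0 < norm (z - x) + 1" by (simp add: add_nonneg_pos)
      have t: "0 < t" "t \<le> 1" using e(1) n by (auto simp: t_def)
      have "t * norm (z - x) \<le> e / (2 * (norm (z - x) + 1)) * (norm (z - x) + 1)"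
        using n t by (intro mult_mono) (auto simp: t_def)
      also have "\<dots> = e / 2" using n by (simp add: field_simps)
      finally have "t * norm (z - x) < e" using e(1) by linarith
      then have "x + t *\<^sub>R (z - x) \<in> ball x e" using t by (simp add: dist_norm)
      with e(2) obtain K where K: "K \<in> F" "x + t *\<^sub>R (z - x) \<in> K" by blast
      have "fst p \<bullet> z \<le> snd p" if p: "p \<in> P K" for p
      proof (rule ccontr)
        assume "\<not> fst p \<bullet> z \<le> snd p"
        then have zp: "snd p < fst p \<bullet> z" by simp
        have "snd p \<le> fst p \<bullet> x"
        proof (rule ccontr)
          assume "\<not> snd p \<le> fst p \<bullet> x"
          then have "x \<in> {y. fst p \<bullet> y < snd p}" by simp
          moreover have "{y. fst p \<bullet> y < snd p} \<in> HS" using K(1) p unfolding HS_def by blast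
          ultimately have "z \<in> {y. fst p \<bullet> y < snd p}" using z unfolding S_def by blast
          with zp show False by simp
        qed
        moreover have "fst p \<bullet> x + t * (fst p \<bullet> z - fst p \<bullet> x) \<le> snd p"
        proof -
          have "x + t *\<^sub>R (z - x) \<in> {x. \<forall>p\<in>P K. fst p \<bullet> x \<le> snd p}"
            by (rule subst[OF P(2)[OF K(1)], of "\<lambda>S. x + t *\<^sub>R (z - x) \<in> S"]) (rule K(2))
          with p have "fst p \<bullet> (x + t *\<^sub>R (z - x)) \<le> snd p" by simp
          then show ?thesis by (simp add: inner_add_right inner_diff_right)
        qed
        \<comment> \<open>At the point close to \<open>x\<close> the excess over
          \<open>snd p\<close> is the convex combination of a nonnegative excess at \<open>x\<close>
          and a positive one at \<open>z\<close>.\<close>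
        moreover have "t * (fst p \<bullet> z - snd p) > 0" using t zp by simp
        moreover have "(1 - t) * (fst p \<bullet> x - snd p) \<ge> 0" using t calculation(1) by simp
        ultimately show False by (simp add: algebra_simps)
      qed
      then have "z \<in> K" using P(2)[OF K(1)] by blast
      with K(1) show ?thesis by blast
    qed
    then show ?thesis unfolding F(3) using S(1)[of x] by (intro interior_maximal) auto
  qed
  then have "\<Union>(S ` \<Omega>) = \<Omega>" using S(3) by blast
  moreover have "finite (S ` \<Omega>)"
  proof (rule finite_subset)
    show "S ` \<Omega> \<subseteq> Inter ` Pow HS" unfolding S_def by blast
  qed (use HS in simp)
  ultimately show thesis using that[of "S ` \<Omega>"] S by blast
qed

lemma polyhedral_domain_bounded_open: "polyhedral_domain \<Omega> \<Longrightarrow> bounded_open \<Omega>"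
proof -
  assume "polyhedral_domain \<Omega>"
  then obtain F where F: "finite F" "\<And>K. K \<in> F \<Longrightarrow> polytope K" "\<Omega> = interior (\<Union>F)"
    unfolding polyhedral_domain_def by blast
  have "bounded (\<Union>F)" using F by (intro bounded_Union) (auto intro: polytope_imp_bounded)
  with F(3) show ?thesis by (simp add: bounded_open_def bounded_interior)
qed

lemma has_weak_grad_subset:
  assumes fG: "has_weak_grad \<Omega> f G" and U: "open U" "U \<subseteq> \<Omega>" and \<Omega>: "open \<Omega>"
  shows "has_weak_grad U f G"
proof -
  note D = has_weak_gradD[OF fG]
  have "spair U f (pderivative i \<theta>) = - spair U (\<lambda>x. G x $ i) \<theta>" if \<theta>: "\<theta> \<in> test_functions U" for \<theta> i
    using D(3)[of \<theta> i] test_functions_mono[OF U(2)] \<theta>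
      spair_test_subset[OF test_functions_pderivative[OF \<theta>] U(2,1) \<Omega>] spair_test_subset[OF \<theta> U(2,1) \<Omega>]
    by auto
  moreover have "f \<in> L2 U" "G \<in> L2 U"
    using L2_restrict(1)[OF D(1) U(2)] L2_restrict(1)[OF D(2) U(2)] U(1) \<Omega> by auto
  ultimately show ?thesis by (simp add: has_weak_grad_def)
qed

section \<open>Gluing Poincare inequalities\<close>

text \<open>An arbitrary constant \<open>c\<close> in place of the mean makes the inequality easy to
  glue. \<open>H1_mean0_Poincare\<close> returns to functions of mean zero.\<close>

definition Poincare :: "(real^'n) set \<Rightarrow> bool" where
  "Poincare U \<longleftrightarrow> (\<exists>C\<ge>0. \<forall>f G. has_weak_grad U f G \<longrightarrow> (\<exists>c. L2_norm U (\<lambda>x. f x - c) \<le> C * L2_norm U G))"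

lemma L2_norm_Un_le:
  fixes f :: "real^'n \<Rightarrow> 'b::euclidean_space"
  assumes f: "f \<in> L2 (U \<union> V)" and U: "U \<in> sets lebesgue" and V: "V \<in> sets lebesgue"
  shows "L2_norm (U \<union> V) f \<le> L2_norm U f + L2_norm V f"
proof -
  let ?g = "\<lambda>S x. if x \<in> S then (norm (f x))\<^sup>2 else 0"
  have fU: "f \<in> L2 U" and fV: "f \<in> L2 V"
    using L2_restrict(1)[OF f] U V by auto
  have i: "integrable lebesgue (?g S)" "(\<integral>x. ?g S x \<partial>lebesgue) = (L2_norm S f)\<^sup>2" if "f \<in> L2 S" "S \<in> sets lebesgue" for S
    using that L2_integrable_norm2[OF that(1)]
    by (simp_all add: Lebesgue_Measure.integrable_restrict_UNIV Lebesgue_Measure.integral_restrict_UNIV L2_norm_def)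
  have UV: "U \<union> V \<in> sets lebesgue" using U V by simp
  have "(L2_norm (U \<union> V) f)\<^sup>2 = (\<integral>x. ?g (U \<union> V) x \<partial>lebesgue)" by (simp only: i(2)[OF f UV])
  also have "\<dots> \<le> (\<integral>x. ?g U x + ?g V x \<partial>lebesgue)"
    by (intro integral_mono Bochner_Integration.integrable_add i f fU fV U V UV) auto
  also have "\<dots> = (L2_norm U f)\<^sup>2 + (L2_norm V f)\<^sup>2"
    by (subst Bochner_Integration.integral_add) (simp_all only: i fU fV U V)
  also have "\<dots> \<le> (L2_norm U f + L2_norm V f)\<^sup>2"
    by (simp add: power2_sum)
  finally show ?thesis by (rule power2_le_imp_le) (intro add_nonneg_nonneg L2_norm_nonneg)
qed

lemma L2_norm_const:
  assumes "U \<in> lmeasurable"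
  shows "L2_norm U (\<lambda>x. c) = norm c * sqrt (measure lebesgue U)"
proof -
  have "measure (lebesgue_on U) U = measure lebesgue U"
    using assms by (subst measure_restrict_space) auto
  then show ?thesis by (simp add: L2_norm_def real_sqrt_mult)
qed

text \<open>The overlap is open and nonempty, so it has positive measure. There both constants are
  close to \<open>f\<close>, hence to each other, and the constant of \<open>U\<close> can be used
  on \<open>V\<close> too.\<close>

lemma Poincare_Un:
  fixes U V :: "(real^'n) set"
  assumes PU: "Poincare U" and PV: "Poincare V" and U: "bounded_open U" and V: "bounded_open V" and ne: "U \<inter> V \<noteq> {}"
  shows "Poincare (U \<union> V)"
proof -
  interpret U: bounded_open U by (rule U)
  interpret V: bounded_open V by (rule V)
  interpret W: bounded_open "U \<union> V"
    using U.open_domain V.open_domain U.bounded_domain V.bounded_domain by unfold_locales auto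
  interpret I: bounded_open "U \<inter> V"
    using U.open_domain V.open_domain U.bounded_domain by unfold_locales auto
  obtain C where C: "0 \<le> C" "\<And>f G. has_weak_grad U f G \<Longrightarrow> \<exists>c. L2_norm U (\<lambda>x. f x - c) \<le> C * L2_norm U G"
    using PU unfolding Poincare_def by blast
  obtain D where D: "0 \<le> D" "\<And>f G. has_weak_grad V f G \<Longrightarrow> \<exists>c. L2_norm V (\<lambda>x. f x - c) \<le> D * L2_norm V G"
    using PV unfolding Poincare_def by blast
  let ?mI = "sqrt (measure lebesgue (U \<inter> V))" and ?mV = "sqrt (measure lebesgue V)"
  have mI: "0 < ?mI"
    using open_not_negligible[OF I.open_domain ne] negligible_iff_measure0[OF I.domain_lmeasurable]
    by (simp add: zero_less_measure_iff)
  \<comment> \<open>\<open>C\<close> is for the deviation on \<open>U\<close>, \<open>D\<close> for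
    the deviation from \<open>d\<close> on \<open>V\<close>, and the last term for replacing
    \<open>d\<close> by \<open>c\<close> on \<open>V\<close>.\<close>
  define E where "E = C + (D + (C + D) / ?mI * ?mV)"
  have "\<exists>c. L2_norm (U \<union> V) (\<lambda>x. f x - c) \<le> E * L2_norm (U \<union> V) G" if fG: "has_weak_grad (U \<union> V) f G" for f G
  proof -
    let ?N = "L2_norm (U \<union> V) G"
    note L = has_weak_gradD[OF fG]
    have GU: "L2_norm U G \<le> ?N" and GV: "L2_norm V G \<le> ?N"
      using L2_restrict(2)[OF L(2)] U.domain_sets V.domain_sets by auto
    obtain c where c: "L2_norm U (\<lambda>x. f x - c) \<le> C * L2_norm U G"
      using C(2)[OF has_weak_grad_subset[OF fG U.open_domain _ W.open_domain]] by auto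
    obtain d where d: "L2_norm V (\<lambda>x. f x - d) \<le> D * L2_norm V G"
      using D(2)[OF has_weak_grad_subset[OF fG V.open_domain _ W.open_domain]] by auto
    have c': "L2_norm U (\<lambda>x. f x - c) \<le> C * ?N" using c mult_left_mono[OF GU C(1)] by linarith
    have d': "L2_norm V (\<lambda>x. f x - d) \<le> D * ?N" using d mult_left_mono[OF GV D(1)] by linarith
    have fL: "(\<lambda>x. f x - k) \<in> L2 (U \<union> V)" for k
      by (intro L2_diff L L2_const W.domain_lmeasurable)
    have fU: "(\<lambda>x. f x - k) \<in> L2 U" and fV: "(\<lambda>x. f x - k) \<in> L2 V" for k
      using L2_restrict(1)[OF fL] U.domain_sets V.domain_sets by auto
    have fI: "(\<lambda>x. f x - k) \<in> L2 (U \<inter> V)" "L2_norm (U \<inter> V) (\<lambda>x. f x - k) \<le> L2_norm U (\<lambda>x. f x - k)"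
      "L2_norm (U \<inter> V) (\<lambda>x. f x - k) \<le> L2_norm V (\<lambda>x. f x - k)" for k
      using L2_restrict[OF fU, of "U \<inter> V"] L2_restrict[OF fV, of "U \<inter> V"] U.domain_sets V.domain_sets I.domain_sets
      by auto
    have "cmod (d - c) * ?mI = L2_norm (U \<inter> V) (\<lambda>x. (f x - c) - (f x - d))"
      by (simp add: L2_norm_const[OF I.domain_lmeasurable])
    also have "\<dots> \<le> L2_norm (U \<inter> V) (\<lambda>x. f x - c) + L2_norm (U \<inter> V) (\<lambda>x. f x - d)"
      using L2_norm_triangle[OF fI(1) L2_uminus[OF fI(1)], of c d] L2_norm_uminus[of "U \<inter> V" "\<lambda>x. f x - d"] by simp
    also have "\<dots> \<le> (C + D) * ?N" using fI(2)[of c] fI(3)[of d] c' d' by (simp add: distrib_right)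
    finally have "cmod (d - c) \<le> (C + D) * ?N / ?mI" using mI by (simp add: pos_le_divide_eq)
    then have "cmod (d - c) * ?mV \<le> (C + D) * ?N / ?mI * ?mV" by (rule mult_right_mono) simp
    moreover have "L2_norm V (\<lambda>x. f x - c) \<le> L2_norm V (\<lambda>x. f x - d) + cmod (d - c) * ?mV"
      using L2_norm_triangle[OF fV L2_const[OF V.domain_lmeasurable], of d "d - c"]
      by (simp add: L2_norm_const[OF V.domain_lmeasurable])
    ultimately have "L2_norm V (\<lambda>x. f x - c) \<le> D * ?N + (C + D) * ?N / ?mI * ?mV" using d' by linarith
    with L2_norm_Un_le[OF fL U.domain_sets V.domain_sets, of c] c'
    have "L2_norm (U \<union> V) (\<lambda>x. f x - c) \<le> C * ?N + (D * ?N + (C + D) * ?N / ?mI * ?mV)" by linarith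
    also have "\<dots> = E * ?N" by (simp add: E_def algebra_simps)
    finally show ?thesis by blast
  qed
  moreover have "0 \<le> E" unfolding E_def using C(1) D(1) mI by (intro add_nonneg_nonneg mult_nonneg_nonneg divide_nonneg_pos) auto
  ultimately show ?thesis unfolding Poincare_def by blast
qed

text \<open>Take a subfamily of largest size whose union satisfies the inequality. If members
  remained outside it, connectedness would let one of them meet that union, and it could be
  added.\<close>

lemma Poincare_Union:
  fixes \<C> :: "(real^'n) set set"
  assumes fin: "finite \<C>" and ne: "\<C> \<noteq> {}" and conn: "connected (\<Union>\<C>)"
    and \<C>: "\<And>U. U \<in> \<C> \<Longrightarrow> bounded_open U \<and> U \<noteq> {} \<and> Poincare U"
  shows "Poincare (\<Union>\<C>)"
proof -
  let ?Q = "\<lambda>\<D>. \<D> \<subseteq> \<C> \<and> \<D> \<noteq> {} \<and> Poincare (\<Union>\<D>)"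
  obtain U where "U \<in> \<C>" using ne by blast
  then have "?Q {U}" using \<C> by auto
  moreover have "\<forall>\<D>. ?Q \<D> \<longrightarrow> card \<D> \<le> card \<C>" using fin by (auto intro: card_mono)
  ultimately have "\<exists>\<D>. ?Q \<D> \<and> (\<forall>\<E>. ?Q \<E> \<longrightarrow> card \<E> \<le> card \<D>)"
    by (intro ex_has_greatest_nat[of ?Q "{U}" card "Suc (card \<C>)"]) (simp_all add: less_Suc_eq_le)
  then obtain \<D> where \<D>: "?Q \<D>" and max: "\<And>\<E>. ?Q \<E> \<Longrightarrow> card \<E> \<le> card \<D>"
    by (elim exE conjE) simp
  have finD: "finite \<D>" using \<D> fin finite_subset by blast
  have "\<D> = \<C>"
  proof (rule ccontr)
    assume "\<D> \<noteq> \<C>"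
    then have ne2: "\<C> - \<D> \<noteq> {}" using \<D> by blast
    have op: "open (\<Union>\<E>)" if "\<E> \<subseteq> \<C>" for \<E>
      using that \<C> bounded_open.open_domain by (intro open_Union) blast
    have "\<Union>\<D> \<inter> \<Union>(\<C> - \<D>) \<noteq> {}"
    proof
      assume disj: "\<Union>\<D> \<inter> \<Union>(\<C> - \<D>) = {}"
      have 1: "\<Union>\<C> \<subseteq> \<Union>\<D> \<union> \<Union>(\<C> - \<D>)" using \<D> by auto
      have 2: "\<Union>\<D> \<inter> \<Union>\<C> \<noteq> {}" "\<Union>(\<C> - \<D>) \<inter> \<Union>\<C> \<noteq> {}"
        using \<D> ne2 \<C> by blast+
      show False
        using connectedD[OF conn op[of \<D>] op[of "\<C> - \<D>"]] \<D> disj 1 2 by blast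
    qed
    then obtain V where V: "V \<in> \<C>" "V \<notin> \<D>" "V \<inter> \<Union>\<D> \<noteq> {}" by blast
    have "bounded (\<Union>\<D>)"
      using \<C> \<D> finD bounded_open.bounded_domain by (intro bounded_Union) blast+
    then have "bounded_open (\<Union>\<D>)" using op \<D> by unfold_locales auto
    then have "Poincare (V \<union> \<Union>\<D>)" using \<C>[OF V(1)] \<D> V(3) by (intro Poincare_Un) auto
    then have "?Q (insert V \<D>)" using V \<D> by auto
    from max[OF this] V finD show False by simp
  qed
  with \<D> show ?thesis by simp
qed

section \<open>Translation estimates and convex sets\<close>

text \<open>Borel measurability of \<open>f\<close> allows the change of variables to take place in
  \<open>lborel\<close>.\<close>

lemma L2_shift:
  fixes f :: "real^'n \<Rightarrow> complex"
  assumes f: "f \<in> L2 UNIV" and m: "f \<in> borel_measurable borel"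
  shows "(\<lambda>x. f (x - a)) \<in> L2 UNIV" "L2_norm UNIV (\<lambda>x. f (x - a)) = L2_norm UNIV f"
proof -
  have [measurable]: "f \<in> borel_measurable borel" by (rule m)
  have "integrable lborel (\<lambda>x. (norm (f x))\<^sup>2)"
    using L2_integrable_norm2[OF f] by (simp add: lebesgue_on_UNIV_eq integrable_completion)
  then have "integrable (distr lborel borel ((+) (- a))) (\<lambda>x. (norm (f x))\<^sup>2)"
    by (simp add: lborel_distr_plus)
  then have "integrable lborel (\<lambda>x. (norm (f (x - a)))\<^sup>2)"
    by (subst (asm) integrable_distr_eq) simp_all
  then have "integrable lebesgue (\<lambda>x. (norm (f (x - a)))\<^sup>2)"
    by (subst integrable_completion) simp_all
  moreover have "(\<lambda>x. f (x - a)) \<in> borel_measurable lebesgue"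
    by (intro measurable_completion) simp
  ultimately show "(\<lambda>x. f (x - a)) \<in> L2 UNIV" by (simp add: L2_def lebesgue_on_UNIV_eq)
  show "L2_norm UNIV (\<lambda>x. f (x - a)) = L2_norm UNIV f"
    using integral_lebesgue_shift[of "\<lambda>x. (norm (f x))\<^sup>2" a] by (simp add: L2_norm_def lebesgue_on_UNIV_eq)
qed

lemma L2_norm_eq_UNIV:
  fixes f :: "real^'n \<Rightarrow> 'b::euclidean_space"
  assumes "U \<in> sets lebesgue" "\<And>x. x \<notin> U \<Longrightarrow> f x = 0"
  shows "L2_norm U f = L2_norm UNIV f"
  using integral_lebesgue_on_subset[of U UNIV "\<lambda>x. (norm (f x))\<^sup>2"] assms by (simp add: L2_norm_def)

lemma L2_UNIV:
  fixes f :: "real^'n \<Rightarrow> 'b::euclidean_space"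
  assumes "f \<in> L2 U" "U \<in> sets lebesgue" "\<And>x. x \<notin> U \<Longrightarrow> f x = 0"
  shows "f \<in> L2 UNIV"
proof -
  have eq: "(\<lambda>x. if x \<in> U then f x else 0) = f" "(\<lambda>x. if x \<in> U then (norm (f x))\<^sup>2 else 0) = (\<lambda>x. (norm (f x))\<^sup>2)"
    using assms(3) by auto
  have "f \<in> borel_measurable lebesgue"
    using borel_measurable_if[OF assms(2), of f] L2_measurable[OF assms(1)] eq by simp
  moreover have "integrable lebesgue (\<lambda>x. (norm (f x))\<^sup>2)"
    using Lebesgue_Measure.integrable_restrict_UNIV[OF assms(2), of "\<lambda>x. (norm (f x))\<^sup>2"] L2_integrable_norm2[OF assms(1)] eq
    by simp
  ultimately show ?thesis by (simp add: L2_def lebesgue_on_UNIV_eq)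
qed

text \<open>By duality it suffices to bound the pairing with a test function \<open>\<theta>\<close>, and there the difference
  can be moved to \<open>\<theta>\<close>. Convexity keeps the translates of \<open>\<theta>\<close> along the segment supported in \<open>U\<close>.\<close>

lemma L2_norm_translation_difference_le:
  fixes U :: "(real^'n) set" and f :: "real^'n \<Rightarrow> complex"
  assumes U: "bounded_open U" and conv: "convex U" and fG: "has_weak_grad U f G"
    and m: "f \<in> borel_measurable borel" and f0: "\<And>x. x \<notin> U \<Longrightarrow> f x = 0"
  shows "L2_norm (U \<inter> {x. x + h \<in> U}) (\<lambda>x. f (x + h) - f x) \<le> real CARD('n) * norm h * L2_norm U G"
    and "(\<lambda>x. f (x + h) - f x) \<in> L2 (U \<inter> {x. x + h \<in> U})"
proof -
  interpret U: bounded_open U by (rule U)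
  let ?W = "U \<inter> {x. x + h \<in> U}"
  have "open {x. x + h \<in> U}"
    using open_vimage[OF U.open_domain, of "\<lambda>x. x + h"] by (simp add: vimage_def continuous_intros)
  then interpret W: bounded_open ?W
    using U.open_domain U.bounded_domain by unfold_locales auto
  note L = has_weak_gradD[OF fG]
  have fU: "f \<in> L2 UNIV" by (rule L2_UNIV[OF L(1) U.domain_sets f0])
  have fh: "(\<lambda>x. f (x + h)) \<in> L2 UNIV" using L2_shift(1)[OF fU m, of "- h"] by simp
  have fW: "f \<in> L2 ?W" "(\<lambda>x. f (x + h)) \<in> L2 ?W"
    using L2_restrict(1)[OF fU, of ?W] L2_restrict(1)[OF fh, of ?W] W.domain_sets by auto
  show dW: "(\<lambda>x. f (x + h) - f x) \<in> L2 ?W" by (intro L2_diff fW)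
  let ?K = "real CARD('n) * norm h * L2_norm U G"
  show "L2_norm ?W (\<lambda>x. f (x + h) - f x) \<le> ?K"
  proof (rule W.L2_norm_le_dual[OF dW])
    show "0 \<le> ?K" by simp
    fix \<theta> assume \<theta>: "\<theta> \<in> test_functions ?W"
    have \<theta>0: "\<theta> x = 0" if "x \<notin> ?W" for x by (rule test_functions_eq_0[OF \<theta> that])
    have \<theta>m: "\<theta> \<in> borel_measurable borel"
      by (rule borel_measurable_continuous_onI[OF test_functions_continuous[OF \<theta>]])
    have f_int: "integrable lebesgue f"
    proof -
      have "(\<lambda>x. if x \<in> U then f x else 0) = f" using f0 by auto
      then show ?thesis
        using L2_imp_integrable[OF U.domain_lmeasurable L(1)]
          Lebesgue_Measure.integrable_restrict_UNIV[OF U.domain_sets, of f] by simp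
    qed
    \<comment> \<open>The pairing of \<open>f\<close> with the translate of \<open>\<theta>\<close>
      by \<open>t *\<^sub>R h\<close>. Its increment from 0 to 1 is the pairing of the difference
      with \<open>\<theta>\<close>, by the substitution of \<open>x - h\<close> for
      \<open>x\<close>.\<close>
    define \<Phi> where "\<Phi> t = (\<integral>x. f x * \<theta> (x - t *\<^sub>R h) \<partial>lebesgue)" for t
    define D where "D t = - (\<integral>x. f x * dir_derivative h \<theta> (x - t *\<^sub>R h) \<partial>lebesgue)" for t
    have D_le: "norm (D t) \<le> ?K * L2_norm ?W \<theta>" if t: "t \<in> {0..1}" for t
    proof -
      let ?\<eta> = "\<lambda>x. \<theta> (x - t *\<^sub>R h)"
      have sub: "(+) (t *\<^sub>R h) ` ?W \<subseteq> U"
      proof clarify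
        fix x assume x: "x \<in> U" "x + h \<in> U"
        have "(1 - t) *\<^sub>R x + t *\<^sub>R (x + h) \<in> U"
          using convexD[OF conv x, of "1 - t" t] t by simp
        then show "t *\<^sub>R h + x \<in> U" by (simp add: algebra_simps)
      qed
      have \<eta>: "?\<eta> \<in> test_functions U"
        using test_functions_shift[OF \<theta>] test_functions_mono[OF sub] by blast
      have "dir_derivative h \<theta> (x - t *\<^sub>R h) = dir_derivative h ?\<eta> x" for x
        by (simp add: dir_derivative_def pderivative_shift)
      then have "- D t = (\<integral>x. f x * dir_derivative h ?\<eta> x \<partial>lebesgue)" by (simp add: D_def)
      also have "\<dots> = spair U f (dir_derivative h ?\<eta>)"
        using integral_lebesgue_on_subset[of U UNIV "\<lambda>x. f x * dir_derivative h ?\<eta> x"] f0 U.domain_sets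
        by (simp add: spair_def lebesgue_on_UNIV_eq)
      also have "\<dots> = (\<Sum>i\<in>UNIV. spair U f (\<lambda>x. of_real (h $ i) * pderivative i ?\<eta> x))"
        unfolding spair_def dir_derivative_def sum_distrib_left
        by (intro Bochner_Integration.integral_sum L2_integrable_mult L L2_cmult U.test_L2 test_functions_pderivative \<eta>)
      also have "\<dots> = (\<Sum>i\<in>UNIV. - of_real (h $ i) * spair U (\<lambda>x. G x $ i) ?\<eta>)"
        by (simp add: spair_cmult_right L(3)[OF \<eta>])
      finally have "norm (D t) = norm (\<Sum>i\<in>UNIV. - of_real (h $ i) * spair U (\<lambda>x. G x $ i) ?\<eta>)"
        by (metis norm_minus_cancel)
      \<comment> \<open>Each coordinate is estimated separately, which produces the factor
        \<open>CARD('n)\<close>.\<close>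
      also have "\<dots> \<le> (\<Sum>i\<in>(UNIV::'n set). norm h * (L2_norm U G * L2_norm U ?\<eta>))"
      proof (rule sum_norm_le)
        fix i :: 'n
        have "norm (spair U (\<lambda>x. G x $ i) ?\<eta>) \<le> L2_norm U (\<lambda>x. G x $ i) * L2_norm U ?\<eta>"
          by (intro spair_bound L2_component L U.test_L2 \<eta>)
        also have "\<dots> \<le> L2_norm U G * L2_norm U ?\<eta>"
          by (intro mult_right_mono L2_norm_component_le L L2_norm_nonneg)
        finally have "\<bar>h $ i\<bar> * norm (spair U (\<lambda>x. G x $ i) ?\<eta>) \<le> norm h * (L2_norm U G * L2_norm U ?\<eta>)"
          by (intro mult_mono component_le_norm_cart norm_ge_zero)
        then show "norm (- of_real (h $ i) * spair U (\<lambda>x. G x $ i) ?\<eta>) \<le> norm h * (L2_norm U G * L2_norm U ?\<eta>)"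
          by (simp add: norm_mult)
      qed
      also have "\<dots> = ?K * L2_norm U ?\<eta>" by simp
      also have "L2_norm U ?\<eta> = L2_norm UNIV ?\<eta>"
        by (rule L2_norm_eq_UNIV[OF U.domain_sets test_functions_eq_0[OF \<eta>]])
      also have "\<dots> = L2_norm UNIV \<theta>"
        by (rule L2_shift(2)[OF L2_UNIV[OF W.test_L2[OF \<theta>] W.domain_sets \<theta>0] \<theta>m])
      also have "\<dots> = L2_norm ?W \<theta>"
        by (rule L2_norm_eq_UNIV[OF W.domain_sets \<theta>0, symmetric])
      finally show ?thesis .
    qed
    have "spair ?W (\<lambda>x. f (x + h) - f x) \<theta> = spair ?W (\<lambda>x. f (x + h)) \<theta> - spair ?W f \<theta>"
      by (intro spair_diff_left fW W.test_L2 \<theta>)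
    also have "spair ?W f \<theta> = \<Phi> 0"
      using integral_lebesgue_on_subset[of ?W UNIV "\<lambda>x. f x * \<theta> x"] \<theta>0 W.domain_sets
      by (simp add: spair_def lebesgue_on_UNIV_eq \<Phi>_def)
    also have "spair ?W (\<lambda>x. f (x + h)) \<theta> = \<Phi> 1"
    proof -
      have "spair ?W (\<lambda>x. f (x + h)) \<theta> = (\<integral>x. f (x + h) * \<theta> x \<partial>lebesgue)"
        using integral_lebesgue_on_subset[of ?W UNIV "\<lambda>x. f (x + h) * \<theta> x"] \<theta>0 W.domain_sets
        by (simp add: spair_def lebesgue_on_UNIV_eq)
      also have "\<dots> = \<Phi> 1"
        using integral_lebesgue_shift[of "\<lambda>x. f (x + h) * \<theta> x" h] m \<theta>m by (simp add: \<Phi>_def)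
      finally show ?thesis .
    qed
    finally have "norm (spair ?W (\<lambda>x. f (x + h) - f x) \<theta>) = norm (\<Phi> 1 - \<Phi> 0)" by simp
    also have "\<dots> \<le> (?K * L2_norm ?W \<theta>) * norm (1 - 0 :: real)"
    proof (rule differentiable_bound[where S = "{0..1}" and f' = "\<lambda>t s. s *\<^sub>R D t"])
      show "(\<Phi> has_derivative (\<lambda>s. s *\<^sub>R D t)) (at t within {0..1})" for t
        using integral_shift_has_vector_derivative[OF f_int \<theta>, of h t]
        unfolding \<Phi>_def[symmetric] D_def[symmetric] has_vector_derivative_def
        by (rule has_derivative_at_withinI)
      show "onorm (\<lambda>s. s *\<^sub>R D t) \<le> ?K * L2_norm ?W \<theta>" if "t \<in> {0..1}" for t
      proof (rule onorm_le)
        fix s :: real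
        show "norm (s *\<^sub>R D t) \<le> ?K * L2_norm ?W \<theta> * norm s"
          using mult_left_mono[OF D_le[OF that], of "\<bar>s\<bar>"] by (simp add: mult.commute)
      qed
    qed auto
    finally show "norm (spair ?W (\<lambda>x. f (x + h) - f x) \<theta>) \<le> ?K * L2_norm ?W \<theta>" by simp
  qed
qed

text \<open>Supplies the Borel measurability for translations and for the exchange of integrals, and
  the extension by zero; neither affects the weak gradient on \<open>U\<close>.\<close>

lemma borel_representative:
  fixes f :: "real^'n \<Rightarrow> complex"
  assumes U: "open U" and f: "f \<in> borel_measurable (lebesgue_on U)"
  obtains g where "g \<in> borel_measurable borel" "\<And>x. x \<notin> U \<Longrightarrow> g x = 0" "AE x in lebesgue_on U. f x = g x"
proof -
  let ?f = "\<lambda>x. if x \<in> U then f x else 0"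
  have m: "?f \<in> borel_measurable lebesgue"
    using f U by (simp add: borel_measurable_if)
  have "(\<lambda>x. Re (?f x)) \<in> borel_measurable lebesgue" "(\<lambda>x. Im (?f x)) \<in> borel_measurable lebesgue"
    using m by (rule borel_measurable_Re[THEN measurable_compose[rotated]], use m in \<open>rule borel_measurable_Im[THEN measurable_compose[rotated]]\<close>)
  from this[THEN completion_ex_borel_measurable_real] obtain r s where
    rs: "r \<in> borel_measurable lborel" "AE x in lborel. Re (?f x) = r x"
      "s \<in> borel_measurable lborel" "AE x in lborel. Im (?f x) = s x" by blast
  have [measurable]: "r \<in> borel_measurable borel" "s \<in> borel_measurable borel" "U \<in> sets borel" using rs U by auto
  show thesis
  proof (rule that)
    show "(\<lambda>x. indicator U x *\<^sub>R (of_real (r x) + \<i> * of_real (s x))) \<in> borel_measurable borel"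
      by measurable
    have "AE x in lborel. x \<in> U \<longrightarrow> f x = indicator U x *\<^sub>R (of_real (r x) + \<i> * of_real (s x))"
      using rs(2,4) by eventually_elim (auto simp: complex_eq_iff)
    then have "AE x in lebesgue. x \<in> U \<longrightarrow> f x = indicator U x *\<^sub>R (of_real (r x) + \<i> * of_real (s x))"
      by (rule AE_completion)
    then show "AE x in lebesgue_on U. f x = indicator U x *\<^sub>R (of_real (r x) + \<i> * of_real (s x))"
      using U by (simp add: AE_restrict_space_iff)
  qed simp
qed

text \<open>Brings squared norms into the form to which Tonelli's theorem on \<open>lborel\<close>
  applies.\<close>

lemma ennreal_L2_norm_power2:
  fixes f :: "real^'n \<Rightarrow> 'b::euclidean_space"
  assumes f: "f \<in> L2 S" and S: "S \<in> sets lebesgue"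
  shows "(\<integral>\<^sup>+x. ennreal ((norm (f x))\<^sup>2) * indicator S x \<partial>lborel) = ennreal ((L2_norm S f)\<^sup>2)"
proof -
  have "(\<integral>\<^sup>+x. ennreal ((norm (f x))\<^sup>2) * indicator S x \<partial>lborel)
      = (\<integral>\<^sup>+x. ennreal ((norm (f x))\<^sup>2) * indicator S x \<partial>lebesgue)"
    by (simp add: nn_integral_completion)
  also have "\<dots> = (\<integral>\<^sup>+x. ennreal ((norm (f x))\<^sup>2) \<partial>lebesgue_on S)"
    using S by (subst nn_integral_restrict_space) auto
  also have "\<dots> = ennreal ((L2_norm S f)\<^sup>2)"
    using nn_integral_eq_integral[OF L2_integrable_norm2[OF f]] by (simp add: L2_norm_def)
  finally show ?thesis .
qed

text \<open>The translation estimate is integrated over all translations. The constant is a value of \<open>f\<close>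
  at a point where the resulting inner integral does not exceed its mean.\<close>

lemma Poincare_convex:
  fixes U :: "(real^'n) set"
  assumes U: "bounded_open U" and conv: "convex U" and ne: "U \<noteq> {}"
  shows "Poincare U"
proof -
  interpret U: bounded_open U by (rule U)
  have [measurable]: "U \<in> sets borel" using U.open_domain by simp
  obtain R where R: "\<And>x. x \<in> U \<Longrightarrow> norm x \<le> R" using U.bounded_domain unfolding bounded_iff by blast
  \<comment> \<open>A bound for the diameter: \<open>U\<close> and its translate by \<open>h\<close>
    are disjoint when \<open>norm h > d\<close>.\<close>
  define d where "d = 2 * R"
  have d: "norm h \<le> d" if "x \<in> U" "x + h \<in> U" for x h
    using R[OF that(1)] R[OF that(2)] norm_triangle_ineq4[of "x + h" x] by (simp add: d_def)
  obtain x0 where "x0 \<in> U" using ne by blast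
  with d[of x0 0] have d0: "0 \<le> d" by simp
  define m where "m = measure lebesgue U"
  have emU: "emeasure lborel U = ennreal m"
    using U.domain_lmeasurable emeasure_eq_measure2[of U lebesgue] unfolding m_def
    by (simp add: fmeasurable_def emeasure_eq_ennreal_measure)
  have m: "0 < m"
    using open_not_negligible[OF U.open_domain ne] negligible_iff_measure0[OF U.domain_lmeasurable]
    by (simp add: zero_less_measure_iff m_def)
  define v where "v = measure lebesgue (cball (0::real^'n) d)"
  have v: "0 \<le> v" "emeasure lborel (cball (0::real^'n) d) = ennreal v"
    using lmeasurable_cball[of "0::real^'n" d] unfolding v_def
    by (simp_all add: fmeasurable_def emeasure_eq_ennreal_measure)
  \<comment> \<open>\<open>K^2 * v\<close> bounds the double integral of \<open>q\<close>, so the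
    mean over \<open>U\<close> of the inner integral is at most \<open>K^2 * v / m\<close>; the root
    of this is \<open>C\<close> times the norm of \<open>G\<close>.\<close>
  define C where "C = real CARD('n) * d * sqrt (v / m)"
  have main: "\<exists>c. L2_norm U (\<lambda>x. f x - c) \<le> C * L2_norm U G"
    if fG: "has_weak_grad U f G" and [measurable]: "f \<in> borel_measurable borel" and f0: "\<And>x. x \<notin> U \<Longrightarrow> f x = 0" for f G
  proof -
    let ?N = "L2_norm U G"
    define K where "K = real CARD('n) * d * ?N"
    define q where "q x y = indicator U x * indicator U y * ennreal ((norm (f y - f x))\<^sup>2)" for x y
    have qm [measurable]: "case_prod q \<in> borel_measurable (lborel \<Otimes>\<^sub>M lborel)"
      unfolding q_def by measurable
    have qm2 [measurable]: "(\<lambda>(x, h). q x (x + h)) \<in> borel_measurable (lborel \<Otimes>\<^sub>M lborel)"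
      unfolding q_def by measurable
    \<comment> \<open>For a fixed translation this is the squared norm of the difference on the
      overlap, and 0 when the overlap is empty.\<close>
    have shift_le: "(\<integral>\<^sup>+x. q x (x + h) \<partial>lborel) \<le> ennreal (K\<^sup>2) * indicator (cball 0 d) h" for h
    proof (cases "norm h \<le> d")
      case True
      let ?W = "U \<inter> {x. x + h \<in> U}"
      note T = L2_norm_translation_difference_le[OF U conv fG that(2) f0, of h]
      have "open {x. x + h \<in> U}"
        using open_vimage[OF U.open_domain, of "\<lambda>x. x + h"] by (simp add: vimage_def continuous_intros)
      then have W: "?W \<in> sets lebesgue" using U.open_domain by auto
      have "(\<integral>\<^sup>+x. q x (x + h) \<partial>lborel) = (\<integral>\<^sup>+x. ennreal ((norm (f (x + h) - f x))\<^sup>2) * indicator ?W x \<partial>lborel)"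
        by (rule nn_integral_cong) (simp add: q_def indicator_def)
      also have "\<dots> = ennreal ((L2_norm ?W (\<lambda>x. f (x + h) - f x))\<^sup>2)"
        by (rule ennreal_L2_norm_power2[OF T(2) W])
      also have "\<dots> \<le> ennreal (K\<^sup>2)"
      proof (intro ennreal_leI power_mono L2_norm_nonneg order_trans[OF T(1)])
        show "real CARD('n) * norm h * ?N \<le> K"
          unfolding K_def using True by (intro mult_right_mono mult_left_mono) auto
      qed
      finally show ?thesis using True by simp
    next
      case False
      then have "q x (x + h) = 0" for x
        using d[of x h] by (auto simp: q_def indicator_def)
      then show ?thesis by simp
    qed
    define Q where "Q x = (\<integral>\<^sup>+y. q x y \<partial>lborel)" for x
    have Qm [measurable]: "Q \<in> borel_measurable lborel"
      unfolding Q_def by measurable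
    \<comment> \<open>The substitution \<open>y = x + h\<close> in the inner integral, followed by
      an exchange of the integrals, makes the translation estimate applicable for each
      \<open>h\<close>.\<close>
    have "(\<integral>\<^sup>+x. Q x \<partial>lborel) = (\<integral>\<^sup>+x. \<integral>\<^sup>+h. q x (x + h) \<partial>lborel \<partial>lborel)"
    proof (rule nn_integral_cong)
      fix x
      have [measurable]: "q x \<in> borel_measurable borel" unfolding q_def by measurable
      have "Q x = (\<integral>\<^sup>+y. q x y \<partial>distr lborel borel ((+) x))"
        unfolding Q_def lborel_distr_plus ..
      also have "\<dots> = (\<integral>\<^sup>+h. q x (x + h) \<partial>lborel)"
        by (subst nn_integral_distr) auto
      finally show "Q x = (\<integral>\<^sup>+h. q x (x + h) \<partial>lborel)" .
    qed
    also have "\<dots> = (\<integral>\<^sup>+h. \<integral>\<^sup>+x. q x (x + h) \<partial>lborel \<partial>lborel)"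
      by (rule lborel_pair.Fubini'[OF qm2, symmetric])
    also have "\<dots> \<le> (\<integral>\<^sup>+h. ennreal (K\<^sup>2) * indicator (cball (0::real^'n) d) h \<partial>lborel)"
      by (intro nn_integral_mono shift_le)
    also have "\<dots> = ennreal (K\<^sup>2 * v)"
      by (simp add: nn_integral_cmult_indicator v ennreal_mult)
    finally have Q_le: "(\<integral>\<^sup>+x. Q x \<partial>lborel) \<le> ennreal (K\<^sup>2 * v)" .
    define B where "B = K\<^sup>2 * v / m"
    have B: "0 \<le> B" unfolding B_def using v(1) m by simp
    \<comment> \<open>If \<open>Q\<close> exceeded \<open>B\<close> on all of \<open>U\<close>, then
      its integral would exceed \<open>B * m = K^2 * v\<close>, as \<open>U\<close> has positive
      measure.\<close>
    obtain x where x: "x \<in> U" "Q x \<le> ennreal B"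
    proof (rule ccontr)
      assume "\<not> thesis"
      with that have less: "\<And>x. x \<in> U \<Longrightarrow> ennreal B < Q x" by (meson not_less)
      have "(\<integral>\<^sup>+x. ennreal B * indicator U x \<partial>lborel) = ennreal (K\<^sup>2 * v)"
        using m B by (simp add: nn_integral_cmult_indicator emU ennreal_mult[symmetric] B_def)
      moreover have "(\<integral>\<^sup>+x. ennreal B * indicator U x \<partial>lborel) < (\<integral>\<^sup>+x. Q x \<partial>lborel)"
      proof (rule nn_integral_less)
        show "(\<integral>\<^sup>+x. ennreal B * indicator U x \<partial>lborel) \<noteq> \<infinity>" using calculation by simp
        show "AE x in lborel. ennreal B * indicator U x \<le> Q x"
          using less by (intro AE_I2) (auto simp: indicator_def less_imp_le)
        show "\<not> (AE x in lborel. Q x \<le> ennreal B * indicator U x)"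
        proof
          assume "AE x in lborel. Q x \<le> ennreal B * indicator U x"
          then have "AE x in lborel. x \<notin> U"
            by eventually_elim (use less in \<open>auto simp: indicator_def not_le[symmetric]\<close>)
          then have "emeasure lborel U = 0"
            by (subst (asm) AE_iff_measurable[of U]) auto
          with emU m show False by simp
        qed
      qed auto
      ultimately show False using Q_le by simp
    qed
    have fL: "(\<lambda>y. f y - f x) \<in> L2 U"
      by (intro L2_diff has_weak_gradD(1)[OF fG] L2_const U.domain_lmeasurable)
    have "ennreal ((L2_norm U (\<lambda>y. f y - f x))\<^sup>2) = (\<integral>\<^sup>+y. ennreal ((norm (f y - f x))\<^sup>2) * indicator U y \<partial>lborel)"
      by (rule ennreal_L2_norm_power2[OF fL U.domain_sets, symmetric])
    also have "\<dots> = Q x" using x(1) by (simp add: Q_def q_def mult.commute)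
    also have "\<dots> \<le> ennreal B" by (rule x(2))
    finally have "(L2_norm U (\<lambda>y. f y - f x))\<^sup>2 \<le> B" using B by (simp add: ennreal_le_iff)
    also have "B = (C * ?N)\<^sup>2"
      using v(1) m by (simp add: B_def C_def K_def power_mult_distrib)
    finally have "L2_norm U (\<lambda>y. f y - f x) \<le> C * ?N"
      by (rule power2_le_imp_le) (use d0 v(1) m in \<open>simp add: C_def\<close>)
    then show ?thesis by blast
  qed
  have "\<exists>c. L2_norm U (\<lambda>x. f x - c) \<le> C * L2_norm U G" if fG: "has_weak_grad U f G" for f G
  proof -
    obtain g where g: "g \<in> borel_measurable borel" "\<And>x. x \<notin> U \<Longrightarrow> g x = 0" "AE x in lebesgue_on U. f x = g x"
      using borel_representative[OF U.open_domain L2_measurable[OF has_weak_gradD(1)[OF fG]]] by blast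
    have gG: "has_weak_grad U g G" by (rule U.has_weak_grad_cong[OF fG g(3)]) simp
    from main[OF this g(1,2)] obtain c where c: "L2_norm U (\<lambda>x. g x - c) \<le> C * L2_norm U G" by blast
    have "L2_norm U (\<lambda>x. f x - c) = L2_norm U (\<lambda>x. g x - c)"
    proof (rule L2_norm_cong_AE)
      show "AE x in lebesgue_on U. f x - c = g x - c" using g(3) by eventually_elim simp
    qed (intro L2_diff L2_const U.domain_lmeasurable has_weak_gradD(1)[OF fG] has_weak_gradD(1)[OF gG])+
    with c have "L2_norm U (\<lambda>x. f x - c) \<le> C * L2_norm U G" by simp
    then show ?thesis by blast
  qed
  moreover have "0 \<le> C" using d0 v(1) m by (simp add: C_def)
  ultimately show ?thesis unfolding Poincare_def by blast
qed

lemma polyhedral_domain_Poincare: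
  assumes "polyhedral_domain \<Omega>"
  shows "Poincare \<Omega>"
proof -
  interpret bounded_open \<Omega> by (rule polyhedral_domain_bounded_open[OF assms])
  obtain \<C> where \<C>: "finite \<C>" "\<And>U. U \<in> \<C> \<Longrightarrow> open U \<and> convex U \<and> U \<noteq> {}" "\<Union>\<C> = \<Omega>"
    by (rule polyhedral_domain_convex_cover[OF assms], rule that, assumption, blast, assumption)
  have "bounded_open U" if "U \<in> \<C>" for U
    using \<C>(2)[OF that] \<C>(3) that bounded_domain by (intro bounded_open.intro) (auto intro: bounded_subset)
  then have "bounded_open U \<and> U \<noteq> {} \<and> Poincare U" if "U \<in> \<C>" for U
    using \<C>(2)[OF that] that by (simp add: Poincare_convex)
  moreover have "\<C> \<noteq> {}" "connected (\<Union>\<C>)"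
    using assms \<C>(3) unfolding polyhedral_domain_def by auto
  ultimately have "Poincare (\<Union>\<C>)"
    using \<C>(1) by (intro Poincare_Union)
  then show ?thesis by (simp add: \<C>(3))
qed

section \<open>Functions of mean zero on a Poincare domain\<close>

locale Poincare_domain = bounded_open \<Omega> for \<Omega> :: "(real^'n) set" +
  assumes Poincare_domain: "Poincare \<Omega>" and domain_nonempty: "\<Omega> \<noteq> {}"
begin

lemma H1_mean0_D:
  assumes "s \<in> H1_mean0 \<Omega>"
  shows "has_weak_grad \<Omega> s (weak_grad \<Omega> s)" "s \<in> L2 \<Omega>" "weak_grad \<Omega> s \<in> L2 \<Omega>" "spair \<Omega> s (\<lambda>x. 1) = 0"
proof -
  show *: "has_weak_grad \<Omega> s (weak_grad \<Omega> s)" using assms has_weak_grad_weak_grad by (auto simp: H1_mean0_def)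
  then show "s \<in> L2 \<Omega>" "weak_grad \<Omega> s \<in> L2 \<Omega>" by (rule has_weak_gradD)+
  show "spair \<Omega> s (\<lambda>x. 1) = 0" using assms by (simp add: H1_mean0_def L2_mean0_def)
qed

lemma H1_mean0_I: "has_weak_grad \<Omega> s G \<Longrightarrow> spair \<Omega> s (\<lambda>x. 1) = 0 \<Longrightarrow> s \<in> H1_mean0 \<Omega>"
  by (auto simp: H1_mean0_def H1_def L2_mean0_def has_weak_grad_def)

lemma one_L2: "(\<lambda>x. c) \<in> L2 \<Omega>" for c :: complex
  by (rule L2_const[OF domain_lmeasurable])

lemma H1_mean0_add: "s \<in> H1_mean0 \<Omega> \<Longrightarrow> t \<in> H1_mean0 \<Omega> \<Longrightarrow> (\<lambda>x. s x + t x) \<in> H1_mean0 \<Omega>"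
  by (rule H1_mean0_I[OF has_weak_grad_add[OF H1_mean0_D(1) H1_mean0_D(1)]])
     (simp_all add: spair_add_left H1_mean0_D one_L2)

lemma H1_mean0_cmult: "s \<in> H1_mean0 \<Omega> \<Longrightarrow> (\<lambda>x. c * s x) \<in> H1_mean0 \<Omega>"
  by (rule H1_mean0_I[OF has_weak_grad_cmult[OF H1_mean0_D(1)]])
     (simp_all add: spair_cmult_left H1_mean0_D)

lemma weak_grad_add_AE:
  "s \<in> H1_mean0 \<Omega> \<Longrightarrow> t \<in> H1_mean0 \<Omega> \<Longrightarrow>
    AE x in lebesgue_on \<Omega>. weak_grad \<Omega> (\<lambda>x. s x + t x) x = weak_grad \<Omega> s x + weak_grad \<Omega> t x"
  by (rule weak_grad_eq_AE[OF has_weak_grad_add[OF H1_mean0_D(1) H1_mean0_D(1)]])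

lemma weak_grad_cmult_AE:
  "s \<in> H1_mean0 \<Omega> \<Longrightarrow> AE x in lebesgue_on \<Omega>. weak_grad \<Omega> (\<lambda>x. c * s x) x = c *s weak_grad \<Omega> s x"
  by (rule weak_grad_eq_AE[OF has_weak_grad_cmult[OF H1_mean0_D(1)]])

text \<open>A function of mean zero is orthogonal to the constants, so its norm is at most its
  distance to any constant.\<close>

lemma H1_mean0_Poincare:
  "\<exists>C\<ge>0. \<forall>s\<in>H1_mean0 \<Omega>. L2_norm \<Omega> s \<le> C * L2_norm \<Omega> (weak_grad \<Omega> s)"
proof -
  obtain C where C: "0 \<le> C" "\<And>f G. has_weak_grad \<Omega> f G \<Longrightarrow> \<exists>c. L2_norm \<Omega> (\<lambda>x. f x - c) \<le> C * L2_norm \<Omega> G"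
    using Poincare_domain unfolding Poincare_def by blast
  have "L2_norm \<Omega> s \<le> C * L2_norm \<Omega> (weak_grad \<Omega> s)" if s: "s \<in> H1_mean0 \<Omega>" for s
  proof -
    note D = H1_mean0_D[OF s]
    obtain c where c: "L2_norm \<Omega> (\<lambda>x. s x - c) \<le> C * L2_norm \<Omega> (weak_grad \<Omega> s)" using C(2)[OF D(1)] by blast
    have "L2_inner \<Omega> s (\<lambda>x. c) = Re (spair \<Omega> s (\<lambda>x. cnj c * 1))"
      by (subst Re_spair[OF D(2)]) (simp_all add: one_L2)
    also have "\<dots> = 0" unfolding spair_cmult_right by (simp add: D(4))
    finally have "(L2_norm \<Omega> s)\<^sup>2 = L2_inner \<Omega> (\<lambda>x. s x - c) s"
      by (simp add: L2_norm_power2 L2_inner_diff_left D one_L2 L2_inner_commute[of \<Omega> "\<lambda>x. c" s])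
    also have "\<dots> \<le> L2_norm \<Omega> (\<lambda>x. s x - c) * L2_norm \<Omega> s"
      using L2_Cauchy_Schwarz[OF L2_diff[OF D(2) one_L2] D(2), of c] by simp
    finally have "L2_norm \<Omega> s * L2_norm \<Omega> s \<le> L2_norm \<Omega> (\<lambda>x. s x - c) * L2_norm \<Omega> s"
      by (simp add: power2_eq_square)
    then have "L2_norm \<Omega> s \<le> L2_norm \<Omega> (\<lambda>x. s x - c)"
      using L2_norm_nonneg[of \<Omega> s] L2_norm_nonneg[of \<Omega> "\<lambda>x. s x - c"]
      by (cases "L2_norm \<Omega> s = 0") (auto dest: mult_right_le_imp_le)
    with c show ?thesis by linarith
  qed
  with C(1) show ?thesis by blast
qed

lemma H1_mean0_Riesz:
  assumes add: "\<And>s t. s \<in> H1_mean0 \<Omega> \<Longrightarrow> t \<in> H1_mean0 \<Omega> \<Longrightarrow> F (\<lambda>x. s x + t x) = F s + F t"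
    and scale: "\<And>c s. s \<in> H1_mean0 \<Omega> \<Longrightarrow> F (\<lambda>x. of_real c * s x) = c * F s"
    and bound: "\<And>s. s \<in> H1_mean0 \<Omega> \<Longrightarrow> \<bar>F s\<bar> \<le> M * L2_norm \<Omega> (weak_grad \<Omega> s)"
  shows "\<exists>q\<in>H1_mean0 \<Omega>. \<forall>s\<in>H1_mean0 \<Omega>. L2_inner \<Omega> (weak_grad \<Omega> q) (weak_grad \<Omega> s) = F s"
proof -
  let ?H = "H1_mean0 \<Omega>" and ?g = "weak_grad \<Omega>"
  note D = H1_mean0_D
  obtain C where C: "0 \<le> C" "\<And>s. s \<in> ?H \<Longrightarrow> L2_norm \<Omega> s \<le> C * L2_norm \<Omega> (?g s)"
    using H1_mean0_Poincare by blast
  have diff: "(\<lambda>x. s x + of_real (-1) * t x) \<in> ?H"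
    "AE x in lebesgue_on \<Omega>. ?g (\<lambda>x. s x + of_real (-1) * t x) x = ?g s x - ?g t x" if "s \<in> ?H" "t \<in> ?H" for s t
  proof -
    show "(\<lambda>x. s x + of_real (-1) * t x) \<in> ?H" by (intro H1_mean0_add H1_mean0_cmult that)
    show "AE x in lebesgue_on \<Omega>. ?g (\<lambda>x. s x + of_real (-1) * t x) x = ?g s x - ?g t x"
      using weak_grad_eq_AE[OF has_weak_grad_diff[OF D(1)[OF that(1)] D(1)[OF that(2)]]] by simp
  qed
  have norm_diff: "L2_norm \<Omega> (?g (\<lambda>x. s x + of_real (-1) * t x)) = L2_norm \<Omega> (\<lambda>x. ?g s x - ?g t x)" if "s \<in> ?H" "t \<in> ?H" for s t
    by (intro L2_norm_cong_AE diff that D L2_diff)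
  show ?thesis
  proof (rule Riesz_representation[where add = "\<lambda>f g x. f x + g x" and smul = "\<lambda>c f x. of_real c * f x" and C = M])
    show "?H \<noteq> {}" using H1_mean0_I[OF has_weak_grad_const[of 0]] by (auto simp: spair_def)
    show "L2_inner \<Omega> (?g (\<lambda>x. s x + t x)) (?g r) = L2_inner \<Omega> (?g s) (?g r) + L2_inner \<Omega> (?g t) (?g r)"
      if "s \<in> ?H" "t \<in> ?H" "r \<in> ?H" for s t r
      using that L2_inner_cong_AE[OF D(3)[OF H1_mean0_add] _ weak_grad_add_AE D(3), of s t r]
      by (simp add: L2_add D L2_inner_add_left)
    show "L2_inner \<Omega> (?g (\<lambda>x. of_real c * s x)) (?g r) = c * L2_inner \<Omega> (?g s) (?g r)"
      if "s \<in> ?H" "r \<in> ?H" for c s r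
    proof -
      have "complex_of_real c *s z = c *\<^sub>R z" for z :: "complex^'n"
        unfolding vec_eq_iff vector_scaleR_component vector_smult_component by (simp add: scaleR_conv_of_real)
      then have "AE x in lebesgue_on \<Omega>. ?g (\<lambda>x. of_real c * s x) x = c *\<^sub>R ?g s x"
        using weak_grad_cmult_AE[OF that(1), of "of_real c"] by simp
      then have "L2_inner \<Omega> (?g (\<lambda>x. of_real c * s x)) (?g r) = L2_inner \<Omega> (\<lambda>x. c *\<^sub>R ?g s x) (?g r)"
        by (intro L2_inner_cong_AE D H1_mean0_cmult L2_scaleR that)
      then show ?thesis by (simp add: L2_inner_scaleR_left)
    qed
    show "\<bar>F s\<bar> \<le> M * sqrt (L2_inner \<Omega> (?g s) (?g s))" if "s \<in> ?H" for s
      using bound[OF that] by (simp add: sqrt_L2_inner_self)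
    fix s :: "nat \<Rightarrow> _" assume s: "\<And>n. s n \<in> ?H" and Cau: "\<And>e. 0 < e \<Longrightarrow> \<exists>N. \<forall>m\<ge>N. \<forall>n\<ge>N.
        sqrt (L2_inner \<Omega> (?g (\<lambda>x. s m x + of_real (-1) * s n x)) (?g (\<lambda>x. s m x + of_real (-1) * s n x))) < e"
    have Cg: "\<exists>N. \<forall>m\<ge>N. \<forall>n\<ge>N. L2_norm \<Omega> (\<lambda>x. ?g (s m) x - ?g (s n) x) < e" if "0 < e" for e
      using Cau[OF that] unfolding sqrt_L2_inner_self norm_diff[OF s s] .
    have Cs: "\<exists>N. \<forall>m\<ge>N. \<forall>n\<ge>N. L2_norm \<Omega> (\<lambda>x. s m x - s n x) < e" if "0 < e" for e
    proof -
      have "0 < e / (C + 1)" using that C(1) by simp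
      from Cg[OF this] obtain N where N: "\<And>m n. N \<le> m \<Longrightarrow> N \<le> n \<Longrightarrow> L2_norm \<Omega> (\<lambda>x. ?g (s m) x - ?g (s n) x) < e / (C + 1)" by blast
      have "L2_norm \<Omega> (\<lambda>x. s m x - s n x) < e" if mn: "N \<le> m" "N \<le> n" for m n
      proof -
        have "L2_norm \<Omega> (\<lambda>x. s m x - s n x) \<le> C * L2_norm \<Omega> (\<lambda>x. ?g (s m) x - ?g (s n) x)"
          using C(2)[OF diff(1)[OF s s], of m n] unfolding norm_diff[OF s s] by simp
        also have "\<dots> \<le> (C + 1) * L2_norm \<Omega> (\<lambda>x. ?g (s m) x - ?g (s n) x)" by (intro mult_right_mono) auto
        also have "\<dots> < e" using N[OF mn] C(1) by (simp add: pos_less_divide_eq mult.commute)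
        finally show ?thesis .
      qed
      then show ?thesis by blast
    qed
    obtain q where q: "q \<in> L2 \<Omega>" "(\<lambda>n. L2_norm \<Omega> (\<lambda>x. s n x - q x)) \<longlonglongrightarrow> 0"
      using L2_Cauchy_limit[of \<Omega> s, OF domain_lmeasurable D(2)[OF s] Cs] by blast
    obtain G where G: "G \<in> L2 \<Omega>" "(\<lambda>n. L2_norm \<Omega> (\<lambda>x. ?g (s n) x - G x)) \<longlonglongrightarrow> 0"
      using L2_Cauchy_limit[of \<Omega> "\<lambda>n. ?g (s n)", OF domain_lmeasurable D(3)[OF s] Cg] by blast
    have qG: "has_weak_grad \<Omega> q G" by (rule has_weak_grad_limit[OF D(1)[OF s] q(1) G(1) q(2) G(2)])
    have "(\<lambda>n. spair \<Omega> q (\<lambda>x. 1)) \<longlonglongrightarrow> 0"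
    proof (rule Lim_null_comparison)
      have "norm (spair \<Omega> q (\<lambda>x. 1)) \<le> L2_norm \<Omega> (\<lambda>x. s n x - q x) * L2_norm \<Omega> (\<lambda>x. 1::complex)" for n
        using spair_bound[OF L2_diff[OF D(2)[OF s[of n]] q(1)] one_L2[of 1]]
        by (simp add: spair_diff_left D(2,4)[OF s] q one_L2)
      then show "\<forall>\<^sub>F n in sequentially. norm (spair \<Omega> q (\<lambda>x. 1)) \<le> L2_norm \<Omega> (\<lambda>x. s n x - q x) * L2_norm \<Omega> (\<lambda>x. 1::complex)"
        by simp
      show "(\<lambda>n. L2_norm \<Omega> (\<lambda>x. s n x - q x) * L2_norm \<Omega> (\<lambda>x. 1::complex)) \<longlonglongrightarrow> 0"
        using tendsto_mult_right[OF q(2), of "L2_norm \<Omega> (\<lambda>x. 1::complex)"] by simp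
    qed
    then have "spair \<Omega> q (\<lambda>x. 1) = 0" by (simp add: LIMSEQ_const_iff)
    with qG have qH: "q \<in> ?H" by (rule H1_mean0_I)
    have "L2_norm \<Omega> (\<lambda>x. ?g (s n) x - ?g q x) = L2_norm \<Omega> (\<lambda>x. ?g (s n) x - G x)" for n
    proof (rule L2_norm_cong_AE)
      show "AE x in lebesgue_on \<Omega>. ?g (s n) x - ?g q x = ?g (s n) x - G x"
        using weak_grad_eq_AE[OF qG] by eventually_elim simp
    qed (intro L2_diff D s qH G)+
    with G(2) have "(\<lambda>n. L2_norm \<Omega> (?g (\<lambda>x. s n x + of_real (-1) * q x))) \<longlonglongrightarrow> 0"
      by (simp only: norm_diff[OF s qH])
    with qH show "\<exists>q\<in>?H. (\<lambda>n. sqrt (L2_inner \<Omega> (?g (\<lambda>x. s n x + of_real (-1) * q x)) (?g (\<lambda>x. s n x + of_real (-1) * q x)))) \<longlonglongrightarrow> 0"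
      unfolding sqrt_L2_inner_self by blast
  next
    show "L2_inner \<Omega> (?g s) (?g t) = L2_inner \<Omega> (?g t) (?g s)" for s t by (rule L2_inner_commute)
  qed (use add scale in \<open>simp_all add: H1_mean0_add H1_mean0_cmult\<close>)
qed

end

section \<open>Divergences and gradients\<close>

context Poincare_domain
begin

lemma measure_domain_pos: "0 < measure lebesgue \<Omega>"
  using open_not_negligible[OF open_domain domain_nonempty] negligible_iff_measure0[OF domain_lmeasurable]
  by (simp add: zero_less_measure_iff)

lemma spair_const_one: "spair \<Omega> (\<lambda>x. c) (\<lambda>x. 1) = c * of_real (measure lebesgue \<Omega>)"
proof -
  have "measure (lebesgue_on \<Omega>) \<Omega> = measure lebesgue \<Omega>"
    using domain_lmeasurable by (subst measure_restrict_space) auto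
  then show ?thesis by (simp add: spair_def scaleR_conv_of_real)
qed

lemma H1_D:
  assumes "s \<in> H1 \<Omega>"
  shows "has_weak_grad \<Omega> s (weak_grad \<Omega> s)" "s \<in> L2 \<Omega>" "weak_grad \<Omega> s \<in> L2 \<Omega>"
  using has_weak_grad_weak_grad[OF assms] by (auto dest: has_weak_gradD)

lemma H0div_D:
  assumes "\<tau> \<in> H0div \<Omega>"
  shows "has_weak_div \<Omega> \<tau> (weak_div \<Omega> \<tau>)" "\<tau> \<in> L2 \<Omega>" "weak_div \<Omega> \<tau> \<in> L2 \<Omega>"
    "s \<in> H1 \<Omega> \<Longrightarrow> vpair \<Omega> \<tau> (weak_grad \<Omega> s) = - spair \<Omega> (weak_div \<Omega> \<tau>) s"
proof -
  show *: "has_weak_div \<Omega> \<tau> (weak_div \<Omega> \<tau>)"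
    using assms has_weak_div_weak_div by (auto simp: H0div_def)
  then show "\<tau> \<in> L2 \<Omega>" "weak_div \<Omega> \<tau> \<in> L2 \<Omega>" by (rule has_weak_divD)+
  show "vpair \<Omega> \<tau> (weak_grad \<Omega> s) = - spair \<Omega> (weak_div \<Omega> \<tau>) s" if "s \<in> H1 \<Omega>"
    using assms that by (simp add: H0div_def normal_trace_def eq_neg_iff_add_eq_0)
qed

text \<open>Green's formula against the constant function 1, whose gradient vanishes almost
  everywhere.\<close>

lemma weak_div_mean0:
  assumes "\<tau> \<in> H0div \<Omega>"
  shows "weak_div \<Omega> \<tau> \<in> L2_mean0 \<Omega>"
proof -
  have one: "(\<lambda>x. 1) \<in> H1 \<Omega>" using has_weak_grad_const[of 1] by (auto simp: H1_def)
  have "vpair \<Omega> (weak_grad \<Omega> (\<lambda>x. 1)) \<tau> = vpair \<Omega> (\<lambda>x. 0) \<tau>"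
    by (rule vpair_cong_AE[OF H1_D(3)[OF one] L2_zero weak_grad_eq_AE[OF has_weak_grad_const] H0div_D(2)[OF assms]])
  then have "spair \<Omega> (weak_div \<Omega> \<tau>) (\<lambda>x. 1) = 0"
    using H0div_D(4)[OF assms one] by (simp add: vpair_commute[of \<Omega> \<tau>]) (simp add: vpair_def)
  then show ?thesis using H0div_D(3)[OF assms] by (simp add: L2_mean0_def)
qed

text \<open>What the Riesz theorem delivers is enough. Testing with \<open>\<i> * s\<close> adds the
  imaginary part, and subtracting the mean of \<open>s\<close> changes neither its gradient nor its
  pairing with \<open>g\<close>. Test functions then identify the divergence, and general
  \<open>s\<close> in \<open>H1 \<Omega>\<close> give the zero normal trace.\<close>

lemma H0div_I:
  assumes \<tau>: "\<tau> \<in> L2 \<Omega>" and g: "g \<in> L2_mean0 \<Omega>"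
    and eq: "\<And>s. s \<in> H1_mean0 \<Omega> \<Longrightarrow> Re (vpair \<Omega> \<tau> (weak_grad \<Omega> s)) = - Re (spair \<Omega> g s)"
  shows "\<tau> \<in> H0div \<Omega>" "has_weak_div \<Omega> \<tau> g"
proof -
  have gL: "g \<in> L2 \<Omega>" "spair \<Omega> g (\<lambda>x. 1) = 0" using g by (auto simp: L2_mean0_def)
  have eq0: "vpair \<Omega> \<tau> (weak_grad \<Omega> s) = - spair \<Omega> g s" if s: "s \<in> H1_mean0 \<Omega>" for s
  proof -
    have "vpair \<Omega> \<tau> (weak_grad \<Omega> (\<lambda>x. \<i> * s x)) = vpair \<Omega> \<tau> (\<lambda>x. \<i> *s weak_grad \<Omega> s x)"
      by (intro vpair_cong_AE_right weak_grad_cmult_AE H1_mean0_D H1_mean0_cmult L2_vcmult \<tau> s)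
    then show ?thesis
      using eq[OF s] eq[OF H1_mean0_cmult[OF s, of \<i>]]
      by (simp add: vpair_cmult_right spair_cmult_right complex_eq_iff)
  qed
  have eq1: "vpair \<Omega> \<tau> (weak_grad \<Omega> s) = - spair \<Omega> g s" if s: "s \<in> H1 \<Omega>" for s
  proof -
    define m where "m = spair \<Omega> s (\<lambda>x. 1) / of_real (measure lebesgue \<Omega>)"
    have wg: "has_weak_grad \<Omega> (\<lambda>x. s x - m) (weak_grad \<Omega> s)"
      using has_weak_grad_diff[OF H1_D(1)[OF s] has_weak_grad_const[of m]] by simp
    have "spair \<Omega> (\<lambda>x. s x - m) (\<lambda>x. 1) = 0"
      using measure_domain_pos by (simp add: spair_diff_left H1_D s one_L2 spair_const_one m_def)
    with wg have mem: "(\<lambda>x. s x - m) \<in> H1_mean0 \<Omega>" by (rule H1_mean0_I)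
    have "vpair \<Omega> \<tau> (weak_grad \<Omega> s) = vpair \<Omega> \<tau> (weak_grad \<Omega> (\<lambda>x. s x - m))"
      by (intro vpair_cong_AE_right[symmetric] weak_grad_eq_AE wg H1_mean0_D mem H1_D s \<tau>)
    also have "\<dots> = - spair \<Omega> g (\<lambda>x. s x - m)" by (rule eq0[OF mem])
    also have "\<dots> = - (spair \<Omega> g s - spair \<Omega> g (\<lambda>x. m * 1))"
      by (simp add: spair_diff_right H1_D s one_L2 gL)
    also have "spair \<Omega> g (\<lambda>x. m * 1) = 0" unfolding spair_cmult_right gL(2) by simp
    finally show ?thesis by simp
  qed
  show div: "has_weak_div \<Omega> \<tau> g"
    unfolding has_weak_div_def
  proof (intro conjI ballI \<tau> gL)
    fix \<theta> assume \<theta>: "\<theta> \<in> test_functions \<Omega>"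
    have H1: "\<theta> \<in> H1 \<Omega>" using has_weak_grad_test[OF \<theta>] by (auto simp: H1_def)
    have "vpair \<Omega> \<tau> (weak_grad \<Omega> \<theta>) = vpair \<Omega> \<tau> (\<lambda>x. \<chi> i. pderivative i \<theta> x)"
      by (intro vpair_cong_AE_right weak_grad_eq_AE has_weak_grad_test \<theta> H1_D H1 test_gradient_L2 \<tau>)
    with eq1[OF H1] show "vpair \<Omega> \<tau> (\<lambda>x. \<chi> i. pderivative i \<theta> x) = - spair \<Omega> g \<theta>" by simp
  qed
  have "weak_div \<Omega> \<tau> \<in> L2 \<Omega>"
    using div has_weak_divD(2)[OF has_weak_div_weak_div[of \<tau> \<Omega>]] by (auto simp: Hdiv_def)
  then have "spair \<Omega> (weak_div \<Omega> \<tau>) s = spair \<Omega> g s" if "s \<in> H1 \<Omega>" for s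
    by (rule spair_cong_AE[OF _ gL(1) weak_div_eq_AE[OF div] H1_D(2)[OF that]])
  then show "\<tau> \<in> H0div \<Omega>"
    using div eq1 by (auto simp: H0div_def Hdiv_def normal_trace_def)
qed

lemma Re_vpair_cnj:
  fixes F G :: "real^'n \<Rightarrow> complex^'n"
  assumes "F \<in> L2 \<Omega>" "G \<in> L2 \<Omega>"
  shows "Re (vpair \<Omega> (\<lambda>x. \<chi> i. cnj (F x $ i)) G) = L2_inner \<Omega> F G"
  using Re_vpair[OF L2_vcnj[OF assms(1)] assms(2)] by simp

text \<open>The solution is the conjugated gradient of the solution of a Neumann problem.\<close>

lemma weak_div_surjective:
  assumes \<psi>: "\<psi> \<in> L2_mean0 \<Omega>"
  shows "\<exists>v\<in>H0div \<Omega>. has_weak_div \<Omega> v \<psi>"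
proof -
  have \<psi>L: "\<psi> \<in> L2 \<Omega>" using \<psi> by (simp add: L2_mean0_def)
  obtain C where C: "0 \<le> C" "\<And>s. s \<in> H1_mean0 \<Omega> \<Longrightarrow> L2_norm \<Omega> s \<le> C * L2_norm \<Omega> (weak_grad \<Omega> s)"
    using H1_mean0_Poincare by blast
  have "\<exists>q\<in>H1_mean0 \<Omega>. \<forall>s\<in>H1_mean0 \<Omega>. L2_inner \<Omega> (weak_grad \<Omega> q) (weak_grad \<Omega> s) = - Re (spair \<Omega> \<psi> s)"
  proof (rule H1_mean0_Riesz)
    show "- Re (spair \<Omega> \<psi> (\<lambda>x. s x + t x)) = - Re (spair \<Omega> \<psi> s) + - Re (spair \<Omega> \<psi> t)"
      if "s \<in> H1_mean0 \<Omega>" "t \<in> H1_mean0 \<Omega>" for s t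
      by (simp add: spair_add_right H1_mean0_D that \<psi>L)
    show "- Re (spair \<Omega> \<psi> (\<lambda>x. of_real c * s x)) = c * - Re (spair \<Omega> \<psi> s)" for c s
      by (simp add: spair_cmult_right)
    show "\<bar>- Re (spair \<Omega> \<psi> s)\<bar> \<le> (L2_norm \<Omega> \<psi> * C) * L2_norm \<Omega> (weak_grad \<Omega> s)" if s: "s \<in> H1_mean0 \<Omega>" for s
    proof -
      have "\<bar>- Re (spair \<Omega> \<psi> s)\<bar> \<le> norm (spair \<Omega> \<psi> s)" using abs_Re_le_cmod by simp
      also have "\<dots> \<le> L2_norm \<Omega> \<psi> * L2_norm \<Omega> s" by (rule spair_bound[OF \<psi>L H1_mean0_D(2)[OF s]])
      also have "\<dots> \<le> L2_norm \<Omega> \<psi> * (C * L2_norm \<Omega> (weak_grad \<Omega> s))"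
        by (intro mult_left_mono C s L2_norm_nonneg)
      finally show ?thesis by (simp add: mult.assoc)
    qed
  qed
  then obtain q where q: "q \<in> H1_mean0 \<Omega>"
    "\<And>s. s \<in> H1_mean0 \<Omega> \<Longrightarrow> L2_inner \<Omega> (weak_grad \<Omega> q) (weak_grad \<Omega> s) = - Re (spair \<Omega> \<psi> s)" by blast
  let ?v = "\<lambda>x. \<chi> i. cnj (weak_grad \<Omega> q x $ i)"
  have vL: "?v \<in> L2 \<Omega>" by (intro L2_vcnj H1_mean0_D q)
  have "Re (vpair \<Omega> ?v (weak_grad \<Omega> s)) = - Re (spair \<Omega> \<psi> s)" if "s \<in> H1_mean0 \<Omega>" for s
    using q(2)[OF that] Re_vpair_cnj[OF H1_mean0_D(3)[OF q(1)] H1_mean0_D(3)[OF that]] by simp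
  from H0div_I[OF vL \<psi> this] show ?thesis by blast
qed

text \<open>Split \<open>g\<close> into its orthogonal projection onto the gradients and a remainder
  \<open>h\<close>. The conjugate of \<open>h\<close> is divergence-free with zero normal trace, so
  it is an admissible \<open>v\<close>; hence \<open>h\<close> is orthogonal to \<open>g\<close>, to
  the projection, and so to itself.\<close>

lemma gradient_if_orthogonal_to_div_free:
  assumes g: "g \<in> L2 \<Omega>"
    and orth: "\<And>v. v \<in> H0div \<Omega> \<Longrightarrow> has_weak_div \<Omega> v (\<lambda>x. 0) \<Longrightarrow> vpair \<Omega> g v = 0"
  shows "\<exists>r\<in>H1_mean0 \<Omega>. AE x in lebesgue_on \<Omega>. weak_grad \<Omega> r x = g x"
proof -
  have "\<exists>r\<in>H1_mean0 \<Omega>. \<forall>s\<in>H1_mean0 \<Omega>. L2_inner \<Omega> (weak_grad \<Omega> r) (weak_grad \<Omega> s) = L2_inner \<Omega> g (weak_grad \<Omega> s)"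
  proof (rule H1_mean0_Riesz)
    show "L2_inner \<Omega> g (weak_grad \<Omega> (\<lambda>x. s x + t x)) = L2_inner \<Omega> g (weak_grad \<Omega> s) + L2_inner \<Omega> g (weak_grad \<Omega> t)"
      if st: "s \<in> H1_mean0 \<Omega>" "t \<in> H1_mean0 \<Omega>" for s t
    proof -
      have "L2_inner \<Omega> (weak_grad \<Omega> (\<lambda>x. s x + t x)) g = L2_inner \<Omega> (\<lambda>x. weak_grad \<Omega> s x + weak_grad \<Omega> t x) g"
        by (intro L2_inner_cong_AE weak_grad_add_AE H1_mean0_D H1_mean0_add L2_add st g)
      then show ?thesis
        by (simp only: L2_inner_commute[of \<Omega> g] L2_inner_add_left H1_mean0_D st g)
    qed
    show "L2_inner \<Omega> g (weak_grad \<Omega> (\<lambda>x. of_real c * s x)) = c * L2_inner \<Omega> g (weak_grad \<Omega> s)"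
      if s: "s \<in> H1_mean0 \<Omega>" for c s
    proof -
      have "complex_of_real c *s z = c *\<^sub>R z" for z :: "complex^'n"
        unfolding vec_eq_iff vector_scaleR_component vector_smult_component by (simp add: scaleR_conv_of_real)
      then have "AE x in lebesgue_on \<Omega>. weak_grad \<Omega> (\<lambda>x. of_real c * s x) x = c *\<^sub>R weak_grad \<Omega> s x"
        using weak_grad_cmult_AE[OF s, of "of_real c"] by simp
      then have "L2_inner \<Omega> (weak_grad \<Omega> (\<lambda>x. of_real c * s x)) g = L2_inner \<Omega> (\<lambda>x. c *\<^sub>R weak_grad \<Omega> s x) g"
        by (intro L2_inner_cong_AE H1_mean0_D H1_mean0_cmult L2_scaleR s g)
      then show ?thesis by (simp only: L2_inner_commute[of \<Omega> g] L2_inner_scaleR_left)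
    qed
    show "\<bar>L2_inner \<Omega> g (weak_grad \<Omega> s)\<bar> \<le> L2_norm \<Omega> g * L2_norm \<Omega> (weak_grad \<Omega> s)" if "s \<in> H1_mean0 \<Omega>" for s
      by (intro L2_Cauchy_Schwarz g H1_mean0_D that)
  qed
  then obtain r where r: "r \<in> H1_mean0 \<Omega>"
    "\<And>s. s \<in> H1_mean0 \<Omega> \<Longrightarrow> L2_inner \<Omega> (weak_grad \<Omega> r) (weak_grad \<Omega> s) = L2_inner \<Omega> g (weak_grad \<Omega> s)" by blast
  define h where "h x = g x - weak_grad \<Omega> r x" for x
  have rL: "weak_grad \<Omega> r \<in> L2 \<Omega>" by (intro H1_mean0_D r)
  have hL: "h \<in> L2 \<Omega>" unfolding h_def[abs_def] by (intro L2_diff g rL)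
  have h0: "L2_inner \<Omega> h (weak_grad \<Omega> s) = 0" if "s \<in> H1_mean0 \<Omega>" for s
    unfolding h_def[abs_def] using r(2)[OF that] by (simp add: L2_inner_diff_left g rL H1_mean0_D that)
  let ?v = "\<lambda>x. \<chi> i. cnj (h x $ i)"
  have zero: "(\<lambda>x. 0) \<in> L2_mean0 \<Omega>" by (simp add: L2_mean0_def spair_def)
  have "Re (vpair \<Omega> ?v (weak_grad \<Omega> s)) = - Re (spair \<Omega> (\<lambda>x. 0) s)" if "s \<in> H1_mean0 \<Omega>" for s
    using h0[OF that] Re_vpair_cnj[OF hL H1_mean0_D(3)[OF that]] by (simp add: spair_def)
  from orth[OF H0div_I[OF L2_vcnj[OF hL] zero this]] have "vpair \<Omega> ?v g = 0" by (simp add: vpair_commute)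
  then have "L2_inner \<Omega> h g = 0" using Re_vpair_cnj[OF hL g] by simp
  then have "L2_inner \<Omega> h h = 0"
    using L2_inner_diff_right[OF g rL hL] h0[OF r(1)] unfolding h_def[abs_def, symmetric] by simp
  from L2_inner_self_eq_0_imp_AE[OF hL this] have "AE x in lebesgue_on \<Omega>. weak_grad \<Omega> r x = g x"
    by eventually_elim (simp add: h_def)
  with r(1) show ?thesis by blast
qed

text \<open>Du Bois-Reymond: every test function becomes admissible after subtracting a multiple of
  one test function of integral 1. Thus \<open>r\<close> is constant almost everywhere, and its mean
  decides the constant.\<close>

lemma eq_0_if_orthogonal_to_H10_mean0:
  assumes r: "r \<in> L2_mean0 \<Omega>" and orth: "\<And>\<psi>. \<psi> \<in> H10_mean0 \<Omega> \<Longrightarrow> spair \<Omega> r \<psi> = 0"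
  shows "AE x in lebesgue_on \<Omega>. r x = 0"
proof -
  have rL: "r \<in> L2 \<Omega>" "spair \<Omega> r (\<lambda>x. 1) = 0" using r by (auto simp: L2_mean0_def)
  have not_0: "\<not> (AE x in lebesgue_on \<Omega>. (1::complex) = 0)"
  proof
    assume *: "AE x in lebesgue_on \<Omega>. (1::complex) = 0"
    have "spair \<Omega> (\<lambda>x. 1) (\<lambda>x. 1) = spair \<Omega> (\<lambda>x. 0) (\<lambda>x. 1)"
      by (rule spair_cong_AE[OF one_L2 L2_zero * one_L2])
    then show False using spair_const_one[of 1] spair_const_one[of 0] measure_domain_pos by simp
  qed
  obtain \<theta>1 where \<theta>1: "\<theta>1 \<in> test_functions \<Omega>" "spair \<Omega> (\<lambda>x. 1) \<theta>1 \<noteq> 0"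
    using L2_eq_0_if_orthogonal_to_tests[OF one_L2[of 1]] not_0 by blast
  define \<theta>0 where "\<theta>0 x = inverse (spair \<Omega> (\<lambda>x. 1) \<theta>1) * \<theta>1 x" for x
  have \<theta>0: "\<theta>0 \<in> test_functions \<Omega>" "spair \<Omega> (\<lambda>x. 1) \<theta>0 = 1"
    unfolding \<theta>0_def[abs_def] using \<theta>1 by (auto intro: test_functions_cmult simp: spair_cmult_right)
  \<comment> \<open>The value that a constant \<open>r\<close> would have, since
    \<open>\<theta>0\<close> has integral 1.\<close>
  define c where "c = spair \<Omega> r \<theta>0"
  have "AE x in lebesgue_on \<Omega>. r x - c = 0"
  proof (rule L2_eq_0_if_orthogonal_to_tests[OF L2_diff[OF rL(1) one_L2]])
    fix \<theta> assume \<theta>: "\<theta> \<in> test_functions \<Omega>"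
    let ?m = "spair \<Omega> (\<lambda>x. 1) \<theta>"
    let ?\<psi> = "\<lambda>x. \<theta> x - ?m * \<theta>0 x"
    have t: "?\<psi> \<in> test_functions \<Omega>" by (intro test_functions_diff test_functions_cmult \<theta> \<theta>0)
    have "spair \<Omega> (\<lambda>x. 1) ?\<psi> = 0"
      by (subst spair_diff_right) (simp_all add: test_L2 \<theta> \<theta>0 L2_cmult one_L2 spair_cmult_right)
    then have "?\<psi> \<in> H10_mean0 \<Omega>"
      using test_H10[OF t] test_L2[OF t] by (simp add: H10_mean0_def L2_mean0_def spair_commute)
    from orth[OF this] have "spair \<Omega> r \<theta> - ?m * c = 0"
      by (subst (asm) spair_diff_right) (simp_all add: test_L2 \<theta> \<theta>0 L2_cmult rL spair_cmult_right c_def)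
    moreover have "spair \<Omega> (\<lambda>x. c * 1) \<theta> = c * ?m" by (rule spair_cmult_left)
    ultimately show "spair \<Omega> (\<lambda>x. r x - c) \<theta> = 0"
      by (subst spair_diff_left) (simp_all add: rL one_L2 test_L2 \<theta>)
  qed
  then have rc: "AE x in lebesgue_on \<Omega>. r x = c" by eventually_elim simp
  have "spair \<Omega> r (\<lambda>x. 1) = spair \<Omega> (\<lambda>x. c) (\<lambda>x. 1)"
    by (rule spair_cong_AE[OF rL(1) one_L2 rc one_L2])
  then have "c = 0" using rL(2) spair_const_one[of c] measure_domain_pos by simp
  with rc show ?thesis by simp
qed

end

section \<open>The coefficient matrix\<close>

text \<open>Cauchy-Schwarz for the form of \<open>M\<close>, applied to \<open>\<xi>\<close> and
  \<open>M *v \<xi>\<close>: the mixed term is \<open>(norm (M *v \<xi>))\<^sup>2\<close>, and the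
  upper bound at \<open>M *v \<xi>\<close> lets one such factor cancel. At \<open>N *v \<xi>\<close>
  this becomes a lower bound for the inverse.\<close>

lemma spd_matrix_norm_le:
  fixes M :: "real^'n^'n"
  assumes M: "spd_matrix M" and up: "\<And>\<xi>. \<xi> \<bullet> (M *v \<xi>) \<le> b * (norm \<xi>)\<^sup>2"
  shows "(norm (M *v \<xi>))\<^sup>2 \<le> b * (\<xi> \<bullet> (M *v \<xi>))"
proof -
  have sym: "x \<bullet> (M *v y) = y \<bullet> (M *v x)" for x y
    using M dot_lmul_matrix[of x M y] transpose_matrix_vector[of M x] by (simp add: spd_matrix_def inner_commute)
  have nonneg: "0 \<le> x \<bullet> (M *v x)" for x
    using M unfolding spd_matrix_def by (cases "x = 0") (auto simp: less_imp_le)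
  let ?\<eta> = "M *v \<xi>"
  have "(\<xi> \<bullet> (M *v ?\<eta>))\<^sup>2 \<le> (\<xi> \<bullet> (M *v \<xi>)) * (?\<eta> \<bullet> (M *v ?\<eta>))"
  proof (rule quadratic_nonneg_discriminant)
    fix t
    show "0 \<le> \<xi> \<bullet> (M *v \<xi>) + 2 * t * (\<xi> \<bullet> (M *v ?\<eta>)) + t\<^sup>2 * (?\<eta> \<bullet> (M *v ?\<eta>))"
      using nonneg[of "\<xi> + t *\<^sub>R ?\<eta>"] sym[of ?\<eta> \<xi>]
      by (simp add: matrix_vector_right_distrib matrix_vector_mult_scaleR inner_add_left inner_add_right power2_eq_square algebra_simps)
  qed
  also have "\<dots> \<le> (\<xi> \<bullet> (M *v \<xi>)) * (b * (norm ?\<eta>)\<^sup>2)" by (intro mult_left_mono up nonneg)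
  finally have "((norm ?\<eta>)\<^sup>2)\<^sup>2 \<le> (b * (\<xi> \<bullet> (M *v \<xi>))) * (norm ?\<eta>)\<^sup>2"
    using sym[of \<xi> ?\<eta>] by (simp add: power2_norm_eq_inner algebra_simps)
  then have le: "(norm ?\<eta>)\<^sup>2 * (norm ?\<eta>)\<^sup>2 \<le> (b * (\<xi> \<bullet> (M *v \<xi>))) * (norm ?\<eta>)\<^sup>2" by (simp add: power2_eq_square)
  show ?thesis
  proof (cases "?\<eta> = 0")
    case False
    then have "0 < (norm ?\<eta>)\<^sup>2" by simp
    from mult_right_le_imp_le[OF le this] show ?thesis .
  qed simp
qed

lemma invertible_if_injective:
  fixes M :: "real^'n^'n"
  assumes "\<And>\<xi>. M *v \<xi> = 0 \<Longrightarrow> \<xi> = 0"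
  shows "invertible M"
  using assms matrix_left_invertible_ker[of M] invertible_left_inverse[of M] by blast

lemma
  assumes "invertible M"
  shows matrix_inv_right: "M ** matrix_inv M = mat 1" and matrix_inv_left: "matrix_inv M ** M = mat 1"
  using someI_ex[OF assms[unfolded invertible_def]] by (simp_all add: matrix_inv_def)

lemma transpose_matrix_inv_symmetric:
  fixes M :: "real^'n^'n"
  assumes "transpose M = M" "invertible M"
  shows "transpose (matrix_inv M) = matrix_inv M"
proof -
  have "transpose (matrix_inv M) ** M = mat 1"
    using matrix_inv_right[OF assms(2)] assms(1) matrix_transpose_mul[of M "matrix_inv M"] by (simp add: transpose_mat)
  then have "transpose (matrix_inv M) ** (M ** matrix_inv M) = matrix_inv M"
    by (simp add: matrix_mul_assoc)
  then show ?thesis by (simp add: matrix_inv_right[OF assms(2)])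
qed

lemma matrix_add_rdistrib: "(A + B) ** C = A ** C + B ** C"
  by (vector matrix_matrix_mult_def sum.distrib[symmetric] field_simps)

text \<open>The bound for \<open>N\<close> is the coercivity of \<open>M\<close> at
  \<open>N *v \<xi>\<close>. The previous lemma at the same vector gives
  \<open>(norm \<xi>)\<^sup>2 / b\<close> as a lower bound for the form of \<open>N\<close>, so
  \<open>N - mat 1\<close> is coercive with constant \<open>(1 - b) / b\<close>, whose reciprocal
  bounds \<open>P\<close>. The product formulas come from
  \<open>N = (N - mat 1) + mat 1\<close>.\<close>

lemma coefficient_matrix_properties:
  fixes M :: "real^'n^'n"
  assumes M: "spd_matrix M" and a: "0 < a" "\<And>\<xi>. a * (norm \<xi>)\<^sup>2 \<le> \<xi> \<bullet> (M *v \<xi>)"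
    and b: "0 < b" "b < 1" "\<And>\<xi>. \<xi> \<bullet> (M *v \<xi>) \<le> b * (norm \<xi>)\<^sup>2"
  defines "N \<equiv> matrix_inv M" and "P \<equiv> matrix_inv (matrix_inv M - mat 1)"
  shows "invertible M" "invertible (N - mat 1)" "transpose N = N" "transpose P = P"
    "P ** N = mat 1 + P" "N ** P = mat 1 + P"
    "norm (N *v \<xi>) \<le> norm \<xi> / a" "norm (P *v \<xi>) \<le> norm \<xi> * (b / (1 - b))"
proof -
  have "\<xi> = 0" if "M *v \<xi> = 0" for \<xi> using a(1) a(2)[of \<xi>] that by (simp add: mult_le_0_iff)
  then show inv: "invertible M" by (rule invertible_if_injective)
  have MN: "M *v (N *v x) = x" for x
    by (simp add: N_def matrix_vector_mul_assoc matrix_inv_right[OF inv])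
  show "norm (N *v \<xi>) \<le> norm \<xi> / a"
  proof (cases "N *v \<xi> = 0")
    case False
    have "a * norm (N *v \<xi>) * norm (N *v \<xi>) \<le> (N *v \<xi>) \<bullet> \<xi>"
      using a(2)[of "N *v \<xi>"] by (simp add: MN power2_eq_square)
    also have "\<dots> \<le> norm \<xi> * norm (N *v \<xi>)" using norm_cauchy_schwarz[of "N *v \<xi>" \<xi>] by (simp add: mult.commute)
    finally have "a * norm (N *v \<xi>) \<le> norm \<xi>" using False by simp
    then show ?thesis using a(1) by (simp add: pos_le_divide_eq mult.commute)
  qed (use a in simp)
  have coercive: "norm \<xi> * ((1 - b) / b) \<le> norm ((N - mat 1) *v \<xi>)" for \<xi>
  proof (cases "\<xi> = 0")
    case False
    have "(norm \<xi>)\<^sup>2 \<le> b * ((N *v \<xi>) \<bullet> \<xi>)"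
      using spd_matrix_norm_le[OF M b(3), of "N *v \<xi>"] by (simp add: MN)
    then have "(norm \<xi>)\<^sup>2 / b \<le> (N *v \<xi>) \<bullet> \<xi>" using b(1) by (simp add: pos_divide_le_eq mult.commute)
    then have "(norm \<xi>)\<^sup>2 / b - (norm \<xi>)\<^sup>2 \<le> \<xi> \<bullet> ((N - mat 1) *v \<xi>)"
      by (simp add: matrix_vector_mult_diff_rdistrib inner_diff_right power2_norm_eq_inner inner_commute)
    also have "\<dots> \<le> norm \<xi> * norm ((N - mat 1) *v \<xi>)" by (rule norm_cauchy_schwarz)
    finally have "norm \<xi> * (norm \<xi> * ((1 - b) / b)) \<le> norm \<xi> * norm ((N - mat 1) *v \<xi>)"
      using b(1) by (simp add: power2_eq_square field_simps)
    then show ?thesis by (rule mult_left_le_imp_le) (use False in simp)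
  qed simp
  have "\<xi> = 0" if "(N - mat 1) *v \<xi> = 0" for \<xi>
    using coercive[of \<xi>] that b by (simp add: divide_le_0_iff mult_le_0_iff)
  then show inv2: "invertible (N - mat 1)" by (rule invertible_if_injective)
  have P: "P ** (N - mat 1) = mat 1" "(N - mat 1) ** P = mat 1"
    unfolding P_def N_def[symmetric] by (rule matrix_inv_left[OF inv2] matrix_inv_right[OF inv2])+
  then show "P ** N = mat 1 + P" "N ** P = mat 1 + P"
    using matrix_add_ldistrib[of P "N - mat 1" "mat 1"] matrix_add_rdistrib[of "N - mat 1" "mat 1" P] by simp_all
  show N: "transpose N = N" unfolding N_def using M inv by (intro transpose_matrix_inv_symmetric) (auto simp: spd_matrix_def)
  have "transpose (N - mat 1) = N - mat 1"
    using N by (simp add: vec_eq_iff transpose_def mat_def)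
  then show "transpose P = P" unfolding P_def N_def[symmetric] using inv2 by (rule transpose_matrix_inv_symmetric)
  have "norm (P *v \<xi>) * ((1 - b) / b) \<le> norm \<xi>"
    using coercive[of "P *v \<xi>"] by (simp add: matrix_vector_mul_assoc P)
  then show "norm (P *v \<xi>) \<le> norm \<xi> * (b / (1 - b))"
    using b by (simp add: field_simps)
qed

text \<open>By Cramer's rule the entries of the inverse are quotients of determinants, and these are
  polynomials in measurable entries.\<close>

lemma matrix_inv_measurable:
  fixes B :: "real^'n \<Rightarrow> real^'n^'n"
  assumes B: "\<And>i j. (\<lambda>x. B x $ i $ j) \<in> borel_measurable (lebesgue_on \<Omega>)"
    and inv: "\<And>x. x \<in> \<Omega> \<Longrightarrow> invertible (B x)"
  shows "(\<lambda>x. matrix_inv (B x) $ k $ l) \<in> borel_measurable (lebesgue_on \<Omega>)"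
proof -
  have "matrix_inv (B x) $ k $ l = det (\<chi> i j. if j = k then axis l 1 $ i else B x $ i $ j) / det (B x)" if "x \<in> \<Omega>" for x
  proof -
    have d: "det (B x) \<noteq> 0" using inv[OF that] by (simp add: invertible_det_nz)
    have "B x *v (matrix_inv (B x) *v axis l 1) = axis l 1"
      by (simp add: matrix_vector_mul_assoc matrix_inv_right[OF inv[OF that]])
    then have "(matrix_inv (B x) *v axis l 1) $ k = det (\<chi> i j. if j = k then axis l 1 $ i else B x $ i $ j) / det (B x)"
      unfolding cramer[OF d] by simp
    moreover have "(matrix_inv (B x) *v axis l 1) $ k = matrix_inv (B x) $ k $ l"
      by (simp add: matrix_vector_mult_def axis_def if_distrib cong: if_cong)
    ultimately show ?thesis by simp
  qed
  moreover have "(\<lambda>x. det (\<chi> i j. if j = k then axis l 1 $ i else B x $ i $ j) / det (B x)) \<in> borel_measurable (lebesgue_on \<Omega>)"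
  proof (intro borel_measurable_divide)
    have "(\<lambda>x. if j = k then axis l 1 $ i else B x $ i $ j) \<in> borel_measurable (lebesgue_on \<Omega>)" for i j
      using B by (cases "j = k") auto
    then show "(\<lambda>x. det (\<chi> i j. if j = k then axis l 1 $ i else B x $ i $ j)) \<in> borel_measurable (lebesgue_on \<Omega>)"
      unfolding det_def by (intro borel_measurable_sum borel_measurable_times borel_measurable_prod borel_measurable_const) simp_all
    show "(\<lambda>x. det (B x)) \<in> borel_measurable (lebesgue_on \<Omega>)"
      unfolding det_def by (intro borel_measurable_sum borel_measurable_times borel_measurable_prod borel_measurable_const B)
  qed
  ultimately show ?thesis by (subst measurable_cong) (auto simp: space_restrict_space)
qed

section \<open>Real matrix fields acting on complex vector fields\<close>

lemma mapply_component: "mapply M w x $ i = (\<Sum>j\<in>UNIV. of_real (M x $ i $ j) * w x $ j)"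
  by (simp add: mapply_def map_matrix_def matrix_vector_mult_def)

lemma mapply_L2:
  fixes M :: "real^'n \<Rightarrow> real^'n^'n"
  assumes M: "\<And>i j. (\<lambda>x. M x $ i $ j) \<in> borel_measurable (lebesgue_on \<Omega>)"
    and bound: "\<And>x \<xi>. x \<in> \<Omega> \<Longrightarrow> norm (M x *v \<xi>) \<le> norm \<xi> * K" and w: "w \<in> L2 \<Omega>"
  shows "mapply M w \<in> L2 \<Omega>"
  unfolding L2_vec_iff
proof
  fix i
  have "(\<lambda>x. M x $ i $ j *\<^sub>R w x $ j) \<in> L2 \<Omega>" for j
  proof (rule L2_mult_bounded[where K = K, OF M _ L2_component[OF w]])
    fix x assume x: "x \<in> \<Omega>"
    have "M x $ i $ j = (M x *v axis j 1) $ i"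
      by (simp add: matrix_vector_mult_def axis_def if_distrib cong: if_cong)
    also have "\<bar>\<dots>\<bar> \<le> norm (M x *v axis j 1)" by (rule component_le_norm_cart)
    also have "\<dots> \<le> K" using bound[OF x, of "axis j 1"] by simp
    finally show "\<bar>M x $ i $ j\<bar> \<le> K" .
  qed
  then have "(\<lambda>x. \<Sum>j\<in>UNIV. M x $ i $ j *\<^sub>R w x $ j) \<in> L2 \<Omega>" by (intro L2_sum)
  then show "(\<lambda>x. mapply M w x $ i) \<in> L2 \<Omega>" by (simp add: mapply_component scaleR_conv_of_real)
qed

lemma mapply_add: "mapply M (\<lambda>x. v x + w x) = (\<lambda>x. mapply M v x + mapply M w x)"
  by (rule ext) (simp add: mapply_def matrix_vector_right_distrib)

lemma vpair_mapply_symmetric: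
  assumes "\<And>x. x \<in> \<Omega> \<Longrightarrow> transpose (M x) = M x"
  shows "vpair \<Omega> (mapply M v) w = vpair \<Omega> v (mapply M w)"
  unfolding vpair_def
proof (rule Bochner_Integration.integral_cong[OF refl])
  fix x assume "x \<in> space (lebesgue_on \<Omega>)"
  then have T: "transpose (M x) = M x" using assms by simp
  have sym: "M x $ i $ j = M x $ j $ i" for i j
  proof -
    have "M x $ i $ j = transpose (M x) $ j $ i" by (simp only: transpose_def vec_lambda_beta)
    then show ?thesis by (simp only: T)
  qed
  have "(\<Sum>i\<in>UNIV. mapply M v x $ i * w x $ i) = (\<Sum>i\<in>UNIV. \<Sum>j\<in>UNIV. of_real (M x $ i $ j) * v x $ j * w x $ i)"
    by (simp add: mapply_component sum_distrib_right)
  also have "\<dots> = (\<Sum>j\<in>UNIV. \<Sum>i\<in>UNIV. of_real (M x $ i $ j) * v x $ j * w x $ i)"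
    by (rule sum.swap)
  also have "\<dots> = (\<Sum>i\<in>UNIV. v x $ i * mapply M w x $ i)"
    by (simp add: mapply_component sum_distrib_left sym mult_ac)
  finally show "(\<Sum>i\<in>UNIV. mapply M v x $ i * w x $ i) = (\<Sum>i\<in>UNIV. v x $ i * mapply M w x $ i)" .
qed

lemma mapply_mapply:
  assumes "M x ** N x = mat 1 + L x"
  shows "mapply M (mapply N w) x = w x + mapply L w x"
proof -
  have "map_matrix complex_of_real (M x) ** map_matrix complex_of_real (N x) = map_matrix complex_of_real (M x ** N x)"
    by (simp add: vec_eq_iff map_matrix_def matrix_matrix_mult_def)
  also have "\<dots> = mat 1 + map_matrix complex_of_real (L x)"
    unfolding assms by (simp add: vec_eq_iff map_matrix_def mat_def)
  finally show ?thesis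
    by (simp add: mapply_def matrix_vector_mul_assoc matrix_vector_mult_add_rdistrib)
qed

lemma mapply_one_plus: "mapply (\<lambda>x. mat 1 + P x) w x = w x + mapply P w x"
proof -
  have "map_matrix complex_of_real (mat 1 + P x) = mat 1 + map_matrix complex_of_real (P x)"
    by (simp add: vec_eq_iff map_matrix_def mat_def)
  then show ?thesis by (simp add: mapply_def matrix_vector_mult_add_rdistrib)
qed

text \<open>Real numbers strictly between the extended bounds and 0 or 1 leave the extended reals
  behind, and homogeneity extends the bounds from the unit sphere. A unit vector at a point of the
  domain gives \<open>a \<le> b\<close>, hence \<open>b > 0\<close>.\<close>

lemma coefficient_bounds:
  fixes A :: "real^'n \<Rightarrow> real^'n^'n"
  assumes ne: "\<Omega> \<noteq> {}" and low: "0 < kappa_lower \<Omega> A" and up: "kappa_upper \<Omega> A < 1"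
  obtains a b where "0 < a" "0 < b" "b < 1"
    "\<And>x \<xi>. x \<in> \<Omega> \<Longrightarrow> a * (norm \<xi>)\<^sup>2 \<le> \<xi> \<bullet> (A x *v \<xi>)"
    "\<And>x \<xi>. x \<in> \<Omega> \<Longrightarrow> \<xi> \<bullet> (A x *v \<xi>) \<le> b * (norm \<xi>)\<^sup>2"
proof -
  obtain a where a: "0 < a" "ereal a < kappa_lower \<Omega> A"
    using ereal_dense2[OF low] by auto
  obtain b where b: "kappa_upper \<Omega> A < ereal b" "b < 1"
    using ereal_dense2[OF up] by (auto simp: one_ereal_def)
  have le: "a \<le> \<xi> \<bullet> (A x *v \<xi>)" "\<xi> \<bullet> (A x *v \<xi>) \<le> b" if x: "x \<in> \<Omega>" and \<xi>: "norm \<xi> = 1" for x \<xi>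
  proof -
    have "kappa_lower \<Omega> A \<le> ereal (\<xi> \<bullet> (A x *v \<xi>))"
      unfolding kappa_lower_def by (rule INF_lower2[OF x], rule INF_lower) (simp add: \<xi>)
    with a(2) have "ereal a < ereal (\<xi> \<bullet> (A x *v \<xi>))" by (rule less_le_trans)
    then show "a \<le> \<xi> \<bullet> (A x *v \<xi>)" by simp
    have "ereal (\<xi> \<bullet> (A x *v \<xi>)) \<le> kappa_upper \<Omega> A"
      unfolding kappa_upper_def by (rule SUP_upper2[OF x], rule SUP_upper) (simp add: \<xi>)
    then have "ereal (\<xi> \<bullet> (A x *v \<xi>)) < ereal b" using b(1) by (rule le_less_trans)
    then show "\<xi> \<bullet> (A x *v \<xi>) \<le> b" by simp
  qed
  have scaled: "a * (norm \<xi>)\<^sup>2 \<le> \<xi> \<bullet> (A x *v \<xi>) \<and> \<xi> \<bullet> (A x *v \<xi>) \<le> b * (norm \<xi>)\<^sup>2" if x: "x \<in> \<Omega>" for x \<xi>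
  proof (cases "\<xi> = 0")
    case False
    define \<eta> where "\<eta> = (1 / norm \<xi>) *\<^sub>R \<xi>"
    have \<eta>: "norm \<eta> = 1" "\<xi> = norm \<xi> *\<^sub>R \<eta>" using False by (simp_all add: \<eta>_def)
    have "\<xi> \<bullet> (A x *v \<xi>) = (norm \<xi>)\<^sup>2 * (\<eta> \<bullet> (A x *v \<eta>))"
      by (subst (1 2) \<eta>(2)) (simp add: matrix_vector_mult_scaleR power2_eq_square)
    then show ?thesis
      using mult_left_mono[OF le(1)[OF x \<eta>(1)], of "(norm \<xi>)\<^sup>2"] mult_left_mono[OF le(2)[OF x \<eta>(1)], of "(norm \<xi>)\<^sup>2"]
      by (simp add: mult.commute)
  qed simp
  obtain x where "x \<in> \<Omega>" using ne by blast
  obtain \<xi> :: "real^'n" where "norm \<xi> = 1" using vector_choose_size[of 1] by auto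
  from le[OF \<open>x \<in> \<Omega>\<close> this] a(1) have "0 < b" by linarith
  with that[of a b] a b scaled show thesis by blast
qed

section \<open>Equivalence of the eigenvalue problems\<close>

text \<open>The interface of the coefficient to the equivalence proof: pointwise symmetry and
  algebra, with boundedness recorded as preservation of \<open>L2 \<Omega>\<close>.\<close>

locale admissible_coefficient = Poincare_domain \<Omega> for \<Omega> :: "(real^'n) set" +
  fixes A :: "real^'n \<Rightarrow> real^'n^'n"
  assumes inv_sym: "\<And>x. x \<in> \<Omega> \<Longrightarrow> transpose (matrix_inv (A x)) = matrix_inv (A x)"
    and inv_P: "\<And>x. x \<in> \<Omega> \<Longrightarrow> matrix_inv (A x) ** P_field A x = mat 1 + P_field A x"
    and P_L2: "\<And>w. w \<in> L2 \<Omega> \<Longrightarrow> mapply (P_field A) w \<in> L2 \<Omega>"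
    and inv_L2: "\<And>w. w \<in> L2 \<Omega> \<Longrightarrow> mapply (\<lambda>x. matrix_inv (A x)) w \<in> L2 \<Omega>"
begin

abbreviation P where "P \<equiv> mapply (P_field A)"
abbreviation A_inv where "A_inv \<equiv> mapply (\<lambda>x. matrix_inv (A x))"

lemma vpair_P_A_inv:
  assumes w: "w \<in> L2 \<Omega>" and v: "v \<in> L2 \<Omega>"
  shows "vpair \<Omega> (P w) (A_inv v) = vpair \<Omega> w v + vpair \<Omega> (P w) v"
proof -
  have "vpair \<Omega> (P w) (A_inv v) = vpair \<Omega> (A_inv (P w)) v"
    by (rule vpair_mapply_symmetric[symmetric]) (rule inv_sym)
  also have "\<dots> = vpair \<Omega> (\<lambda>x. w x + P w x) v"
    unfolding vpair_def
    by (rule Bochner_Integration.integral_cong) (simp_all add: mapply_mapply inv_P)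
  also have "\<dots> = vpair \<Omega> w v + vpair \<Omega> (P w) v" by (rule vpair_add_left[OF w P_L2[OF w] v])
  finally show ?thesis .
qed

lemma vpair_one_plus_P:
  assumes y: "y \<in> L2 \<Omega>" and z: "z \<in> L2 \<Omega>"
  shows "vpair \<Omega> (mapply (\<lambda>x. mat 1 + P_field A x) y) z = vpair \<Omega> y z + vpair \<Omega> (P y) z"
proof -
  have "mapply (\<lambda>x. mat 1 + P_field A x) y = (\<lambda>x. y x + P y x)"
    by (rule ext) (rule mapply_one_plus)
  then show ?thesis by (simp add: vpair_add_left y z P_L2)
qed

lemma zero_in_spaces: "(\<lambda>x. 0) \<in> H10_mean0 \<Omega>" "(\<lambda>x. 0) \<in> H1_mean0 \<Omega>"
  using test_H10[OF test_functions_zero] by (simp_all add: H10_mean0_def H1_mean0_def L2_mean0_def spair_def H10_def)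

lemma H10_mean0_D:
  assumes "\<phi> \<in> H10_mean0 \<Omega>"
  shows "\<phi> \<in> H10 \<Omega>" "\<phi> \<in> H1 \<Omega>" "\<phi> \<in> L2_mean0 \<Omega>" "\<phi> \<in> L2 \<Omega>" "weak_grad \<Omega> \<phi> \<in> L2 \<Omega>"
  using assms H1_D(3)[of \<phi>] by (auto simp: H10_mean0_def H10_def L2_mean0_def)

lemma H1_mean0_in: "r \<in> H1_mean0 \<Omega> \<Longrightarrow> r \<in> H1 \<Omega>" "r \<in> H1_mean0 \<Omega> \<Longrightarrow> r \<in> L2_mean0 \<Omega>"
  by (auto simp: H1_mean0_def)

lemma H10div_D:
  assumes "v \<in> H10div \<Omega>"
  shows "v \<in> H0div \<Omega>" "v \<in> L2 \<Omega>" "weak_div \<Omega> v \<in> H10_mean0 \<Omega>"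
  using assms H0div_D(2)[of v] weak_div_mean0[of v] by (auto simp: H10div_def H10_mean0_def)

lemma H10div_I:
  assumes "v \<in> H0div \<Omega>" "has_weak_div \<Omega> v \<psi>" "\<psi> \<in> H10 \<Omega>"
  shows "v \<in> H10div \<Omega>" "weak_grad \<Omega> (weak_div \<Omega> v) = weak_grad \<Omega> \<psi>"
proof -
  have ae: "AE x in lebesgue_on \<Omega>. weak_div \<Omega> v x = \<psi> x" by (rule weak_div_eq_AE[OF assms(2)])
  then show "weak_grad \<Omega> (weak_div \<Omega> v) = weak_grad \<Omega> \<psi>" by (rule weak_grad_cong)
  from ae have "AE x in lebesgue_on \<Omega>. \<psi> x = weak_div \<Omega> v x" by eventually_elim simp
  from H10_cong[OF assms(3) this] assms(1) show "v \<in> H10div \<Omega>" by (simp add: H10div_def)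
qed

text \<open>Each of the three spaces contains 0, so the equations can be tested independently of
  each other.\<close>

lemma eigenpair2_iff:
  "eigenpair2 \<Omega> A lam (\<phi>, y, r) \<longleftrightarrow>
     lam \<noteq> 0 \<and> \<phi> \<in> H10_mean0 \<Omega> \<and> y \<in> L2 \<Omega> \<and> r \<in> H1_mean0 \<Omega> \<and>
     \<not> (AE x in lebesgue_on \<Omega>. \<phi> x = 0 \<and> y x = 0 \<and> r x = 0) \<and>
     (\<forall>\<psi>\<in>H10_mean0 \<Omega>. vpair \<Omega> (P (weak_grad \<Omega> \<phi>)) (weak_grad \<Omega> \<psi>) + vpair \<Omega> (P y) (weak_grad \<Omega> \<psi>)
        = lam * (spair \<Omega> \<phi> \<psi> + spair \<Omega> r \<psi>)) \<and>
     (\<forall>z\<in>L2 \<Omega>. vpair \<Omega> (P (weak_grad \<Omega> \<phi>)) z + vpair \<Omega> y z + vpair \<Omega> (P y) z = vpair \<Omega> (weak_grad \<Omega> r) z) \<and>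
     (\<forall>s\<in>H1_mean0 \<Omega>. - vpair \<Omega> y (weak_grad \<Omega> s) = lam * spair \<Omega> \<phi> s)"
  (is "?L \<longleftrightarrow> ?R")
proof
  assume L: ?L
  then have mem: "y \<in> L2 \<Omega>" by (simp add: eigenpair2_def V_space_def)
  have *: "(\<psi>, z, s) \<in> V_space \<Omega>" if "\<psi> \<in> H10_mean0 \<Omega>" "z \<in> L2 \<Omega>" "s \<in> H1_mean0 \<Omega>" for \<psi> z s
    using that by (simp add: V_space_def)
  show ?R
  proof (intro conjI ballI)
    show "vpair \<Omega> (P (weak_grad \<Omega> \<phi>)) (weak_grad \<Omega> \<psi>) + vpair \<Omega> (P y) (weak_grad \<Omega> \<psi>)
        = lam * (spair \<Omega> \<phi> \<psi> + spair \<Omega> r \<psi>)" if "\<psi> \<in> H10_mean0 \<Omega>" for \<psi>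
      using L *[OF that L2_zero zero_in_spaces(2)] unfolding eigenpair2_def by blast
    show "vpair \<Omega> (P (weak_grad \<Omega> \<phi>)) z + vpair \<Omega> y z + vpair \<Omega> (P y) z = vpair \<Omega> (weak_grad \<Omega> r) z" if "z \<in> L2 \<Omega>" for z
    proof -
      have "vpair \<Omega> (P (weak_grad \<Omega> \<phi>)) z + vpair \<Omega> (mapply (\<lambda>x. mat 1 + P_field A x) y) z - vpair \<Omega> (weak_grad \<Omega> r) z = 0"
        using L *[OF zero_in_spaces(1) that zero_in_spaces(2)] unfolding eigenpair2_def by blast
      then show ?thesis by (simp add: vpair_one_plus_P mem that algebra_simps)
    qed
    show "- vpair \<Omega> y (weak_grad \<Omega> s) = lam * spair \<Omega> \<phi> s" if "s \<in> H1_mean0 \<Omega>" for s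
      using L *[OF zero_in_spaces(1) L2_zero that] unfolding eigenpair2_def by blast
  qed (use L in \<open>simp_all add: eigenpair2_def V_space_def\<close>)
next
  assume ?R
  then show ?L
    by (auto simp: eigenpair2_def V_space_def vpair_one_plus_P algebra_simps)
qed

lemma eigenpair2_imp_eigenpair1:
  assumes "eigenpair2 \<Omega> A lam (\<phi>, y, r)"
  shows "eigenpair1 \<Omega> A lam (\<lambda>x. (1 / lam) *s y x)"
proof -
  note E = assms[unfolded eigenpair2_iff]
  have lam: "lam \<noteq> 0" and \<phi>: "\<phi> \<in> H10_mean0 \<Omega>" and y: "y \<in> L2 \<Omega>" and r: "r \<in> H1_mean0 \<Omega>"
    and nz: "\<not> (AE x in lebesgue_on \<Omega>. \<phi> x = 0 \<and> y x = 0 \<and> r x = 0)"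
    using E by auto
  have eq1: "vpair \<Omega> (P (weak_grad \<Omega> \<phi>)) (weak_grad \<Omega> \<psi>) + vpair \<Omega> (P y) (weak_grad \<Omega> \<psi>)
        = lam * (spair \<Omega> \<phi> \<psi> + spair \<Omega> r \<psi>)" if "\<psi> \<in> H10_mean0 \<Omega>" for \<psi>
    using E that by blast
  have eq2: "vpair \<Omega> (P (weak_grad \<Omega> \<phi>)) z + vpair \<Omega> y z + vpair \<Omega> (P y) z = vpair \<Omega> (weak_grad \<Omega> r) z" if "z \<in> L2 \<Omega>" for z
    using E that by blast
  have eq3: "- vpair \<Omega> y (weak_grad \<Omega> s) = lam * spair \<Omega> \<phi> s" if "s \<in> H1_mean0 \<Omega>" for s
    using E that by blast
  note \<phi>D = H10_mean0_D[OF \<phi>] and rD = H1_mean0_D[OF r]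
  define u where "u x = (1 / lam) *s y x" for x
  have lu: "lam *s u x = y x" for x using lam by (simp add: u_def vector_smult_assoc)
  have uL: "u \<in> L2 \<Omega>" unfolding u_def[abs_def] by (rule L2_vcmult[OF y])
  have "vpair \<Omega> u (weak_grad \<Omega> s) = - spair \<Omega> \<phi> s" if "s \<in> H1_mean0 \<Omega>" for s
    using arg_cong[OF eq3[OF that], of uminus] lam unfolding u_def[abs_def] vpair_cmult_left by simp
  then have "Re (vpair \<Omega> u (weak_grad \<Omega> s)) = - Re (spair \<Omega> \<phi> s)" if "s \<in> H1_mean0 \<Omega>" for s
    using that by simp
  note u = H0div_I[OF uL \<phi>D(3) this]
  note uH = H10div_I[OF u \<phi>D(1)]
  \<comment> \<open>A vanishing \<open>u\<close> forces \<open>y = 0\<close> and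
    \<open>\<phi> = 0\<close>, as \<open>\<phi>\<close> is the divergence of \<open>u\<close>. The
    first equation then says that \<open>r\<close> is orthogonal to
    \<open>H10_mean0 \<Omega>\<close>, so \<open>r\<close> would vanish too.\<close>
  have u_nz: "\<not> (AE x in lebesgue_on \<Omega>. u x = 0)"
  proof
    assume u0: "AE x in lebesgue_on \<Omega>. u x = 0"
    then have y0: "AE x in lebesgue_on \<Omega>. y x = 0" by eventually_elim (metis lu vector_smult_rzero)
    have \<phi>0: "AE x in lebesgue_on \<Omega>. \<phi> x = 0"
    proof (rule L2_eq_0_if_orthogonal_to_tests[OF \<phi>D(4)])
      fix \<theta> assume \<theta>: "\<theta> \<in> test_functions \<Omega>"
      have "vpair \<Omega> u (\<lambda>x. \<chi> i. pderivative i \<theta> x) = vpair \<Omega> (\<lambda>x. 0) (\<lambda>x. \<chi> i. pderivative i \<theta> x)"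
        by (rule vpair_cong_AE[OF uL L2_zero u0 test_gradient_L2[OF \<theta>]])
      then show "spair \<Omega> \<phi> \<theta> = 0" using has_weak_divD(3)[OF u(2) \<theta>] by (simp add: vpair_def)
    qed
    have "AE x in lebesgue_on \<Omega>. 0 = weak_grad \<Omega> \<phi> x"
      using weak_grad_eq_AE[OF has_weak_grad_const[of 0]] unfolding weak_grad_cong[OF \<phi>0]
      by eventually_elim simp
    then have g0: "AE x in lebesgue_on \<Omega>. weak_grad \<Omega> \<phi> x = 0" by eventually_elim simp
    have P0: "vpair \<Omega> (P w) z = 0" if "w \<in> L2 \<Omega>" "z \<in> L2 \<Omega>" "AE x in lebesgue_on \<Omega>. w x = 0" for w z
    proof -
      have "AE x in lebesgue_on \<Omega>. P w x = 0" using that(3) by eventually_elim (simp add: mapply_def)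
      from vpair_cong_AE[OF P_L2[OF that(1)] L2_zero this that(2)] show ?thesis by (simp add: vpair_def)
    qed
    have "AE x in lebesgue_on \<Omega>. r x = 0"
    proof (rule eq_0_if_orthogonal_to_H10_mean0[OF H1_mean0_in(2)[OF r]])
      fix \<psi> assume \<psi>: "\<psi> \<in> H10_mean0 \<Omega>"
      have "spair \<Omega> \<phi> \<psi> = spair \<Omega> (\<lambda>x. 0) \<psi>"
        by (rule spair_cong_AE[OF \<phi>D(4) L2_zero \<phi>0 H10_mean0_D(4)[OF \<psi>]])
      then have "spair \<Omega> \<phi> \<psi> = 0" by (simp add: spair_def)
      with eq1[OF \<psi>] P0[OF \<phi>D(5) H10_mean0_D(5)[OF \<psi>] g0] P0[OF y H10_mean0_D(5)[OF \<psi>] y0] lam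
      show "spair \<Omega> r \<psi> = 0" by simp
    qed
    with y0 \<phi>0 have "AE x in lebesgue_on \<Omega>. \<phi> x = 0 \<and> y x = 0 \<and> r x = 0" by eventually_elim simp
    with nz show False ..
  qed
  have "vpair \<Omega> (P (\<lambda>x. weak_grad \<Omega> (weak_div \<Omega> u) x + lam *s u x))
      (\<lambda>x. weak_grad \<Omega> (weak_div \<Omega> v) x + lam *s A_inv v x) = 0" if v: "v \<in> H10div \<Omega>" for v
  proof -
    let ?W = "\<lambda>x. weak_grad \<Omega> \<phi> x + y x"
    let ?\<psi> = "weak_div \<Omega> v"
    note vD = H10div_D[OF v]
    note \<psi>D = H10_mean0_D[OF vD(3)]
    have W: "?W \<in> L2 \<Omega>" by (intro L2_add \<phi>D y)
    have split: "vpair \<Omega> (P ?W) z = vpair \<Omega> (P (weak_grad \<Omega> \<phi>)) z + vpair \<Omega> (P y) z" if "z \<in> L2 \<Omega>" for z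
      by (simp add: mapply_add vpair_add_left P_L2 \<phi>D y that)
    have "vpair \<Omega> (P ?W) (\<lambda>x. weak_grad \<Omega> ?\<psi> x + lam *s A_inv v x)
        = vpair \<Omega> (P ?W) (weak_grad \<Omega> ?\<psi>) + lam * vpair \<Omega> (P ?W) (A_inv v)"
      by (simp add: vpair_add_right \<psi>D L2_vcmult inv_L2 vD P_L2 W vpair_cmult_right)
    also have "vpair \<Omega> (P ?W) (weak_grad \<Omega> ?\<psi>) = lam * (spair \<Omega> \<phi> ?\<psi> + spair \<Omega> r ?\<psi>)"
      using eq1[OF vD(3)] by (simp add: split \<psi>D)
    \<comment> \<open>Moving \<open>A_inv\<close> across turns \<open>P ?W\<close> into
      \<open>?W + P ?W\<close>; by the second equation with \<open>z = v\<close>, the part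
      \<open>y + P ?W\<close> acts as the gradient of \<open>r\<close>.\<close>
    also have "vpair \<Omega> (P ?W) (A_inv v) = vpair \<Omega> (weak_grad \<Omega> \<phi>) v + vpair \<Omega> (weak_grad \<Omega> r) v"
      unfolding vpair_P_A_inv[OF W vD(2)] split[OF vD(2)] vpair_add_left[OF \<phi>D(5) y vD(2)] eq2[OF vD(2), symmetric]
      by (simp add: algebra_simps)
    \<comment> \<open>Green's formula for \<open>v\<close> has no boundary term. The result is the
      negative of the bracket in the first equation, so the two contributions cancel.\<close>
    also have "\<dots> = - (spair \<Omega> \<phi> ?\<psi> + spair \<Omega> r ?\<psi>)"
      using H0div_D(4)[OF vD(1) \<phi>D(2)] H0div_D(4)[OF vD(1) H1_mean0_in(1)[OF r]]
      by (simp add: vpair_commute[of \<Omega> v] spair_commute[of \<Omega> ?\<psi>])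
    finally show ?thesis by (simp add: uH(2) lu ring_distribs)
  qed
  with lam uH(1) u_nz show ?thesis unfolding u_def[abs_def, symmetric] eigenpair1_def by blast
qed

lemma eigenpair1_imp_eigenpair2:
  assumes "eigenpair1 \<Omega> A lam u"
  shows "\<exists>r\<in>H1_mean0 \<Omega>. eigenpair2 \<Omega> A lam (weak_div \<Omega> u, (\<lambda>x. lam *s u x), r)"
proof -
  have lam: "lam \<noteq> 0" and u: "u \<in> H10div \<Omega>" and nz: "\<not> (AE x in lebesgue_on \<Omega>. u x = 0)"
    using assms by (auto simp: eigenpair1_def)
  note uD = H10div_D[OF u]
  define \<phi> where "\<phi> = weak_div \<Omega> u"
  define y where "y x = lam *s u x" for x
  have \<phi>: "\<phi> \<in> H10_mean0 \<Omega>" unfolding \<phi>_def by (rule uD(3))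
  note \<phi>D = H10_mean0_D[OF \<phi>]
  have y: "y \<in> L2 \<Omega>" unfolding y_def[abs_def] by (rule L2_vcmult[OF uD(2)])
  let ?W = "\<lambda>x. weak_grad \<Omega> \<phi> x + y x"
  have W: "?W \<in> L2 \<Omega>" by (intro L2_add \<phi>D y)
  have split: "vpair \<Omega> (P ?W) z = vpair \<Omega> (P (weak_grad \<Omega> \<phi>)) z + vpair \<Omega> (P y) z" if "z \<in> L2 \<Omega>" for z
    by (simp add: mapply_add vpair_add_left P_L2 \<phi>D y that)
  \<comment> \<open>The left side of the second equation of (E2), which has to become the gradient
    of \<open>r\<close>.\<close>
  define g where "g x = P ?W x + y x" for x
  have g: "g \<in> L2 \<Omega>" unfolding g_def[abs_def] by (intro L2_add P_L2 W y)
  \<comment> \<open>(E1) after moving \<open>A_inv\<close> across and integrating the gradient of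
    \<open>\<phi>\<close> by parts.\<close>
  have key: "vpair \<Omega> (P ?W) (weak_grad \<Omega> (weak_div \<Omega> v)) = lam * (spair \<Omega> \<phi> (weak_div \<Omega> v) - vpair \<Omega> g v)"
    if v: "v \<in> H10div \<Omega>" for v
  proof -
    note vD = H10div_D[OF v]
    note \<psi>D = H10_mean0_D[OF vD(3)]
    have "vpair \<Omega> (P ?W) (\<lambda>x. weak_grad \<Omega> (weak_div \<Omega> v) x + lam *s A_inv v x) = 0"
      using assms v by (simp add: eigenpair1_def \<phi>_def y_def)
    then have "vpair \<Omega> (P ?W) (weak_grad \<Omega> (weak_div \<Omega> v)) + lam * vpair \<Omega> (P ?W) (A_inv v) = 0"
      by (simp add: vpair_add_right \<psi>D L2_vcmult inv_L2 vD P_L2 W vpair_cmult_right)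
    moreover have "vpair \<Omega> (P ?W) (A_inv v) = vpair \<Omega> (weak_grad \<Omega> \<phi>) v + vpair \<Omega> g v"
      unfolding g_def[abs_def] by (simp add: vpair_P_A_inv W vD vpair_add_left \<phi>D y P_L2)
    moreover have "vpair \<Omega> (weak_grad \<Omega> \<phi>) v = - spair \<Omega> \<phi> (weak_div \<Omega> v)"
      using H0div_D(4)[OF vD(1) \<phi>D(2)] by (simp add: vpair_commute[of \<Omega> v] spair_commute[of \<Omega> _ \<phi>])
    ultimately have "vpair \<Omega> (P ?W) (weak_grad \<Omega> (weak_div \<Omega> v)) = - (lam * (- spair \<Omega> \<phi> (weak_div \<Omega> v) + vpair \<Omega> g v))"
      by (simp only: eq_neg_iff_add_eq_0)
    then show ?thesis by (simp add: right_diff_distrib distrib_left)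
  qed
  \<comment> \<open>For a divergence-free \<open>v\<close> every other term of \<open>key\<close>
    contains the divergence of \<open>v\<close> and vanishes.\<close>
  have "vpair \<Omega> g v = 0" if v: "v \<in> H0div \<Omega>" "has_weak_div \<Omega> v (\<lambda>x. 0)" for v
  proof -
    have zero: "(\<lambda>x. 0) \<in> H10 \<Omega>" by (rule H10_mean0_D(1)[OF zero_in_spaces(1)])
    note vH = H10div_I[OF v zero]
    have "vpair \<Omega> (P ?W) (weak_grad \<Omega> (\<lambda>x. 0)) = vpair \<Omega> (P ?W) (\<lambda>x. 0)"
      by (rule vpair_cong_AE_right[OF H10_mean0_D(5)[OF zero_in_spaces(1)] L2_zero weak_grad_eq_AE[OF has_weak_grad_const] P_L2[OF W]])
    then have "vpair \<Omega> (P ?W) (weak_grad \<Omega> (weak_div \<Omega> v)) = 0" by (simp add: vH(2)) (simp add: vpair_def)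
    moreover have "spair \<Omega> (weak_div \<Omega> v) \<phi> = spair \<Omega> (\<lambda>x. 0) \<phi>"
      by (rule spair_cong_AE[OF H0div_D(3)[OF v(1)] L2_zero weak_div_eq_AE[OF v(2)] \<phi>D(4)])
    then have "spair \<Omega> \<phi> (weak_div \<Omega> v) = 0" by (simp add: spair_commute[of \<Omega> \<phi>]) (simp add: spair_def)
    ultimately show ?thesis using key[OF vH(1)] lam by simp
  qed
  then obtain r where r: "r \<in> H1_mean0 \<Omega>" "AE x in lebesgue_on \<Omega>. weak_grad \<Omega> r x = g x"
    using gradient_if_orthogonal_to_div_free[OF g] by blast
  have rg: "vpair \<Omega> (weak_grad \<Omega> r) z = vpair \<Omega> g z" if "z \<in> L2 \<Omega>" for z
    by (rule vpair_cong_AE[OF H1_mean0_D(3)[OF r(1)] g r(2) that])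
  have "eigenpair2 \<Omega> A lam (\<phi>, y, r)"
    unfolding eigenpair2_iff
  proof (intro conjI ballI lam \<phi> y r(1))
    show "\<not> (AE x in lebesgue_on \<Omega>. \<phi> x = 0 \<and> y x = 0 \<and> r x = 0)"
    proof
      assume "AE x in lebesgue_on \<Omega>. \<phi> x = 0 \<and> y x = 0 \<and> r x = 0"
      then have "AE x in lebesgue_on \<Omega>. u x = 0"
        by eventually_elim (use lam in \<open>simp add: y_def\<close>)
      with nz show False ..
    qed
    show "vpair \<Omega> (P (weak_grad \<Omega> \<phi>)) (weak_grad \<Omega> \<psi>) + vpair \<Omega> (P y) (weak_grad \<Omega> \<psi>)
        = lam * (spair \<Omega> \<phi> \<psi> + spair \<Omega> r \<psi>)" if \<psi>: "\<psi> \<in> H10_mean0 \<Omega>" for \<psi>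
    proof -
      note \<psi>D = H10_mean0_D[OF \<psi>]
      \<comment> \<open>As \<open>\<psi>\<close> is the divergence of some \<open>v\<close>, the
        first equation is \<open>key\<close> for this \<open>v\<close>, once
        \<open>vpair \<Omega> g v\<close> is rewritten by Green's formula with
        \<open>r\<close>.\<close>
      obtain v where v: "v \<in> H0div \<Omega>" "has_weak_div \<Omega> v \<psi>" using weak_div_surjective[OF \<psi>D(3)] by blast
      note vH = H10div_I[OF v \<psi>D(1)]
      have dv: "spair \<Omega> w (weak_div \<Omega> v) = spair \<Omega> w \<psi>" if "w \<in> L2 \<Omega>" for w
        using spair_cong_AE[OF H0div_D(3)[OF v(1)] \<psi>D(4) weak_div_eq_AE[OF v(2)] that] by (simp add: spair_commute)
      have "vpair \<Omega> g v = vpair \<Omega> v (weak_grad \<Omega> r)"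
        using rg[OF H0div_D(2)[OF v(1)]] by (simp add: vpair_commute)
      also have "\<dots> = - spair \<Omega> r \<psi>"
        using H0div_D(4)[OF v(1) H1_mean0_in(1)[OF r(1)]] dv[OF H1_mean0_D(2)[OF r(1)]] by (simp add: spair_commute[of \<Omega> _ r])
      finally show ?thesis
        using key[OF vH(1)] by (simp add: vH(2) split \<psi>D dv \<phi>D)
    qed
    show "vpair \<Omega> (P (weak_grad \<Omega> \<phi>)) z + vpair \<Omega> y z + vpair \<Omega> (P y) z = vpair \<Omega> (weak_grad \<Omega> r) z" if "z \<in> L2 \<Omega>" for z
      unfolding rg[OF that] g_def[abs_def] by (simp add: vpair_add_left P_L2 W y that split)
    show "- vpair \<Omega> y (weak_grad \<Omega> s) = lam * spair \<Omega> \<phi> s" if "s \<in> H1_mean0 \<Omega>" for s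
      using H0div_D(4)[OF uD(1) H1_mean0_in(1)[OF that]]
      unfolding y_def[abs_def] vpair_cmult_left by (simp add: \<phi>_def)
  qed
  with r(1) show ?thesis unfolding \<phi>_def y_def[abs_def] by blast
qed

text \<open>Subtracting the two first equations leaves \<open>lam * (r' - r, \<psi>) = 0\<close> for
  all \<open>\<psi>\<close> of mean zero in \<open>H10 \<Omega>\<close>.\<close>

lemma eigenpair2_unique:
  assumes "eigenpair2 \<Omega> A lam (\<phi>, y, r)" "eigenpair2 \<Omega> A lam (\<phi>, y, r')"
  shows "AE x in lebesgue_on \<Omega>. r' x = r x"
proof -
  note E = assms[unfolded eigenpair2_iff]
  have r: "r \<in> H1_mean0 \<Omega>" "r' \<in> H1_mean0 \<Omega>" and lam: "lam \<noteq> 0" using E by auto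
  note L = H1_mean0_D(2,4)[OF r(1)] H1_mean0_D(2,4)[OF r(2)]
  have "AE x in lebesgue_on \<Omega>. r' x - r x = 0"
  proof (rule eq_0_if_orthogonal_to_H10_mean0)
    show "(\<lambda>x. r' x - r x) \<in> L2_mean0 \<Omega>"
      by (simp add: L2_mean0_def L2_diff spair_diff_left L one_L2)
    fix \<psi> assume \<psi>: "\<psi> \<in> H10_mean0 \<Omega>"
    have "lam * (spair \<Omega> \<phi> \<psi> + spair \<Omega> r \<psi>) = lam * (spair \<Omega> \<phi> \<psi> + spair \<Omega> r' \<psi>)"
      using E \<psi> by metis
    with lam show "spair \<Omega> (\<lambda>x. r' x - r x) \<psi> = 0"
      by (simp add: spair_diff_left L H10_mean0_D[OF \<psi>])
  qed
  then show ?thesis by eventually_elim simp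
qed

end

theorem theorem2p3:
  fixes \<Omega> :: "(real^'n) set" and A :: "real^'n \<Rightarrow> real^'n^'n"
  assumes dim: "CARD('n) \<in> {2, 3}"
    and dom: "polyhedral_domain \<Omega>"
    and meas: "A \<in> borel_measurable (lebesgue_on \<Omega>)"
    and spd: "\<forall>x\<in>\<Omega>. spd_matrix (A x)"
    and kappa: "0 < kappa_lower \<Omega> A" "kappa_lower \<Omega> A \<le> kappa_upper \<Omega> A" "kappa_upper \<Omega> A < 1"
  shows "(\<forall>lam \<phi> y r. eigenpair2 \<Omega> A lam (\<phi>, y, r) \<longrightarrow> eigenpair1 \<Omega> A lam (\<lambda>x. (1 / lam) *s y x)) \<and>
         (\<forall>lam u. eigenpair1 \<Omega> A lam u \<longrightarrow>
            (\<exists>r\<in>H1_mean0 \<Omega>.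
               eigenpair2 \<Omega> A lam (weak_div \<Omega> u, (\<lambda>x. lam *s u x), r) \<and>
               (\<forall>r'\<in>H1_mean0 \<Omega>.
                  eigenpair2 \<Omega> A lam (weak_div \<Omega> u, (\<lambda>x. lam *s u x), r') \<longrightarrow>
                  (AE x in lebesgue_on \<Omega>. r' x = r x))))"
proof -
  have ne: "\<Omega> \<noteq> {}" using dom by (simp add: polyhedral_domain_def)
  obtain a b where ab: "0 < a" "0 < b" "b < 1"
    "\<And>x \<xi>. x \<in> \<Omega> \<Longrightarrow> a * (norm \<xi>)\<^sup>2 \<le> \<xi> \<bullet> (A x *v \<xi>)"
    "\<And>x \<xi>. x \<in> \<Omega> \<Longrightarrow> \<xi> \<bullet> (A x *v \<xi>) \<le> b * (norm \<xi>)\<^sup>2"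
    using coefficient_bounds[OF ne kappa(1,3)] by blast
  note M = coefficient_matrix_properties[OF bspec[OF spd] ab(1,4,2,3,5), folded P_field_def]
  have Am: "(\<lambda>x. A x $ i $ j) \<in> borel_measurable (lebesgue_on \<Omega>)" for i j
    by (rule measurable_compose[OF meas borel_measurable_continuous_onI]) (intro continuous_intros)
  have Nm: "(\<lambda>x. matrix_inv (A x) $ i $ j) \<in> borel_measurable (lebesgue_on \<Omega>)" for i j
    by (rule matrix_inv_measurable[OF Am M(1)])
  have "(\<lambda>x. (matrix_inv (A x) - mat 1) $ i $ j) \<in> borel_measurable (lebesgue_on \<Omega>)" for i j
    unfolding vector_minus_component by (intro borel_measurable_diff Nm borel_measurable_const)
  then have Pm: "(\<lambda>x. P_field A x $ i $ j) \<in> borel_measurable (lebesgue_on \<Omega>)" for i j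
    unfolding P_field_def by (rule matrix_inv_measurable[OF _ M(2)])
  interpret bounded_open \<Omega> by (rule polyhedral_domain_bounded_open[OF dom])
  interpret admissible_coefficient \<Omega> A
  proof unfold_locales
    show "Poincare \<Omega>" by (rule polyhedral_domain_Poincare[OF dom])
    show "mapply (P_field A) w \<in> L2 \<Omega>" if "w \<in> L2 \<Omega>" for w
      by (rule mapply_L2[OF Pm M(8) that])
    show "mapply (\<lambda>x. matrix_inv (A x)) w \<in> L2 \<Omega>" if "w \<in> L2 \<Omega>" for w
    proof (rule mapply_L2[OF Nm _ that])
      show "norm (matrix_inv (A x) *v \<xi>) \<le> norm \<xi> * (1 / a)" if "x \<in> \<Omega>" for x \<xi>
        using M(7)[OF that that that, of \<xi>] by simp
    qed
  qed (use ne M in auto)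
  show ?thesis
  proof (intro conjI allI impI)
    fix lam \<phi> y r
    assume "eigenpair2 \<Omega> A lam (\<phi>, y, r)"
    then show "eigenpair1 \<Omega> A lam (\<lambda>x. (1 / lam) *s y x)" by (rule eigenpair2_imp_eigenpair1)
  next
    fix lam u
    assume "eigenpair1 \<Omega> A lam u"
    then obtain r where r: "r \<in> H1_mean0 \<Omega>" "eigenpair2 \<Omega> A lam (weak_div \<Omega> u, (\<lambda>x. lam *s u x), r)"
      using eigenpair1_imp_eigenpair2 by blast
    then show "\<exists>r\<in>H1_mean0 \<Omega>. eigenpair2 \<Omega> A lam (weak_div \<Omega> u, (\<lambda>x. lam *s u x), r) \<and>
        (\<forall>r'\<in>H1_mean0 \<Omega>. eigenpair2 \<Omega> A lam (weak_div \<Omega> u, (\<lambda>x. lam *s u x), r') \<longrightarrow>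
          (AE x in lebesgue_on \<Omega>. r' x = r x))"
      using eigenpair2_unique[OF r(2)] by (intro bexI[OF _ r(1)] conjI ballI impI)
  qed
qed

end
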